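(* Let $n\geq2$ and $m\geq1$ be integers, and let $\omega$ be a majorant satisfying $$\limsup_{t\to0^+}\frac{\omega(t)}{t}=c<\infty.$$ Let $\varphi_1\in\mathcal{L}_\omega(\mathbb{S}^{n-1},\mathbb{R}^m)$, $\varphi_2\in\mathcal{C}(\mathbb{S}^{n-1},\mathbb{R}^m)$ and $g\in\mathcal{C}(\overline{\mathbb{B}^n},\mathbb{R}^m)$. If $f$ satisfies the inhomogeneous biharmonic Dirichlet problem $$\Delta(\Delta f)=g \text{ in } \mathbb{B}^n,\qquad f=\varphi_1 \text{ on } \mathbb{S}^{n-1},\qquad \frac{\partial f}{\partial\mathbf{n}}=\varphi_2 \text{ on } \mathbb{S}^{n-1},$$ then $f\in\mathcal{L}_\omega(\mathbb{B}^n,\mathbb{R}^m)$.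
   Context: $\mathbb{B}^n$ is the open unit ball of $\mathbb{R}^n$, $\overline{\mathbb{B}^n}$ its closure, $\mathbb{S}^{n-1}$ the unit sphere, $|\cdot|$ the Euclidean norm, $\mathcal{C}(A,B)$ the set of continuous functions from $A$ to $B$, and $\Delta=\sum_{j=1}^n\partial^2/\partial x_j^2$ is the Laplacian (acting componentwise). A majorant is a continuous increasing function $\omega:[0,\infty)\to[0,\infty)$ with $\omega(0)=0$ such that $\omega(t)/t$ is non-increasing for $t>0$. For $\Omega\subset\mathbb{R}^n$, a function $u:\Omega\to\mathbb{R}^m$ belongs to $\mathcal{L}_\omega(\Omega,\mathbb{R}^m)$ if there is a constant $L>0$ such that $$\sup_{x,y\in\Omega,\,x\neq y}\frac{|u(x)-u(y)|}{\omega(|x-y|)}\leq L.$$ $\partial f/\partial\mathbf{n}=(\partial f_1/\partial\mathbf{n},\ldots,\partial f_m/\partial\mathbf{n})$ denotes differentiation in the inward normal direction. The boundary conditions are interpreted in the following distributional sense. For $r\in(0,1)$ put $f_r(\zeta)=f(r\zeta)$ for $\zeta\in\mathbb{S}^{n-1}$, and let $r\,\partial f_r/\partial\mathbf{n}$ be the inward normal derivative on $\mathbb{S}^{n-1}$ of $F(x)=f(rx)$ (that is, $-\frac{d}{dt}F(t\zeta)|_{t=1}$ at $\zeta$). Then, as $r\to1^-$, $f_r\to\varphi_1$ and $r(\partial f_r/\partial\mathbf{n})\to\varphi_2$. *)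

theory Defs
  imports "HOL-Analysis.Analysis"
begin

text \<open>
  A majorant is a function on \<open>[0,\<infinity>)\<close>; its values at negative arguments are irrelevant.
  ``Increasing'' is read in the weak sense, together with positivity on \<open>(0,\<infinity>)\<close>.  A strictly
  increasing \<open>\<omega>\<close> has this property; under the weak reading only \<open>\<omega> = 0\<close> lacks it (because
  \<open>\<omega> t / t\<close> is non-increasing), and for \<open>\<omega> = 0\<close> the quotients defining \<open>L\<^sub>\<omega>\<close> are meaningless.
\<close>

definition majorant :: "(real \<Rightarrow> real) \<Rightarrow> bool" where
  "majorant \<omega> \<longleftrightarrow>
     continuous_on {0..} \<omega> \<and> \<omega> 0 = 0 \<and> (\<forall>t>0. 0 < \<omega> t) \<and> mono_on {0..} \<omega> \<and>
     antimono_on {0<..} (\<lambda>t. \<omega> t / t)"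

definition lipschitz_class ::
    "(real \<Rightarrow> real) \<Rightarrow> 'a::metric_space set \<Rightarrow> ('a \<Rightarrow> 'b::metric_space) \<Rightarrow> bool" where
  "lipschitz_class \<omega> \<Omega> u \<longleftrightarrow>
     (\<exists>L>0. \<forall>x\<in>\<Omega>. \<forall>y\<in>\<Omega>. x \<noteq> y \<longrightarrow> dist (u x) (u y) / \<omega> (dist x y) \<le> L)"

definition partial :: "'n \<Rightarrow> (real ^ 'n \<Rightarrow> 'b::real_normed_vector) \<Rightarrow> real ^ 'n \<Rightarrow> 'b" where
  "partial i f x = vector_derivative (\<lambda>t. f (x + t *\<^sub>R axis i 1)) (at 0)"

definition laplacian ::
    "(real ^ 'n::finite \<Rightarrow> 'b::real_normed_vector) \<Rightarrow> real ^ 'n \<Rightarrow> 'b" where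
  "laplacian f x = (\<Sum>i\<in>UNIV. partial i (partial i f) x)"

text \<open>For open \<open>U\<close> this is the usual class \<open>C\<^sup>k(U)\<close>.\<close>

primrec Ck_on ::
    "nat \<Rightarrow> (real ^ 'n::finite) set \<Rightarrow> (real ^ 'n \<Rightarrow> 'b::real_normed_vector) \<Rightarrow> bool" where
  "Ck_on 0 U f \<longleftrightarrow> continuous_on U f"
| "Ck_on (Suc k) U f \<longleftrightarrow> (\<forall>x\<in>U. f differentiable (at x)) \<and> (\<forall>i. Ck_on k U (partial i f))"

text \<open>
  Surface measure on the unit sphere of \<open>\<real>\<^sup>n\<close>, obtained from Lebesgue measure by polar
  coordinates: \<open>\<sigma>(A)\<close> is \<open>n\<close> times the volume of the cone \<open>{x. 0 < \<bar>x\<bar> < 1 \<and> x/\<bar>x\<bar> \<in> A}\<close>.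
\<close>

definition sphere_measure :: "(real ^ 'n::finite) measure" where
  "sphere_measure =
     scale_measure (of_nat CARD('n))
       (distr (restrict_space lborel (ball 0 1 - {0})) (restrict_space borel (sphere 0 1)) sgn)"

lemma emeasure_sphere_measure:
  fixes A :: "(real ^ 'n::finite) set"
  assumes "A \<in> sets borel" "A \<subseteq> sphere 0 1"
  shows "emeasure sphere_measure A =
           of_nat CARD('n) * emeasure lborel {x. 0 < norm x \<and> norm x < 1 \<and> sgn x \<in> A}"
proof -
  have sgn_borel: "(sgn :: real ^ 'n \<Rightarrow> real ^ 'n) \<in> borel_measurable borel"
    unfolding sgn_div_norm by measurable
  have m: "sgn \<in> measurable (restrict_space lborel (ball 0 1 - {0}))
             (restrict_space borel (sphere (0 :: real ^ 'n) 1))"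
    by (intro measurable_restrict_space2 measurable_restrict_space1)
       (use sgn_borel in \<open>auto simp: space_restrict_space norm_sgn\<close>)
  have A: "A \<in> sets (restrict_space borel (sphere 0 1))"
    using assms by (auto simp: sets_restrict_space_iff)
  have eq: "sgn -` A \<inter> (ball 0 1 - {0}) =
        {x. 0 < norm x \<and> norm x < 1 \<and> sgn x \<in> A}"
    by auto
  have "emeasure (restrict_space lborel (ball 0 1 - {0}))
          {x. 0 < norm x \<and> norm x < 1 \<and> sgn x \<in> A} =
        emeasure lborel {x. 0 < norm x \<and> norm x < 1 \<and> sgn x \<in> A}"
    by (rule emeasure_restrict_space) auto
  then show ?thesis
    by (simp add: sphere_measure_def emeasure_distr[OF m A] space_restrict_space eq)
qed

text \<open>
  Convergence \<open>u\<^sub>r \<longlongrightarrow> v\<close> as \<open>r \<longlongrightarrow> 1-\<close> in the sense of (vector-valued) distributions on the sphere,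
  for functions on the sphere.  The smooth functions on the sphere are exactly
  the restrictions of smooth functions on \<open>\<real>\<^sup>n\<close>.
\<close>

definition sphere_distr_limit ::
    "(real \<Rightarrow> real ^ 'n::finite \<Rightarrow> real ^ 'm::finite) \<Rightarrow> (real ^ 'n \<Rightarrow> real ^ 'm) \<Rightarrow> bool" where
  "sphere_distr_limit u v \<longleftrightarrow>
     (\<forall>\<psi> :: real ^ 'n \<Rightarrow> real. (\<forall>k. Ck_on k UNIV \<psi>) \<longrightarrow>
        ((\<lambda>r. LINT \<zeta>|sphere_measure. \<psi> \<zeta> *\<^sub>R u r \<zeta>) \<longlongrightarrow>
           (LINT \<zeta>|sphere_measure. \<psi> \<zeta> *\<^sub>R v \<zeta>)) (at_left 1))"

definition inward_normal_deriv ::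
    "(real ^ 'n \<Rightarrow> 'b::real_normed_vector) \<Rightarrow> real ^ 'n \<Rightarrow> 'b" where
  "inward_normal_deriv F \<zeta> = - vector_derivative (\<lambda>t. F (t *\<^sub>R \<zeta>)) (at 1)"

text \<open>
  Classical solutions: \<open>f\<close> and \<open>\<Delta>f\<close> are both \<open>C\<^sup>2\<close>, which is what is needed to apply the Laplacian
  twice.  This is implied by \<open>f\<close> being \<open>C\<^sup>4\<close>.
\<close>

definition biharmonic_dirichlet ::
    "(real ^ 'n::finite \<Rightarrow> real ^ 'm::finite) \<Rightarrow> (real ^ 'n \<Rightarrow> real ^ 'm) \<Rightarrow>
     (real ^ 'n \<Rightarrow> real ^ 'm) \<Rightarrow> (real ^ 'n \<Rightarrow> real ^ 'm) \<Rightarrow> bool" where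
  "biharmonic_dirichlet g \<phi>\<^sub>1 \<phi>\<^sub>2 f \<longleftrightarrow>
     Ck_on 2 (ball 0 1) f \<and> Ck_on 2 (ball 0 1) (laplacian f) \<and>
     (\<forall>x\<in>ball 0 1. laplacian (laplacian f) x = g x) \<and>
     sphere_distr_limit (\<lambda>r \<zeta>. f (r *\<^sub>R \<zeta>)) \<phi>\<^sub>1 \<and>
     sphere_distr_limit (\<lambda>r. inward_normal_deriv (\<lambda>x. f (r *\<^sub>R x))) \<phi>\<^sub>2"

end

theory Submission
  imports Defs
begin

text \<open>
  Since \<open>\<omega> t / t\<close> is bounded near 0, the class \<open>L\<^sub>\<omega>\<close> on bounded sets consists of Lipschitz functions, so
  \<open>f\<close> has to be shown to be Lipschitz.  Write \<open>q = 1 - x \<bullet> x\<close> and let \<open>T\<close> be the biharmonic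
  extension of the boundary data, given by explicit kernels \<open>q\<^sup>i |x - z|\<^bsup>-2c\<^esup>\<close>.

  Neither a Green function nor the divergence theorem is needed; everything rests on the maximum principle.
  On a smaller ball, where \<open>f\<close> is smooth up to the boundary, \<open>U = q \<Delta>f + 4 x\<bullet>\<nabla>f + (2n - 8) f\<close> satisfies
  \<open>\<Delta>U = q \<Delta>\<^sup>2f\<close>, so it differs from the Poisson integral of its boundary values, which are
  combinations of the Dirichlet data, by a multiple of \<open>q sup |\<Delta>\<^sup>2f|\<close>.  The quotient
  \<open>e = (f - T) / q\<close> satisfies \<open>q\<^sup>2 \<Delta>e - 8 e = U - P[U]\<close>, which bounds \<open>e\<close> by the maximum principle and
  then \<open>q \<nabla>e\<close> by a gradient estimate for Poisson's equation on a box.  Hence \<open>f - T\<close> is Lipschitz with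
  a constant depending only on \<open>n\<close> and \<open>sup |\<Delta>\<^sup>2f|\<close>.  This survives the passage to the distributional
  boundary values, because \<open>T\<close> at a fixed point is a pairing with a smooth function on the sphere.
  Finally \<open>T\<close> itself is Lipschitz by direct estimation of its kernels.
\<close>

section \<open>Second derivatives along coordinate lines and the maximum principle\<close>

text \<open>\<open>U\<close> comes from an identity valid for every \<open>w\<close>:
  \<open>q\<^sup>2 \<Delta>(w / q) - 8 w / q = q \<Delta>w + 4 x \<bullet> \<nabla>w + (2n - 8)
  w\<close>. The coefficients 4 and \<open>2n - 8\<close> are also exactly those for which the terms
  with \<open>x \<bullet> \<nabla>\<Delta>w\<close> and \<open>\<Delta>w\<close> cancel in the
  Laplacian of the right-hand side. So the fourth-order problem, which has no maximum principle of
  its own, splits into two second-order ones that have one.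

  The Poisson integral of a Lipschitz function need not be Lipschitz: its radial derivative may grow
  like \<open>log (1 / q)\<close>. In \<open>T\<close> this growth cancels between the two Almansi
  summands, and \<open>T\<close> is therefore kept in an expanded form with a common factor
  \<open>q\<^sup>2\<close>, in which the cancellation has already taken place. The same factor
  absorbs the term with the normal derivative, whose datum is merely continuous.

  Near the sphere nothing is known about the size of \<open>f\<close> or its gradient; only
  integrals against smooth functions converge. Hence the bound on a smaller ball must not involve
  the boundary values taken there.\<close>

definition has_d2 :: "(real \<Rightarrow> real) \<Rightarrow> real \<Rightarrow> real \<Rightarrow> bool" where
  "has_d2 \<phi> p s \<longleftrightarrow> (\<exists>D. (\<forall>\<^sub>F t in nhds 0. (\<phi> has_real_derivative D t) (at t)) \<and> D 0 = p \<and>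
     (D has_real_derivative s) (at 0))"

lemma has_d2I:
  assumes "\<forall>\<^sub>F t in nhds 0. (\<phi> has_real_derivative D t) (at t)"
    and "(D has_real_derivative s) (at 0)" and "p = D 0"
  shows "has_d2 \<phi> p s"
  unfolding has_d2_def using assms by auto

lemma has_d2_DERIV: "has_d2 \<phi> p s \<Longrightarrow> (\<phi> has_real_derivative p) (at 0)"
  unfolding has_d2_def by (auto dest: eventually_nhds_x_imp_x)

lemma has_d2_const: "has_d2 (\<lambda>t. c) 0 0"
  by (rule has_d2I[where D = "\<lambda>_. 0"]) (auto intro!: always_eventually)

lemma has_d2_linear: "has_d2 (\<lambda>t. b * t + c) b 0"
  by (rule has_d2I[where D = "\<lambda>_. b"]) (auto intro!: always_eventually derivative_eq_intros)

lemma has_d2_add: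
  assumes "has_d2 \<phi> p s" "has_d2 \<psi> p' s'"
  shows "has_d2 (\<lambda>t. \<phi> t + \<psi> t) (p + p') (s + s')"
proof -
  obtain D where D: "\<forall>\<^sub>F t in nhds 0. (\<phi> has_real_derivative D t) (at t)" "D 0 = p"
    "(D has_real_derivative s) (at 0)" using assms(1) unfolding has_d2_def by auto
  obtain E where E: "\<forall>\<^sub>F t in nhds 0. (\<psi> has_real_derivative E t) (at t)" "E 0 = p'"
    "(E has_real_derivative s') (at 0)" using assms(2) unfolding has_d2_def by auto
  show ?thesis
  proof (rule has_d2I[where D = "\<lambda>t. D t + E t"])
    show "\<forall>\<^sub>F t in nhds 0. ((\<lambda>t. \<phi> t + \<psi> t) has_real_derivative D t + E t) (at t)"
      using D(1) E(1) by eventually_elim (auto intro!: derivative_eq_intros)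
  qed (use D E in \<open>auto intro!: derivative_eq_intros\<close>)
qed

lemma has_d2_mult:
  assumes "has_d2 \<phi> p s" "has_d2 \<psi> p' s'"
  shows "has_d2 (\<lambda>t. \<phi> t * \<psi> t) (p * \<psi> 0 + \<phi> 0 * p') (s * \<psi> 0 + 2 * p * p' + \<phi> 0 * s')"
proof -
  obtain D where D: "\<forall>\<^sub>F t in nhds 0. (\<phi> has_real_derivative D t) (at t)" "D 0 = p"
    "(D has_real_derivative s) (at 0)" using assms(1) unfolding has_d2_def by auto
  obtain E where E: "\<forall>\<^sub>F t in nhds 0. (\<psi> has_real_derivative E t) (at t)" "E 0 = p'"
    "(E has_real_derivative s') (at 0)" using assms(2) unfolding has_d2_def by auto
  note d = has_d2_DERIV[OF assms(1)] has_d2_DERIV[OF assms(2)]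
  show ?thesis
  proof (rule has_d2I[where D = "\<lambda>t. D t * \<psi> t + \<phi> t * E t"])
    show "\<forall>\<^sub>F t in nhds 0. ((\<lambda>t. \<phi> t * \<psi> t) has_real_derivative D t * \<psi> t + \<phi> t * E t) (at t)"
      using D(1) E(1) by eventually_elim (auto intro!: derivative_eq_intros)
    show "((\<lambda>t. D t * \<psi> t + \<phi> t * E t) has_real_derivative s * \<psi> 0 + 2 * p * p' + \<phi> 0 * s') (at 0)"
      using D(2,3) E(2,3) d by (auto intro!: derivative_eq_intros simp: algebra_simps)
  qed (use D E in auto)
qed

lemma has_d2_inverse:
  assumes "has_d2 \<phi> p s" "\<phi> 0 \<noteq> 0"
  shows "has_d2 (\<lambda>t. inverse (\<phi> t)) (- p / \<phi> 0 ^ 2) (2 * p ^ 2 / \<phi> 0 ^ 3 - s / \<phi> 0 ^ 2)"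
proof -
  obtain D where D: "\<forall>\<^sub>F t in nhds 0. (\<phi> has_real_derivative D t) (at t)" "D 0 = p"
    "(D has_real_derivative s) (at 0)" using assms(1) unfolding has_d2_def by auto
  note d = has_d2_DERIV[OF assms(1)]
  have "(\<phi> \<longlongrightarrow> \<phi> 0) (nhds 0)"
    using DERIV_isCont[OF d] by (simp add: isCont_def tendsto_at_iff_tendsto_nhds)
  then have ne: "\<forall>\<^sub>F t in nhds 0. \<phi> t \<noteq> 0"
    using assms(2) by (rule tendsto_imp_eventually_ne)
  show ?thesis
  proof (rule has_d2I[where D = "\<lambda>t. - (D t / \<phi> t ^ 2)"])
    show "\<forall>\<^sub>F t in nhds 0. ((\<lambda>t. inverse (\<phi> t)) has_real_derivative - (D t / \<phi> t ^ 2)) (at t)"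
      using D(1) ne
      by eventually_elim (auto intro!: derivative_eq_intros simp: field_simps power2_eq_square)
    show "((\<lambda>t. - (D t / \<phi> t ^ 2)) has_real_derivative 2 * p ^ 2 / \<phi> 0 ^ 3 - s / \<phi> 0 ^ 2) (at 0)"
      using D(2,3) d assms(2)
      by (auto intro!: derivative_eq_intros simp: field_simps power2_eq_square power3_eq_cube)
  qed (use D in auto)
qed

lemma has_d2_cong:
  assumes "\<forall>\<^sub>F t in nhds 0. \<phi> t = \<psi> t" "has_d2 \<psi> p s"
  shows "has_d2 \<phi> p s"
proof -
  obtain D where D: "\<forall>\<^sub>F t in nhds 0. (\<psi> has_real_derivative D t) (at t)" "D 0 = p"
    "(D has_real_derivative s) (at 0)" using assms(2) unfolding has_d2_def by auto
  have "\<forall>\<^sub>F t in nhds 0. \<forall>\<^sub>F u in nhds t. \<phi> u = \<psi> u"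
    using assms(1) by (simp add: eventually_eventually)
  then have "\<forall>\<^sub>F t in nhds 0. (\<phi> has_real_derivative D t) (at t)"
    using D(1) by eventually_elim (simp add: DERIV_cong_ev)
  from has_d2I[OF this D(3)] show ?thesis using D(2) by simp
qed

lemma has_d2_scale:
  assumes "has_d2 \<phi> p s"
  shows "has_d2 (\<lambda>t. \<phi> (r * t)) (r * p) (r\<^sup>2 * s)"
proof -
  obtain D where D: "\<forall>\<^sub>F t in nhds 0. (\<phi> has_real_derivative D t) (at t)" "D 0 = p"
    "(D has_real_derivative s) (at 0)" using assms(1) unfolding has_d2_def by auto
  have lim: "filterlim (\<lambda>t::real. r * t) (nhds 0) (nhds 0)"
    by (auto intro!: tendsto_eq_intros filterlim_ident)
  show ?thesis
  proof (rule has_d2I[where D = "\<lambda>t. r * D (r * t)"])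
    show "\<forall>\<^sub>F t in nhds 0. ((\<lambda>t. \<phi> (r * t)) has_real_derivative r * D (r * t)) (at t)"
      using eventually_compose_filterlim[OF D(1) lim]
    proof eventually_elim
      case (elim t)
      have "((\<lambda>t. r * t) has_real_derivative r) (at t)" by (auto intro!: derivative_eq_intros)
      from DERIV_chain2[where f = \<phi> and g = "\<lambda>t. r * t" and x = t and s = UNIV, OF elim this]
      show ?case by (simp add: mult.commute)
    qed
    have "((\<lambda>t. D (r * t)) has_real_derivative s * r) (at 0)"
      using DERIV_chain2[of D s "\<lambda>t. r * t" 0 r UNIV] D(3)
      by (auto intro!: derivative_eq_intros)
    from DERIV_cmult[OF this, of r]
    show "((\<lambda>t. r * D (r * t)) has_real_derivative r\<^sup>2 * s) (at 0)"
      by (simp add: power2_eq_square mult_ac)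
  qed (use D in auto)
qed

text \<open>A positive second derivative at a critical point makes the first derivative positive
  just to the right of 0, and the mean value theorem then lifts \<open>\<phi>\<close> above
  \<open>\<phi> 0\<close>. This is the one-dimensional core of the maximum principles.\<close>

lemma has_d2_local_max:
  assumes "has_d2 \<phi> p s" and "\<forall>\<^sub>F t in nhds 0. \<phi> t \<le> \<phi> 0"
  shows "s \<le> 0"
proof (rule ccontr)
  assume "\<not> s \<le> 0"
  obtain D where D: "\<forall>\<^sub>F t in nhds 0. (\<phi> has_real_derivative D t) (at t)" "D 0 = p"
    "(D has_real_derivative s) (at 0)" using assms(1) unfolding has_d2_def by auto
  from assms(2) obtain d0 where d0: "d0 > 0" "\<And>t. \<bar>t\<bar> < d0 \<Longrightarrow> \<phi> t \<le> \<phi> 0"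
    unfolding eventually_nhds_metric by (auto simp: dist_real_def)
  have "p = 0"
    using DERIV_local_max[OF has_d2_DERIV[OF assms(1)], of d0] d0 by auto
  from D(1) obtain d1 where d1: "d1 > 0" "\<And>t. \<bar>t\<bar> < d1 \<Longrightarrow> (\<phi> has_real_derivative D t) (at t)"
    unfolding eventually_nhds_metric by (auto simp: dist_real_def)
  from DERIV_pos_inc_right[OF D(3)] \<open>\<not> s \<le> 0\<close> obtain d2
    where d2: "d2 > 0" "\<And>h. 0 < h \<Longrightarrow> h < d2 \<Longrightarrow> D 0 < D h" by auto
  define t where "t = min d0 (min d1 d2) / 2"
  have t: "0 < t" "t < d0" "t < d1" "t < d2" using d0(1) d1(1) d2(1) by (auto simp: t_def)
  have "\<exists>z. 0 < z \<and> z < t \<and> \<phi> t - \<phi> 0 = (t - 0) * D z"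
    by (rule MVT2) (use t d1 in auto)
  then obtain z where z: "0 < z" "z < t" "\<phi> t - \<phi> 0 = t * D z" by auto
  have "D z > 0" using d2(2)[of z] z t D(2) \<open>p = 0\<close> by auto
  then have "\<phi> t > \<phi> 0" using z t by (smt (verit) mult_pos_pos)
  with d0(2)[of t] t show False by auto
qed

text \<open>
  Only second derivatives along the coordinate lines through \<^term>\<open>x\<close> enter, so no
  continuity of the second derivatives is required.
\<close>

definition has_lap :: "(real ^ 'n::finite \<Rightarrow> real) \<Rightarrow> real ^ 'n \<Rightarrow> real ^ 'n \<Rightarrow> real \<Rightarrow> bool" where
  "has_lap u x p s \<longleftrightarrow> (\<exists>q. (\<forall>i. has_d2 (\<lambda>t. u (x + t *\<^sub>R axis i 1)) (p $ i) (q i)) \<and> s = sum q UNIV)"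

lemma has_lapI:
  assumes "\<And>i. has_d2 (\<lambda>t. u (x + t *\<^sub>R axis i 1)) (p $ i) (q i)" "s = sum q UNIV"
  shows "has_lap u x p s"
  unfolding has_lap_def using assms by blast

lemma has_lap_const: "has_lap (\<lambda>_. c) x 0 0"
  by (rule has_lapI[where q = "\<lambda>_. 0"]) (auto intro: has_d2_const)

lemma has_lap_add:
  assumes "has_lap u x p s" "has_lap v x p' s'"
  shows "has_lap (\<lambda>x. u x + v x) x (p + p') (s + s')"
proof -
  obtain q q' where q: "\<And>i. has_d2 (\<lambda>t. u (x + t *\<^sub>R axis i 1)) (p $ i) (q i)" "s = sum q UNIV"
    and q': "\<And>i. has_d2 (\<lambda>t. v (x + t *\<^sub>R axis i 1)) (p' $ i) (q' i)" "s' = sum q' UNIV"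
    using assms unfolding has_lap_def by auto
  show ?thesis
    by (rule has_lapI[where q = "\<lambda>i. q i + q' i"])
      (use has_d2_add[OF q(1) q'(1)] q(2) q'(2) in \<open>auto simp: sum.distrib\<close>)
qed

lemma has_lap_mult:
  assumes "has_lap u x p s" "has_lap v x p' s'"
  shows "has_lap (\<lambda>x. u x * v x) x (v x *\<^sub>R p + u x *\<^sub>R p') (s * v x + 2 * (p \<bullet> p') + u x * s')"
proof -
  obtain q q' where q: "\<And>i. has_d2 (\<lambda>t. u (x + t *\<^sub>R axis i 1)) (p $ i) (q i)" "s = sum q UNIV"
    and q': "\<And>i. has_d2 (\<lambda>t. v (x + t *\<^sub>R axis i 1)) (p' $ i) (q' i)" "s' = sum q' UNIV"
    using assms unfolding has_lap_def by auto
  show ?thesis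
    by (rule has_lapI[where q = "\<lambda>i. q i * v x + 2 * (p $ i) * (p' $ i) + u x * q' i"])
      (use has_d2_mult[OF q(1) q'(1)] q(2) q'(2) in
        \<open>auto simp: sum.distrib sum_distrib_left sum_distrib_right inner_vec_def mult_ac\<close>)
qed

lemma has_lap_cmult:
  assumes "has_lap u x p s"
  shows "has_lap (\<lambda>x. c * u x) x (c *\<^sub>R p) (c * s)"
  using has_lap_mult[OF has_lap_const assms, of c] by simp

lemma has_lap_diff:
  assumes "has_lap u x p s" "has_lap v x p' s'"
  shows "has_lap (\<lambda>x. u x - v x) x (p - p') (s - s')"
  using has_lap_add[OF assms(1) has_lap_cmult[OF assms(2), of "-1"]] by simp

lemma has_lap_inverse:
  assumes "has_lap u x p s" "u x \<noteq> 0"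
  shows "has_lap (\<lambda>x. inverse (u x)) x (- (1 / u x ^ 2) *\<^sub>R p)
    (2 * (p \<bullet> p) / u x ^ 3 - s / u x ^ 2)"
proof -
  obtain q where q: "\<And>i. has_d2 (\<lambda>t. u (x + t *\<^sub>R axis i 1)) (p $ i) (q i)" "s = sum q UNIV"
    using assms unfolding has_lap_def by auto
  show ?thesis
    by (rule has_lapI[where q = "\<lambda>i. 2 * (p $ i)^2 / u x ^ 3 - q i / u x ^ 2"])
      (use has_d2_inverse[OF q(1)] q(2) assms(2) in
        \<open>auto simp: sum_subtractf sum_distrib_left sum_divide_distrib inner_vec_def power2_eq_square\<close>)
qed

lemma has_lap_coord: "has_lap (\<lambda>x. x $ k) x (axis k 1) 0"
proof (rule has_lapI[where q = "\<lambda>_. 0"])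
  fix i
  have "has_d2 (\<lambda>t. (axis i 1 $ k) * t + x $ k) (axis i 1 $ k) 0" by (rule has_d2_linear)
  then show "has_d2 (\<lambda>t. (x + t *\<^sub>R axis i 1) $ k) (axis k 1 $ i) 0"
    by (simp add: algebra_simps) (simp add: axis_def eq_commute)
qed auto

lemma has_lap_norm2:
  "has_lap (\<lambda>x. x \<bullet> x) x (2 *\<^sub>R x) (2 * real CARD('n))" for x :: "real ^ 'n::finite"
proof (rule has_lapI[where q = "\<lambda>_. 2"])
  fix i
  have "has_d2 (\<lambda>t. t * t + (2 * x $ i) * t + x \<bullet> x) (2 * x $ i) 2"
    using has_d2_add[OF has_d2_mult[OF has_d2_linear[of 1 0] has_d2_linear[of 1 0]]
        has_d2_linear[of "2 * x $ i" "x \<bullet> x"]] by (simp add: add.assoc)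
  then show "has_d2 (\<lambda>t. (x + t *\<^sub>R axis i 1) \<bullet> (x + t *\<^sub>R axis i 1)) ((2 *\<^sub>R x) $ i) 2"
    by (simp add: algebra_simps inner_axis inner_axis_axis inner_commute[of "axis i 1" x])
qed auto

lemma eventually_add_axis:
  fixes x :: "real ^ 'n::finite"
  assumes "\<forall>\<^sub>F y in nhds x. P y"
  shows "\<forall>\<^sub>F t in nhds 0. P (x + t *\<^sub>R axis i 1)"
proof -
  have "((\<lambda>t. x + t *\<^sub>R axis i 1) \<longlongrightarrow> x + 0 *\<^sub>R axis i 1) (nhds (0::real))"
    by (intro tendsto_intros filterlim_ident)
  then have "filterlim (\<lambda>t. x + t *\<^sub>R axis i 1) (nhds x) (nhds (0::real))" by simp
  from eventually_compose_filterlim[OF assms this] show ?thesis .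
qed

lemma has_lap_cong:
  assumes "\<forall>\<^sub>F y in nhds x. u y = v y" "has_lap v x p s"
  shows "has_lap u x p s"
proof -
  obtain q where q: "\<And>i. has_d2 (\<lambda>t. v (x + t *\<^sub>R axis i 1)) (p $ i) (q i)" "s = sum q UNIV"
    using assms unfolding has_lap_def by auto
  have "has_d2 (\<lambda>t. u (x + t *\<^sub>R axis i 1)) (p $ i) (q i)" for i
  proof (rule has_d2_cong[OF _ q(1)])
    show "\<forall>\<^sub>F t in nhds 0. u (x + t *\<^sub>R axis i 1) = v (x + t *\<^sub>R axis i 1)"
      by (rule eventually_add_axis[OF assms(1)])
  qed
  then show ?thesis using q(2) by (rule has_lapI)
qed

lemma has_lap_scale:
  assumes "has_lap u (r *\<^sub>R x) p s"
  shows "has_lap (\<lambda>x. u (r *\<^sub>R x)) x (r *\<^sub>R p) (r\<^sup>2 * s)"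
proof -
  obtain q where q: "\<And>i. has_d2 (\<lambda>t. u (r *\<^sub>R x + t *\<^sub>R axis i 1)) (p $ i) (q i)" "s = sum q UNIV"
    using assms unfolding has_lap_def by auto
  show ?thesis
    by (rule has_lapI[where q = "\<lambda>i. r\<^sup>2 * q i"])
      (use has_d2_scale[OF q(1), of r] q(2) in \<open>auto simp: sum_distrib_left scaleR_right_distrib\<close>)
qed

lemma has_lap_translate:
  assumes "has_lap u (a + x) p s"
  shows "has_lap (\<lambda>x. u (a + x)) x p s"
  using assms unfolding has_lap_def by (simp add: add.assoc)

text \<open>Boundary condition and differential inequality are merged into one hypothesis about the
  points where \<open>w\<close> is positive: such a point is interior and has positive Laplacian, so
  it cannot be a maximum. In this form zeroth-order terms whose sign is known only where
  \<open>w > 0\<close> can be absorbed.\<close>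

lemma max_principle:
  fixes w :: "real ^ 'n::finite \<Rightarrow> real"
  assumes K: "compact K" "continuous_on K w"
    and pos: "\<And>x. x \<in> K \<Longrightarrow> w x > 0 \<Longrightarrow> x \<in> interior K \<and> (\<exists>p s. has_lap w x p s \<and> s > 0)"
    and x: "x \<in> K"
  shows "w x \<le> 0"
proof (rule ccontr)
  assume "\<not> w x \<le> 0"
  obtain z where z: "z \<in> K" "\<And>y. y \<in> K \<Longrightarrow> w y \<le> w z"
    using continuous_attains_sup[OF K(1) _ K(2)] x by (metis empty_iff)
  have "w z > 0" using z(2)[OF x] \<open>\<not> w x \<le> 0\<close> by auto
  then obtain p s where ps: "z \<in> interior K" "has_lap w z p s" "s > 0" using pos[OF z(1)] by blast
  obtain q where q: "\<And>i. has_d2 (\<lambda>t. w (z + t *\<^sub>R axis i 1)) (p $ i) (q i)" "s = sum q UNIV"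
    using ps(2) unfolding has_lap_def by auto
  have ev: "\<forall>\<^sub>F y in nhds z. y \<in> K"
    using eventually_nhds_in_open[OF open_interior ps(1)]
    by eventually_elim (use interior_subset in blast)
  have "q i \<le> 0" for i
  proof (rule has_d2_local_max[OF q(1)])
    show "\<forall>\<^sub>F t in nhds 0. w (z + t *\<^sub>R axis i 1) \<le> w (z + 0 *\<^sub>R axis i 1)"
      using eventually_add_axis[OF ev, of i]
      by eventually_elim (use z in auto)
  qed
  then have "s \<le> 0" unfolding q(2) by (simp add: sum_nonpos)
  with ps(3) show False by simp
qed

lemma max_principle_ball:
  fixes w :: "real ^ 'n::finite \<Rightarrow> real"
  assumes w: "continuous_on (ball 0 1) w"
    and bd: "\<And>e. e > 0 \<Longrightarrow> \<exists>d<1. \<forall>x. d < norm x \<longrightarrow> norm x < 1 \<longrightarrow> w x \<le> e"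
    and pos: "\<And>x. norm x < 1 \<Longrightarrow> w x > 0 \<Longrightarrow> \<exists>p s. has_lap w x p s \<and> s > 0"
    and x: "norm x < 1"
  shows "w x \<le> 0"
proof (rule field_le_epsilon)
  fix e :: real assume e: "e > 0"
  obtain d where d: "d < 1" "\<And>x. d < norm x \<Longrightarrow> norm x < 1 \<Longrightarrow> w x \<le> e" using bd[OF e] by blast
  \<comment> \<open>The radius lies beyond both \<open>d\<close> and \<open>norm x\<close>: the
    closed ball contains \<open>x\<close>, and \<open>w\<close> exceeds \<open>e\<close> only in its
    interior.\<close>
  define d' where "d' = (1 + max (max d 0) (norm x)) / 2"
  have d': "max (max d 0) (norm x) < d'" "d' < 1" using d x by (auto simp: d'_def)
  have "w x - e \<le> 0"
  proof (rule max_principle[where K = "cball 0 d'" and w = "\<lambda>x. w x - e"])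
    show "continuous_on (cball 0 d') (\<lambda>x. w x - e)"
      by (intro continuous_intros continuous_on_subset[OF w]) (use d' in auto)
    fix y assume y: "y \<in> cball 0 d'" "w y - e > 0"
    have "norm y < 1" using y d' by auto
    have "norm y \<le> d"
    proof (rule ccontr)
      assume "\<not> norm y \<le> d"
      then have "w y \<le> e" using d(2)[OF _ \<open>norm y < 1\<close>] by simp
      with y(2) show False by simp
    qed
    then have "y \<in> interior (cball 0 d')" using d' by (auto simp: interior_cball)
    moreover obtain p s where ps: "has_lap w y p s" "s > 0"
      using pos[OF \<open>norm y < 1\<close>] y e by auto
    have "has_lap (\<lambda>x. w x - e) y (p - 0) (s - 0)"
      by (rule has_lap_diff[OF ps(1) has_lap_const])
    ultimately show "y \<in> interior (cball 0 d') \<and> (\<exists>p s. has_lap (\<lambda>x. w x - e) y p s \<and> s > 0)"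
      using ps by auto
  qed (use d' in auto)
  then show "w x \<le> 0 + e" by simp
qed

section \<open>Interior gradient estimate for Poisson's equation on a cube\<close>

lemma has_lap_reflect:
  fixes v :: "real ^ 'n::finite \<Rightarrow> real"
  assumes "has_lap v (y - (2 * y $ k) *\<^sub>R axis k 1) p s"
  shows "\<exists>p'. has_lap (\<lambda>y. v (y - (2 * y $ k) *\<^sub>R axis k 1)) y p' s"
proof -
  obtain q where q: "\<And>i. has_d2 (\<lambda>t. v (y - (2 * y $ k) *\<^sub>R axis k 1 + t *\<^sub>R axis i 1)) (p $ i) (q i)"
    "s = sum q UNIV" using assms unfolding has_lap_def by auto
  \<comment> \<open>Along \<open>axis k 1\<close> the reflection reverses the parameter, which flips
    the first derivative and leaves the second alone; along the other axes it only moves the base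
    point.\<close>
  have "has_lap (\<lambda>y. v (y - (2 * y $ k) *\<^sub>R axis k 1)) y (\<chi> i. if i = k then - p $ i else p $ i) s"
  proof (rule has_lapI[OF _ q(2)])
    fix i
    show "has_d2 (\<lambda>t. v (y + t *\<^sub>R axis i 1 - (2 * (y + t *\<^sub>R axis i 1) $ k) *\<^sub>R axis k 1))
        ((\<chi> i. if i = k then - p $ i else p $ i) $ i) (q i)"
    proof (cases "i = k")
      case True
      have eq: "y + t *\<^sub>R axis k 1 - (2 * (y + t *\<^sub>R axis k 1) $ k) *\<^sub>R axis k 1 =
        y - (2 * y $ k) *\<^sub>R axis k 1 + (-1 * t) *\<^sub>R axis k 1" for t
        by (simp add: vec_eq_iff axis_def algebra_simps)
      show ?thesis
        unfolding True eq using has_d2_scale[OF q(1)[of k], of "-1"] by simp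
    next
      case False
      have eq: "y + t *\<^sub>R axis i 1 - (2 * (y + t *\<^sub>R axis i 1) $ k) *\<^sub>R axis k 1 =
        y - (2 * y $ k) *\<^sub>R axis k 1 + t *\<^sub>R axis i 1" for t
        using False by (simp add: axis_def algebra_simps)
      show ?thesis unfolding eq using q(1)[of i] False by simp
    qed
  qed
  then show ?thesis by blast
qed

text \<open>The classical barrier argument: half the difference of \<open>u\<close> and its mirror
  image in the hyperplane through \<open>x0\<close> orthogonal to \<open>axis k 1\<close> vanishes
  on that hyperplane, is at most \<open>M\<close> elsewhere, and has slope \<open>p $ k\<close> at
  the centre. Comparing it on the half cube with an explicit quadratic that also vanishes at the
  centre bounds the slope.\<close>

lemma box_gradient_bound_upper:
  fixes u :: "real ^ 'n::finite \<Rightarrow> real"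
  assumes d: "d > 0"
    and cont: "continuous_on {y. \<forall>i. \<bar>y $ i - x0 $ i\<bar> \<le> d} u"
    and bd: "\<And>y. \<forall>i. \<bar>y $ i - x0 $ i\<bar> \<le> d \<Longrightarrow> \<bar>u y\<bar> \<le> M"
    and lap: "\<And>y. \<forall>i. \<bar>y $ i - x0 $ i\<bar> \<le> d \<Longrightarrow> \<exists>p s. has_lap u y p s \<and> \<bar>s\<bar> < S"
    and x0: "has_lap u x0 p s0"
  shows "p $ k \<le> real CARD('n) * M / d + S * d / 2"
proof -
  define n where "n = real CARD('n)"
  have n: "n \<ge> 1" unfolding n_def by (simp add: Suc_leI)
  have M: "M \<ge> 0" using bd[of x0] d by auto
  have S: "S > 0" using lap[of x0] d by fastforce
  define v where "v y = u (x0 + y)" for y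
  define R where "R y = y - (2 * y $ k) *\<^sub>R axis k 1" for y :: "real ^ 'n"
  have Ri: "\<bar>R y $ i\<bar> = \<bar>y $ i\<bar>" for y i
    by (simp add: R_def axis_def)
  define a b :: "real ^ 'n" where "a = (\<chi> i. if i = k then 0 else - d)" and "b = (\<chi> i. d)"
  have memK: "y \<in> cbox a b \<longleftrightarrow> (\<forall>i. \<bar>y $ i\<bar> \<le> d) \<and> 0 \<le> y $ k" for y
    by (auto simp: a_def b_def mem_box_cart abs_le_iff split: if_splits)
       (smt (verit, best))+
  have memI: "y \<in> box a b" if "\<forall>i. \<bar>y $ i\<bar> < d" "0 < y $ k" for y
    using that by (auto simp: a_def b_def mem_box_cart abs_less_iff minus_less_iff split: if_splits)
  \<comment> \<open>The \<open>M\<close> part of the barrier is harmonic, since the coefficient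
    \<open>n\<close> makes its Laplacian \<open>2n - 2n\<close>, and it is at least \<open>M\<close>
    on the outer faces because \<open>y \<bullet> y \<ge> d\<^sup>2\<close> there. The
    \<open>S\<close> part has Laplacian \<open>- S\<close>, which outweighs that of the odd part of
    \<open>v\<close>.\<close>
  define w where "w y = (1/2) * (v y - v (R y)) -
     (M / d\<^sup>2) * (y \<bullet> y - n * (y $ k * y $ k) + (n * d) * y $ k) - (S / 2) * (y $ k * (d - y $ k))" for y
  have contv: "continuous_on {y. \<forall>i. \<bar>y $ i\<bar> \<le> d} v"
    unfolding v_def by (rule continuous_on_compose2[OF cont]) (auto intro!: continuous_intros)
  have contR: "continuous_on (cbox a b) (\<lambda>y. v (R y))"
    by (rule continuous_on_compose2[OF contv]) (auto intro!: continuous_intros simp: Ri memK, auto intro!: continuous_intros simp: R_def)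
  have w0: "w y \<le> 0" if "y \<in> cbox a b" for y
  proof (rule max_principle[OF compact_cbox _ _ that])
    have "continuous_on (cbox a b) v" by (rule continuous_on_subset[OF contv]) (auto simp: memK)
    with contR show "continuous_on (cbox a b) w"
      unfolding w_def by (intro continuous_intros)
    fix y assume y: "y \<in> cbox a b" "w y > 0"
    then have yd: "\<forall>i. \<bar>y $ i\<bar> \<le> d" and yk: "0 \<le> y $ k" by (auto simp: memK)
    have ykd: "y $ k \<le> d" using yd by (metis abs_le_D1)
    have nn: "n * (y $ k * (d - y $ k)) \<ge> 0" using yk ykd n by auto
    have nn2: "(S / 2) * (y $ k * (d - y $ k)) \<ge> 0" using yk ykd S by auto
    have vM: "(1/2) * (v y - v (R y)) \<le> M"
      using bd[of "x0 + y"] bd[of "x0 + R y"] yd by (simp add: v_def Ri)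
    have ik: "\<bar>y $ i\<bar> < d" for i
    proof (rule ccontr)
      assume "\<not> \<bar>y $ i\<bar> < d"
      then have "(y $ i)\<^sup>2 = d\<^sup>2" using yd by (metis order_less_le power2_abs)
      have "(y $ i)\<^sup>2 \<le> (norm y)\<^sup>2" by (metis component_le_norm_cart abs_ge_zero power2_abs power_mono)
      with \<open>(y $ i)\<^sup>2 = d\<^sup>2\<close> have "d\<^sup>2 \<le> y \<bullet> y" by (simp add: power2_norm_eq_inner)
      then have "d\<^sup>2 \<le> y \<bullet> y - n * (y $ k * y $ k) + (n * d) * y $ k"
        using nn by (simp add: algebra_simps)
      then have "M / d\<^sup>2 * d\<^sup>2 \<le> M / d\<^sup>2 * (y \<bullet> y - n * (y $ k * y $ k) + (n * d) * y $ k)"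
        using M by (intro mult_left_mono) auto
      then have "M \<le> M / d\<^sup>2 * (y \<bullet> y - n * (y $ k * y $ k) + (n * d) * y $ k)" using d by simp
      with vM nn2 y(2) show False unfolding w_def by linarith
    qed
    have "0 < y $ k"
    proof (rule ccontr)
      assume "\<not> 0 < y $ k"
      then have "y $ k = 0" using yk by simp
      then have "R y = y" "w y = - (M / d\<^sup>2 * (y \<bullet> y))" by (auto simp: R_def w_def)
      moreover have "M / d\<^sup>2 * (y \<bullet> y) \<ge> 0" using M by auto
      ultimately show False using y(2) by linarith
    qed
    then have "y \<in> interior (cbox a b)" using ik by (auto intro: memI)
    moreover obtain p1 s1 where 1: "has_lap u (x0 + y) p1 s1" "\<bar>s1\<bar> < S"
      using lap[of "x0 + y"] yd by auto
    obtain p2 s2 where 2: "has_lap u (x0 + R y) p2 s2" "\<bar>s2\<bar> < S"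
      using lap[of "x0 + R y"] yd by (auto simp: Ri)
    obtain p3 where 3: "has_lap (\<lambda>y. v (R y)) y p3 s2"
      using has_lap_reflect[of v y k p2 s2] has_lap_translate[OF 2(1)] unfolding v_def R_def by auto
    note c = has_lap_coord[of k y]
    note h = has_lap_diff[OF has_lap_diff[OF has_lap_cmult[OF has_lap_diff[OF has_lap_translate[OF 1(1)] 3], of "1/2"]
       has_lap_cmult[OF has_lap_add[OF has_lap_diff[OF has_lap_norm2 has_lap_cmult[OF has_lap_mult[OF c c], of n]]
          has_lap_cmult[OF c, of "n * d"]], of "M / d\<^sup>2"]]
       has_lap_cmult[OF has_lap_mult[OF c has_lap_diff[OF has_lap_const c, of d]], of "S/2"]]
    have "\<exists>p. has_lap w y p ((s1 - s2) / 2 + S)"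
      using h unfolding v_def[symmetric] w_def[abs_def] by (auto simp: inner_axis_axis n_def)
    moreover have "(s1 - s2) / 2 + S > 0" using 1(2) 2(2) unfolding abs_less_iff by (simp add: field_simps)
    ultimately show "y \<in> interior (cbox a b) \<and> (\<exists>p s. has_lap w y p s \<and> s > 0)" by blast
  qed
  \<comment> \<open>Barrier minus odd part, restricted to the \<open>k\<close>-th axis. It is 0 at 0
    and nonnegative to the right, so its derivative at 0 is nonnegative, and this is the claimed
    inequality.\<close>
  define g where "g t = (M / d\<^sup>2) * (t * t - n * (t * t) + (n * d) * t) + (S / 2) * (t * (d - t))
      - (1/2) * (u (x0 + t *\<^sub>R axis k 1) - u (x0 + (-1 * t) *\<^sub>R axis k 1))" for t
  have g0: "g 0 = 0" by (simp add: g_def)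
  have gp: "g t \<ge> 0" if "0 < t" "t < d" for t
  proof -
    have mem: "t *\<^sub>R axis k 1 \<in> cbox a b" using that by (auto simp: memK axis_def)
    have R: "R (t *\<^sub>R axis k 1) = (-1 * t) *\<^sub>R axis k 1"
      unfolding R_def vec_eq_iff by (auto simp: axis_def)
    have c: "(t *\<^sub>R axis k 1 :: real ^ 'n) $ k = t" by (simp add: axis_def)
    have i: "(t *\<^sub>R axis k 1) \<bullet> (t *\<^sub>R axis k 1 :: real ^ 'n) = t * t" by (simp add: inner_axis_axis)
    show ?thesis
      using w0[OF mem] unfolding w_def g_def v_def R c i by linarith
  qed
  have p: "((\<lambda>t. u (x0 + t *\<^sub>R axis k 1)) has_real_derivative p $ k) (at 0)"
    and p': "((\<lambda>t. u (x0 + (-1 * t) *\<^sub>R axis k 1)) has_real_derivative -1 * p $ k) (at 0)"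
    using x0 has_d2_DERIV has_d2_DERIV[OF has_d2_scale[of "\<lambda>t. u (x0 + t *\<^sub>R axis k 1)" "p $ k" _ "-1"]]
    unfolding has_lap_def by blast+
  have "(g has_real_derivative M / d\<^sup>2 * (n * d) + S / 2 * d - p $ k) (at 0)"
  proof -
    have 1: "((\<lambda>t. t * t - n * (t * t) + (n * d) * t) has_real_derivative n * d) (at 0)"
      by (auto intro!: derivative_eq_intros)
    have 2: "((\<lambda>t. t * (d - t)) has_real_derivative d) (at 0)"
      by (auto intro!: derivative_eq_intros)
    from DERIV_diff[OF DERIV_add[OF DERIV_cmult[OF 1, of "M / d\<^sup>2"] DERIV_cmult[OF 2, of "S / 2"]]
        DERIV_cmult[OF DERIV_diff[OF p p'], of "1/2"]]
    show ?thesis unfolding g_def[abs_def] by simp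
  qed
  then have "M / d\<^sup>2 * (n * d) + S / 2 * d - p $ k \<ge> 0"
  proof (rule contrapos_pp)
    assume neg: "\<not> M / d\<^sup>2 * (n * d) + S / 2 * d - p $ k \<ge> 0"
    show "\<not> (g has_real_derivative M / d\<^sup>2 * (n * d) + S / 2 * d - p $ k) (at 0)"
    proof
      assume g: "(g has_real_derivative M / d\<^sup>2 * (n * d) + S / 2 * d - p $ k) (at 0)"
      obtain e where e: "e > 0" "\<And>h. 0 < h \<Longrightarrow> h < e \<Longrightarrow> g (0 + h) < g 0"
        using DERIV_neg_dec_right[OF g] neg by auto
      have "g (0 + min d e / 2) < g 0" using e d by (intro e(2)) auto
      moreover have "g (min d e / 2) \<ge> 0" using e d by (intro gp) auto
      ultimately show False using g0 by simp
    qed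
  qed
  moreover have eq: "M / d\<^sup>2 * (n * d) = n * M / d" using d by (simp add: power2_eq_square)
  ultimately show ?thesis by (simp add: eq n_def[symmetric])
qed

lemma box_gradient_bound:
  fixes u :: "real ^ 'n::finite \<Rightarrow> real"
  assumes "d > 0"
    and "continuous_on {y. \<forall>i. \<bar>y $ i - x0 $ i\<bar> \<le> d} u"
    and "\<And>y. \<forall>i. \<bar>y $ i - x0 $ i\<bar> \<le> d \<Longrightarrow> \<bar>u y\<bar> \<le> M"
    and lap: "\<And>y. \<forall>i. \<bar>y $ i - x0 $ i\<bar> \<le> d \<Longrightarrow> \<exists>p s. has_lap u y p s \<and> \<bar>s\<bar> < S"
    and x0: "has_lap u x0 p s0"
  shows "\<bar>p $ k\<bar> \<le> real CARD('n) * M / d + S * d / 2"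
proof -
  have "(-1 *\<^sub>R p) $ k \<le> real CARD('n) * M / d + S * d / 2"
  proof (rule box_gradient_bound_upper[where u = "\<lambda>x. -1 * u x"])
    show "has_lap (\<lambda>x. -1 * u x) x0 (-1 *\<^sub>R p) (-1 * s0)" by (rule has_lap_cmult[OF x0])
    fix y assume "\<forall>i. \<bar>y $ i - x0 $ i\<bar> \<le> d"
    then obtain p s where "has_lap u y p s" "\<bar>s\<bar> < S" using lap by blast
    then have "has_lap (\<lambda>x. -1 * u x) y (-1 *\<^sub>R p) (-1 * s)" "\<bar>-1 * s\<bar> < S"
      using has_lap_cmult[of u y p s "-1"] by auto
    then show "\<exists>p s. has_lap (\<lambda>x. -1 * u x) y p s \<and> \<bar>s\<bar> < S" by blast
  qed (use assms in \<open>auto intro!: continuous_intros\<close>)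
  moreover have "p $ k \<le> real CARD('n) * M / d + S * d / 2"
    by (rule box_gradient_bound_upper[OF assms])
  ultimately show ?thesis by simp
qed

section \<open>Surface measure on the sphere\<close>

text \<open>
  The uniqueness argument for Haar measure: Fubini and translation invariance compare
  the two measures with the help of the unit ball, which the transformation preserves.
\<close>

lemma lborel_distr_orthogonal:
  fixes A :: "'a::euclidean_space \<Rightarrow> 'a"
  assumes A: "orthogonal_transformation A"
  shows "distr lborel borel A = lborel"
proof (rule measure_eqI)
  have lin: "linear A" by (rule orthogonal_transformation_linear[OF A])
  have norm_A: "norm (A x) = norm x" for x by (rule orthogonal_transformation_norm[OF A])
  have [measurable]: "A \<in> borel_measurable borel"
    by (intro borel_measurable_continuous_onI linear_continuous_on linear_conv_bounded_linear[THEN iffD1] lin)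
  define B where "B = ball (0::'a) 1"
  have [measurable]: "B \<in> sets borel" by (simp add: B_def)
  have shift: "(\<integral>\<^sup>+x. f x \<partial>lborel) = (\<integral>\<^sup>+x. f (c + x) \<partial>lborel)"
    if [measurable]: "f \<in> borel_measurable borel" for f :: "'a \<Rightarrow> ennreal" and c
    by (subst lborel_distr_plus[of c, symmetric]) (simp add: nn_integral_distr)
  fix E assume "E \<in> sets (distr lborel borel A)"
  then have E[measurable]: "E \<in> sets borel" by simp
  have [measurable]: "A -` E \<in> sets borel"
    using measurable_sets[of A borel borel E] by simp
  have "emeasure lborel (A -` E) * emeasure lborel B =
      (\<integral>\<^sup>+y. (\<integral>\<^sup>+x. indicator E (A x) * indicator B y \<partial>lborel) \<partial>lborel)"
  proof -
    have "emeasure lborel (A -` E) = (\<integral>\<^sup>+x. indicator (A -` E) x \<partial>lborel)" by simp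
    also have "\<dots> = (\<integral>\<^sup>+x. indicator E (A x) \<partial>lborel)" by (intro nn_integral_cong) (simp add: indicator_def)
    finally show ?thesis by (simp add: nn_integral_multc nn_integral_cmult)
  qed
  \<comment> \<open>Translation invariance is used under the inner integral, with a shift
    \<open>z\<close> that \<open>A\<close> takes to \<open>y\<close>. The resulting argument
    \<open>A x + y\<close> lets Fubini and a second shift move the dependence on \<open>A\<close>
    from \<open>E\<close> to the ball.\<close>
  also have "\<dots> = (\<integral>\<^sup>+y. (\<integral>\<^sup>+x. indicator E (A x + y) * indicator B y \<partial>lborel) \<partial>lborel)"
  proof (rule nn_integral_cong)
    fix y
    obtain z where z: "A z = y" using orthogonal_transformation_surj[OF A] by (metis surjD)
    show "(\<integral>\<^sup>+x. indicator E (A x) * indicator B y \<partial>lborel) = (\<integral>\<^sup>+x. indicator E (A x + y) * indicator B y \<partial>lborel)"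
      by (subst shift[of _ z]) (auto simp: linear_add[OF lin] z add.commute)
  qed
  also have "\<dots> = (\<integral>\<^sup>+x. (\<integral>\<^sup>+y. indicator E (A x + y) * indicator B y \<partial>lborel) \<partial>lborel)"
    by (rule lborel_pair.Fubini') measurable
  also have "\<dots> = (\<integral>\<^sup>+x. (\<integral>\<^sup>+y. indicator E y * indicator B (y - A x) \<partial>lborel) \<partial>lborel)"
  proof (rule nn_integral_cong)
    fix x
    show "(\<integral>\<^sup>+y. indicator E (A x + y) * indicator B y \<partial>lborel) = (\<integral>\<^sup>+y. indicator E y * indicator B (y - A x) \<partial>lborel)"
      by (subst (2) shift[of _ "A x"]) auto
  qed
  also have "\<dots> = (\<integral>\<^sup>+y. (\<integral>\<^sup>+x. indicator E y * indicator B (y - A x) \<partial>lborel) \<partial>lborel)"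
    by (rule lborel_pair.Fubini') measurable
  also have "\<dots> = (\<integral>\<^sup>+y. indicator E y * emeasure lborel B \<partial>lborel)"
  proof (rule nn_integral_cong)
    fix y
    obtain z where z: "A z = y" using orthogonal_transformation_surj[OF A] by (metis surjD)
    have "(\<integral>\<^sup>+x. indicator E y * indicator B (y - A x) \<partial>lborel) =
        indicator E y * (\<integral>\<^sup>+x. indicator B (y - A x) \<partial>lborel)"
      by (simp add: nn_integral_cmult)
    also have "(\<integral>\<^sup>+x. indicator B (y - A x) \<partial>lborel) = (\<integral>\<^sup>+x. indicator B (y - A (z + x)) \<partial>lborel)"
      by (subst shift[of _ z]) auto
    also have "\<dots> = (\<integral>\<^sup>+x. indicator B x \<partial>lborel)"
      by (intro nn_integral_cong) (simp add: linear_add[OF lin] z B_def indicator_def norm_A)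
    finally show "(\<integral>\<^sup>+x. indicator E y * indicator B (y - A x) \<partial>lborel) = indicator E y * emeasure lborel B"
      by simp
  qed
  also have "\<dots> = emeasure lborel E * emeasure lborel B" by (simp add: nn_integral_multc)
  finally have eq: "emeasure lborel (A -` E) * emeasure lborel B = emeasure lborel E * emeasure lborel B" .
  have "measure lborel B > 0" by (simp add: B_def content_ball_pos)
  then have "emeasure lborel B \<noteq> 0" by (auto simp: measure_def)
  moreover have "emeasure lborel B \<noteq> top" unfolding B_def
    by (metis emeasure_lborel_ball_finite infinity_ennreal_def less_irrefl)
  ultimately have "emeasure lborel (A -` E) = emeasure lborel E"
    using eq by (metis ennreal_mult_divide_eq)
  then show "emeasure (distr lborel borel A) E = emeasure lborel E"
    by (simp add: emeasure_distr)
qed simp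

lemma space_sphere_measure [simp]: "space sphere_measure = sphere 0 1"
  by (simp add: sphere_measure_def space_scale_measure space_restrict_space)

lemma sets_sphere_measure [measurable_cong]:
  "sets sphere_measure = sets (restrict_space borel (sphere 0 1))"
  by (simp add: sphere_measure_def)

lemma sets_sphere_measure_iff:
  "A \<in> sets sphere_measure \<longleftrightarrow> A \<in> sets borel \<and> A \<subseteq> sphere 0 1"
  unfolding sets_sphere_measure by (subst sets_restrict_space_iff) auto

lemma emeasure_sphere:
  "emeasure sphere_measure (sphere (0 :: real ^ 'n::finite) 1) =
     of_nat CARD('n) * emeasure lborel (ball (0 :: real ^ 'n) 1 - {0})"
proof -
  have "{x :: real ^ 'n. 0 < norm x \<and> norm x < 1 \<and> sgn x \<in> sphere 0 1} = ball 0 1 - {0}"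
    by (auto simp: norm_sgn)
  then show ?thesis by (simp add: emeasure_sphere_measure)
qed

lemma finite_measure_sphere_measure: "finite_measure (sphere_measure :: (real ^ 'n::finite) measure)"
proof
  have "emeasure lborel (ball (0 :: real ^ 'n) 1 - {0}) \<le> emeasure lborel (ball (0 :: real ^ 'n) 1)"
    by (rule emeasure_mono) auto
  then have "emeasure lborel (ball (0 :: real ^ 'n) 1 - {0}) < top"
    using emeasure_lborel_ball_finite[of "0 :: real ^ 'n" 1] by (simp add: less_top order_le_less_trans)
  then show "emeasure (sphere_measure :: (real ^ 'n) measure) (space sphere_measure) \<noteq> \<infinity>"
    by (simp add: emeasure_sphere ennreal_mult_eq_top_iff)
qed

interpretation sphere: finite_measure "sphere_measure :: (real ^ 'n::finite) measure"
  by (rule finite_measure_sphere_measure)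

lemma measure_sphere_pos: "measure sphere_measure (sphere (0 :: real ^ 'n::finite) 1) > 0"
proof -
  have "emeasure lborel (ball (0 :: real ^ 'n) 1 - {0}) = emeasure lborel (ball (0 :: real ^ 'n) 1)"
    by (subst emeasure_Diff) auto
  moreover have "measure lborel (ball (0 :: real ^ 'n) 1) > 0" by (simp add: content_ball_pos)
  then have "emeasure lborel (ball (0 :: real ^ 'n) 1) \<noteq> 0" by (auto simp: measure_def)
  ultimately have "emeasure sphere_measure (sphere (0 :: real ^ 'n::finite) 1) \<noteq> 0"
    by (simp add: emeasure_sphere)
  then show ?thesis by (simp add: sphere.emeasure_eq_measure zero_less_measure_iff)
qed

text \<open>An orthogonal map preserves the norm and commutes with \<open>sgn\<close>, so the cone
  over the preimage of \<open>E\<close> is the preimage of the cone over \<open>E\<close>;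
  invariance of Lebesgue measure does the rest.\<close>

lemma sphere_measure_distr_orthogonal:
  fixes A :: "real ^ 'n::finite \<Rightarrow> real ^ 'n"
  assumes A: "orthogonal_transformation A"
  shows "distr sphere_measure sphere_measure A = sphere_measure"
proof (rule measure_eqI)
  have lin: "linear A" by (rule orthogonal_transformation_linear[OF A])
  have norm_A: "norm (A x) = norm x" for x by (rule orthogonal_transformation_norm[OF A])
  have mA[measurable]: "A \<in> borel_measurable borel"
    by (intro borel_measurable_continuous_onI linear_continuous_on linear_conv_bounded_linear[THEN iffD1] lin)
  have A0: "A x = 0 \<longleftrightarrow> x = 0" for x by (metis norm_A norm_eq_zero)
  have mAs: "A \<in> measurable sphere_measure sphere_measure"
    unfolding measurable_cong_sets[OF sets_sphere_measure sets_sphere_measure]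
    by (intro measurable_restrict_space2 measurable_restrict_space1) (auto simp: space_restrict_space norm_A)
  have msgn[measurable]: "(sgn :: real ^ 'n \<Rightarrow> real ^ 'n) \<in> borel_measurable borel"
    unfolding sgn_div_norm by measurable
  fix E assume "E \<in> sets (distr sphere_measure sphere_measure A)"
  then have E: "E \<in> sets sphere_measure" by simp
  then have E': "E \<in> sets borel" "E \<subseteq> sphere 0 1" by (auto simp: sets_sphere_measure_iff)
  have mE: "A -` E \<in> sets borel" using measurable_sets[OF mA E'(1)] by simp
  define C where "C = {x. 0 < norm x \<and> norm x < 1 \<and> sgn x \<in> E}"
  have "C = {x. 0 < norm x \<and> norm x < 1} \<inter> (sgn -` E \<inter> space borel)" by (auto simp: C_def)
  then have C[measurable]: "C \<in> sets borel" using measurable_sets[OF msgn E'(1)] by auto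
  have "A -` E \<inter> sphere 0 1 = A -` E" using E'(2) by (auto simp: norm_A)
  then have "emeasure (distr sphere_measure sphere_measure A) E = emeasure sphere_measure (A -` E)"
    using emeasure_distr[OF mAs E] by simp
  also have "\<dots> = of_nat CARD('n) * emeasure lborel {x. 0 < norm x \<and> norm x < 1 \<and> sgn x \<in> A -` E}"
    by (rule emeasure_sphere_measure) (use mE E' norm_A in auto)
  also have "{x. 0 < norm x \<and> norm x < 1 \<and> sgn x \<in> A -` E} = A -` C"
    by (auto simp: C_def norm_A A0 sgn_div_norm linear_scale[OF lin])
  also have "emeasure lborel (A -` C) = emeasure (distr lborel borel A) C"
    by (simp add: emeasure_distr)
  also have "\<dots> = emeasure lborel C" by (simp add: lborel_distr_orthogonal[OF A])
  also have "of_nat CARD('n) * emeasure lborel C = emeasure sphere_measure E"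
    unfolding C_def by (rule emeasure_sphere_measure[symmetric]) (use E' in auto)
  finally show "emeasure (distr sphere_measure sphere_measure A) E = emeasure sphere_measure E" .
qed simp

text \<open>The Householder reflection in the hyperplane orthogonal to \<open>x - y\<close>
  exchanges two vectors of equal length.\<close>

lemma orthogonal_reflection_exists:
  fixes x y :: "'a::euclidean_space"
  assumes "norm x = norm y"
  obtains A where "orthogonal_transformation A" "A x = y"
proof (cases "x = y")
  case True
  then show ?thesis using that[of "\<lambda>x. x"] by simp
next
  case False
  define v where "v = x - y"
  have v: "v \<bullet> v \<noteq> 0" using False by (simp add: v_def)
  define c where "c = 2 / (v \<bullet> v)"
  have c: "c * (v \<bullet> v) = 2" using v by (simp add: c_def)
  define A where "A z = z - (c * (z \<bullet> v)) *\<^sub>R v" for z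
  have "linear A"
    unfolding A_def by (rule linearI) (simp_all add: algebra_simps inner_add_left)
  moreover have "A z \<bullet> A w = z \<bullet> w" for z w
  proof -
    have "A z \<bullet> A w = z \<bullet> w - 2 * c * (z \<bullet> v) * (w \<bullet> v) + c * (z \<bullet> v) * (w \<bullet> v) * (c * (v \<bullet> v))"
      unfolding A_def by (simp add: inner_diff_left inner_diff_right inner_commute[of v w] algebra_simps)
    then show ?thesis unfolding c by (simp add: algebra_simps)
  qed
  ultimately have "orthogonal_transformation A" by (simp add: orthogonal_transformation_def)
  moreover have "2 * (x \<bullet> v) = v \<bullet> v"
    using assms by (simp add: v_def inner_diff_left inner_diff_right inner_commute[of y x] norm_eq)
  then have "c * (x \<bullet> v) = 1" using v by (simp add: c_def field_simps)
  then have "A x = y" by (simp add: A_def v_def)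
  ultimately show ?thesis by (rule that)
qed

section \<open>Riesz potentials of functions on the sphere\<close>

lemma continuous_sphere_bounded:
  fixes \<phi> :: "real ^ 'n::finite \<Rightarrow> 'b::real_normed_vector"
  assumes "continuous_on (sphere 0 1) \<phi>"
  obtains M where "M \<ge> 0" "\<And>z. z \<in> sphere 0 1 \<Longrightarrow> norm (\<phi> z) \<le> M"
proof -
  obtain B where "\<forall>y\<in>\<phi> ` sphere 0 1. norm y \<le> B"
    using compact_imp_bounded[OF compact_continuous_image[OF assms compact_sphere]]
    unfolding bounded_iff by blast
  then show ?thesis by (intro that[of "max 0 B"]) (auto simp: le_max_iff_disj)
qed

lemma integrable_sphere:
  fixes \<phi> :: "real ^ 'n::finite \<Rightarrow> 'b::{banach, second_countable_topology}"
  assumes "continuous_on (sphere 0 1) \<phi>"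
  shows "integrable sphere_measure \<phi>"
proof -
  obtain B where B: "\<And>z. z \<in> sphere 0 1 \<Longrightarrow> norm (\<phi> z) \<le> B"
    using continuous_sphere_bounded[OF assms] by metis
  have "\<phi> \<in> borel_measurable sphere_measure"
    unfolding measurable_cong_sets[OF sets_sphere_measure refl]
    by (rule borel_measurable_continuous_on_restrict[OF assms])
  then show ?thesis
    by (intro sphere.integrable_const_bound[where B = B]) (use B in auto)
qed

text \<open>Uniform continuity of \<open>k'\<close> on the product of a closed ball and the sphere
  makes the linearization error of the kernel uniform in \<open>z\<close>, so that it survives
  integration against the bounded \<open>\<phi>\<close>.\<close>

lemma sphere_integral_has_derivative:
  fixes k :: "real ^ 'n::finite \<Rightarrow> real ^ 'n \<Rightarrow> real" and k' :: "real ^ 'n \<Rightarrow> real ^ 'n \<Rightarrow> real ^ 'n"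
  assumes U: "open U" "x \<in> U"
    and d: "\<And>x z. x \<in> U \<Longrightarrow> z \<in> sphere 0 1 \<Longrightarrow> ((\<lambda>x. k x z) has_derivative (\<lambda>h. k' x z \<bullet> h)) (at x)"
    and c': "continuous_on (U \<times> sphere 0 1) (\<lambda>(x, z). k' x z)"
    and ck: "\<And>x. x \<in> U \<Longrightarrow> continuous_on (sphere 0 1) (k x)"
    and \<phi>: "continuous_on (sphere 0 1) \<phi>"
  shows "((\<lambda>x. LINT z|sphere_measure. k x z * \<phi> z) has_derivative
           (\<lambda>h. (LINT z|sphere_measure. \<phi> z *\<^sub>R k' x z) \<bullet> h)) (at x)"
  unfolding has_derivative_at_alt
proof (intro conjI allI impI)
  show "bounded_linear (\<lambda>h. (LINT z|sphere_measure. \<phi> z *\<^sub>R k' x z) \<bullet> h)"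
    by (rule bounded_linear_inner_right)
  fix e :: real assume e: "e > 0"
  obtain r where r: "r > 0" "cball x r \<subseteq> U" using U open_contains_cball by blast
  have ck': "continuous_on (sphere 0 1) (k' y)" if "y \<in> U" for y
  proof -
    have "continuous_on (sphere (0 :: real ^ 'n) 1) (\<lambda>z. (y, z))" by (intro continuous_intros)
    from continuous_on_compose2[OF c' this] that show ?thesis by auto
  qed
  have uc: "uniformly_continuous_on (cball x r \<times> sphere 0 1) (\<lambda>(x, z). k' x z)"
    by (intro compact_uniformly_continuous compact_Times continuous_on_subset[OF c'])
       (use r in auto)
  obtain B where B0: "B \<ge> 0" and B: "\<And>z. z \<in> sphere 0 1 \<Longrightarrow> norm (\<phi> z) \<le> B"
    using continuous_sphere_bounded[OF \<phi>] by metis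
  define s where "s = measure sphere_measure (sphere (0 :: real ^ 'n) 1)"
  have s: "s > 0" unfolding s_def by (rule measure_sphere_pos)
  \<comment> \<open>\<open>B * s\<close> bounds the integral of \<open>\<bar>\<phi> z\<bar>\<close>;
    the added 1 keeps the denominator positive when \<open>B = 0\<close>.\<close>
  define e' where "e' = e / (B * s + 1)"
  have "e' > 0" using e s B0 by (auto simp: e'_def add_nonneg_pos)
  have e'e: "e' * (B * s) \<le> e"
  proof -
    have "B * s \<ge> 0" using B0 s by simp
    then have "e' * (B * s + 1) = e" by (simp add: e'_def)
    then show ?thesis using \<open>e' > 0\<close> by (simp add: algebra_simps)
  qed
  have "\<exists>\<delta>>0. \<forall>p\<in>cball x r \<times> sphere 0 1. \<forall>p'\<in>cball x r \<times> sphere 0 1.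
      dist p' p < \<delta> \<longrightarrow> dist ((\<lambda>(x, z). k' x z) p') ((\<lambda>(x, z). k' x z) p) < e'"
    using uc[unfolded uniformly_continuous_on_def, rule_format, OF \<open>e' > 0\<close>] .
  then obtain \<delta> where \<delta>0: "\<delta> > 0" and *: "\<forall>p\<in>cball x r \<times> sphere 0 1. \<forall>p'\<in>cball x r \<times> sphere 0 1.
      dist p' p < \<delta> \<longrightarrow> dist ((\<lambda>(x, z). k' x z) p') ((\<lambda>(x, z). k' x z) p) < e'"
    by (elim exE conjE)
  have \<delta>: "dist (k' y z) (k' x z) < e'" if "y \<in> cball x r" "z \<in> sphere 0 1" "dist y x < \<delta>" for y z
  proof -
    have "(x, z) \<in> cball x r \<times> sphere 0 1" "(y, z) \<in> cball x r \<times> sphere 0 1" using that r by auto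
    from *[THEN bspec, OF this(1), THEN bspec, OF this(2)] that(3) show ?thesis
      by (simp add: dist_Pair_Pair)
  qed
  show "\<exists>d>0. \<forall>y. norm (y - x) < d \<longrightarrow>
      norm ((LINT z|sphere_measure. k y z * \<phi> z) - (LINT z|sphere_measure. k x z * \<phi> z) -
            (LINT z|sphere_measure. \<phi> z *\<^sub>R k' x z) \<bullet> (y - x)) \<le> e * norm (y - x)"
  proof (intro exI[of _ "min \<delta> r"] conjI allI impI)
    show "min \<delta> r > 0" using \<delta>0 r by simp
    fix y assume y: "norm (y - x) < min \<delta> r"
    have yU: "y \<in> U" using y r by (auto simp: dist_norm norm_minus_commute)
    have bound: "norm (k y z - k x z - k' x z \<bullet> (y - x)) \<le> norm (y - x) * e'"
      if z: "z \<in> sphere 0 1" for z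
    proof (rule differentiable_bound_linearization[where S = "ball x (min \<delta> r)" and f = "\<lambda>x. k x z"
          and f' = "\<lambda>x h. k' x z \<bullet> h" and ?x0.0 = x])
      fix t :: real assume "t \<in> {0..1}"
      then have "norm (t *\<^sub>R (y - x)) \<le> norm (y - x)" by (simp add: mult_left_le_one_le)
      with y show "x + t *\<^sub>R (y - x) \<in> ball x (min \<delta> r)" by (simp add: dist_norm)
    next
      fix w assume w: "w \<in> ball x (min \<delta> r)"
      then have "w \<in> U" using r by (auto simp: dist_norm)
      then show "((\<lambda>x. k x z) has_derivative (\<lambda>h. k' w z \<bullet> h)) (at w within ball x (min \<delta> r))"
        by (rule has_derivative_at_withinI[OF d[OF _ z]])
      have "dist (k' w z) (k' x z) < e'" using w by (intro \<delta> z) (auto simp: dist_commute)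
      then have e: "norm (k' w z - k' x z) \<le> e'" by (simp add: dist_norm)
      show "onorm ((\<lambda>h. k' w z \<bullet> h) - (\<lambda>h. k' x z \<bullet> h)) \<le> e'"
      proof (rule onorm_le)
        fix h
        have "norm ((k' w z - k' x z) \<bullet> h) \<le> norm (k' w z - k' x z) * norm h"
          unfolding real_norm_def by (rule Cauchy_Schwarz_ineq2)
        also have "\<dots> \<le> e' * norm h" by (rule mult_right_mono[OF e norm_ge_zero])
        finally show "norm (((\<lambda>h. k' w z \<bullet> h) - (\<lambda>h. k' x z \<bullet> h)) h) \<le> e' * norm h"
          by (simp add: inner_diff_left)
      qed
    qed (use \<delta>0 r in auto)
    have i1: "integrable sphere_measure (\<lambda>z. k w z * \<phi> z)" if "w \<in> U" for w
      by (intro integrable_sphere continuous_intros ck that \<phi>)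
    have i2: "integrable sphere_measure (\<lambda>z. \<phi> z *\<^sub>R k' x z)"
      by (intro integrable_sphere continuous_intros ck' U \<phi>)
    have "(LINT z|sphere_measure. k y z * \<phi> z) - (LINT z|sphere_measure. k x z * \<phi> z) -
            (LINT z|sphere_measure. \<phi> z *\<^sub>R k' x z) \<bullet> (y - x) =
          (LINT z|sphere_measure. (k y z - k x z - k' x z \<bullet> (y - x)) * \<phi> z)"
    proof -
      have i3: "integrable sphere_measure (\<lambda>z. (\<phi> z *\<^sub>R k' x z) \<bullet> (y - x))"
        by (rule integrable_inner_left) (rule i2)
      have "(LINT z|sphere_measure. \<phi> z *\<^sub>R k' x z) \<bullet> (y - x) =
          (LINT z|sphere_measure. (\<phi> z *\<^sub>R k' x z) \<bullet> (y - x))"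
        by (rule integral_inner_left[symmetric]) (rule i2)
      then have "(LINT z|sphere_measure. k y z * \<phi> z) - (LINT z|sphere_measure. k x z * \<phi> z) -
            (LINT z|sphere_measure. \<phi> z *\<^sub>R k' x z) \<bullet> (y - x) =
          (LINT z|sphere_measure. k y z * \<phi> z - k x z * \<phi> z - (\<phi> z *\<^sub>R k' x z) \<bullet> (y - x))"
        by (simp only: Bochner_Integration.integral_diff Bochner_Integration.integrable_diff i1[OF yU] i1[OF U(2)] i3)
      also have "\<dots> = (LINT z|sphere_measure. (k y z - k x z - k' x z \<bullet> (y - x)) * \<phi> z)"
        by (intro Bochner_Integration.integral_cong refl) (simp add: right_diff_distrib mult.commute)
      finally show ?thesis .
    qed
    also have "norm \<dots> \<le> (LINT z|(sphere_measure :: (real ^ 'n) measure). norm (y - x) * e' * B)"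
    proof (rule Bochner_Integration.integral_norm_bound_integral)
      show "integrable sphere_measure (\<lambda>z. (k y z - k x z - k' x z \<bullet> (y - x)) * \<phi> z)"
        by (intro integrable_sphere continuous_intros ck ck' yU U \<phi>)
      fix z :: "real ^ 'n" assume "z \<in> space sphere_measure"
      then have z: "z \<in> sphere 0 1" by simp
      show "norm ((k y z - k x z - k' x z \<bullet> (y - x)) * \<phi> z) \<le> norm (y - x) * e' * B"
        unfolding norm_mult using \<open>e' > 0\<close> by (intro mult_mono bound[OF z] B[OF z]) auto
    qed simp
    also have "\<dots> = norm (y - x) * (e' * (B * s))" by (simp add: s_def)
    also have "\<dots> \<le> norm (y - x) * e" by (intro mult_left_mono e'e) auto
    finally show "norm ((LINT z|sphere_measure. k y z * \<phi> z) - (LINT z|sphere_measure. k x z * \<phi> z) -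
            (LINT z|sphere_measure. \<phi> z *\<^sub>R k' x z) \<bullet> (y - x)) \<le> e * norm (y - x)"
      by (simp add: mult.commute)
  qed
qed

text \<open>The exponent is attached to the squared distance, so the kernel is
  \<open>|x - z|\<close> to the power \<open>-2c\<close>. The family is closed under the operations
  at issue: gradient and Laplacian of the member \<open>c\<close> are expressed by the member
  \<open>c + 1\<close>. The value \<open>c = n / 2\<close> gives the Poisson kernel up to the factor
  \<open>1 - x \<bullet> x\<close> and normalisation.\<close>

definition riesz :: "real \<Rightarrow> (real ^ 'n::finite \<Rightarrow> real) \<Rightarrow> real ^ 'n \<Rightarrow> real" where
  "riesz c \<phi> x = (LINT z|sphere_measure. ((x - z) \<bullet> (x - z)) powr - c * \<phi> z)"

definition riesz_grad :: "real \<Rightarrow> (real ^ 'n::finite \<Rightarrow> real) \<Rightarrow> real ^ 'n \<Rightarrow> real ^ 'n" where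
  "riesz_grad c \<phi> x =
     (LINT z|sphere_measure. \<phi> z *\<^sub>R ((-2 * c * ((x - z) \<bullet> (x - z)) powr - (c + 1)) *\<^sub>R (x - z)))"

lemma sqdist_pos: "norm x < 1 \<Longrightarrow> z \<in> sphere 0 1 \<Longrightarrow> (x - z) \<bullet> (x - z) > 0" for x z :: "real ^ 'n::finite"
  by auto

lemma riesz_integrable:
  assumes "norm x < 1" "continuous_on (sphere 0 1) \<phi>"
  shows "integrable sphere_measure (\<lambda>z. ((x - z) \<bullet> (x - z)) powr c * \<phi> z)"
  by (intro integrable_sphere continuous_intros assms) (use sqdist_pos[OF assms(1)] in fastforce)

lemma riesz_grad_integrable:
  assumes "norm x < 1" "continuous_on (sphere 0 1) \<phi>"
  shows "integrable sphere_measure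
     (\<lambda>z. \<phi> z *\<^sub>R ((-2 * c * ((x - z) \<bullet> (x - z)) powr - (c + 1)) *\<^sub>R (x - z)))"
  by (intro integrable_sphere continuous_intros assms) (use sqdist_pos[OF assms(1)] in fastforce)

lemma riesz_has_derivative:
  assumes x: "norm x < 1" and \<phi>: "continuous_on (sphere 0 1) \<phi>"
  shows "(riesz c \<phi> has_derivative (\<lambda>h. riesz_grad c \<phi> x \<bullet> h)) (at x)"
  unfolding riesz_def[abs_def] riesz_grad_def
proof (rule sphere_integral_has_derivative[where U = "ball 0 1"])
  fix x z :: "real ^ 'a" assume "x \<in> ball 0 1" and z: "z \<in> sphere 0 1"
  then have p: "(x - z) \<bullet> (x - z) > 0" by (intro sqdist_pos) auto
  have a: "((\<lambda>x. (x - z) \<bullet> (x - z)) has_derivative (\<lambda>h. 2 * ((x - z) \<bullet> h))) (at x)"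
    by (auto intro!: derivative_eq_intros simp: inner_commute)
  have b: "((\<lambda>y. y powr - c) has_derivative (\<lambda>h. h * (- c * ((x - z) \<bullet> (x - z)) powr (- c - 1))))
      (at ((x - z) \<bullet> (x - z)))"
    using has_real_derivative_powr[OF p, of "- c"]
    unfolding has_field_derivative_def by (rule has_derivative_eq_rhs) auto
  from has_derivative_compose[OF a b]
  show "((\<lambda>x. ((x - z) \<bullet> (x - z)) powr - c) has_derivative
         (\<lambda>h. ((-2 * c * ((x - z) \<bullet> (x - z)) powr - (c + 1)) *\<^sub>R (x - z)) \<bullet> h)) (at x)"
    by (rule has_derivative_eq_rhs) (auto simp: fun_eq_iff)
next
  show "continuous_on (ball 0 1 \<times> sphere 0 1)
     (\<lambda>(x :: real ^ 'a, z). (-2 * c * ((x - z) \<bullet> (x - z)) powr - (c + 1)) *\<^sub>R (x - z))"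
    unfolding case_prod_beta by (intro continuous_intros) (use sqdist_pos in fastforce)
next
  fix x :: "real ^ 'a" assume "x \<in> ball 0 1"
  then show "continuous_on (sphere 0 1) (\<lambda>z. ((x - z) \<bullet> (x - z)) powr - c)"
    by (intro continuous_intros) (use sqdist_pos in fastforce)
qed (use assms in auto)

lemma continuous_on_riesz:
  assumes "continuous_on (sphere 0 1) \<phi>"
  shows "continuous_on (ball 0 1) (riesz c \<phi>)"
  by (rule has_derivative_continuous_on, rule has_derivative_at_withinI, rule riesz_has_derivative[OF _ assms])
    simp

text \<open>Splitting \<open>x - z\<close> writes each partial derivative through potentials again,
  with the new datum \<open>z $ i * \<phi> z\<close>. The derivative formula can therefore be
  applied a second time to obtain second derivatives.\<close>

lemma riesz_grad_nth:
  assumes x: "norm x < 1" and \<phi>: "continuous_on (sphere 0 1) \<phi>"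
  shows "riesz_grad c \<phi> x $ i =
    -2 * c * (x $ i * riesz (c + 1) \<phi> x - riesz (c + 1) (\<lambda>z. z $ i * \<phi> z) x)"
proof -
  have \<phi>i: "continuous_on (sphere 0 1) (\<lambda>z. z $ i * \<phi> z)" by (intro continuous_intros \<phi>)
  have "riesz_grad c \<phi> x $ i = riesz_grad c \<phi> x \<bullet> axis i 1" by (simp add: inner_axis)
  also have "\<dots> = (LINT z|sphere_measure. (\<phi> z *\<^sub>R ((-2 * c * ((x - z) \<bullet> (x - z)) powr - (c + 1)) *\<^sub>R (x - z))) \<bullet> axis i 1)"
    unfolding riesz_grad_def by (rule integral_inner_left[symmetric]) (rule riesz_grad_integrable[OF assms])
  also have "\<dots> = (LINT z|sphere_measure. -2 * c * (x $ i * (((x - z) \<bullet> (x - z)) powr - (c + 1) * \<phi> z) -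
       ((x - z) \<bullet> (x - z)) powr - (c + 1) * (z $ i * \<phi> z)))"
    by (intro Bochner_Integration.integral_cong refl) (simp add: inner_axis algebra_simps)
  also have "\<dots> = -2 * c * (x $ i * riesz (c + 1) \<phi> x - riesz (c + 1) (\<lambda>z. z $ i * \<phi> z) x)"
    using riesz_integrable[OF x \<phi>, of "-(c+1)"] riesz_integrable[OF x \<phi>i, of "-(c+1)"]
    unfolding riesz_def by (simp add: Bochner_Integration.integral_diff)
  finally show ?thesis .
qed

text \<open>On the sphere \<open>2 * (x \<bullet> (x - z))\<close> equals the squared distance minus
  \<open>1 - x \<bullet> x\<close>, so the radial derivative stays among the potentials of
  \<open>\<phi>\<close> itself. The cancellations in the Poisson and biharmonic kernels rest on
  this.\<close>

lemma riesz_grad_inner_self: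
  assumes x: "norm x < 1" and \<phi>: "continuous_on (sphere 0 1) \<phi>"
  shows "x \<bullet> riesz_grad c \<phi> x = - c * riesz c \<phi> x + c * (1 - x \<bullet> x) * riesz (c + 1) \<phi> x"
proof -
  have "x \<bullet> riesz_grad c \<phi> x = (LINT z|sphere_measure. x \<bullet> (\<phi> z *\<^sub>R ((-2 * c * ((x - z) \<bullet> (x - z)) powr - (c + 1)) *\<^sub>R (x - z))))"
    unfolding riesz_grad_def by (rule integral_inner_right[symmetric]) (rule riesz_grad_integrable[OF assms])
  also have "\<dots> = (LINT z|sphere_measure. - c * (((x - z) \<bullet> (x - z)) powr - c * \<phi> z) +
      c * (1 - x \<bullet> x) * (((x - z) \<bullet> (x - z)) powr - (c + 1) * \<phi> z))"
  proof (intro Bochner_Integration.integral_cong refl)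
    fix z :: "real ^ 'a" assume "z \<in> space sphere_measure"
    then have z: "z \<in> sphere 0 1" by simp
    define N where "N = (x - z) \<bullet> (x - z)"
    have N: "N > 0" unfolding N_def by (rule sqdist_pos[OF x z])
    have "z \<bullet> z = 1" using z by (simp add: norm_eq_1)
    then have xz: "2 * (x \<bullet> (x - z)) = N - (1 - x \<bullet> x)"
      by (simp add: N_def inner_diff_left inner_diff_right inner_commute)
    have "N powr - c = N * N powr - (c + 1)" using N by (simp add: powr_mult_base)
    then have "- c * (N powr - c * \<phi> z) + c * (1 - x \<bullet> x) * (N powr - (c + 1) * \<phi> z) =
        - c * N powr - (c + 1) * \<phi> z * (N - (1 - x \<bullet> x))" by (simp add: algebra_simps)
    also have "\<dots> = x \<bullet> (\<phi> z *\<^sub>R ((-2 * c * N powr - (c + 1)) *\<^sub>R (x - z)))"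
      unfolding xz[symmetric] by (simp add: algebra_simps)
    finally show "x \<bullet> (\<phi> z *\<^sub>R ((-2 * c * ((x - z) \<bullet> (x - z)) powr - (c + 1)) *\<^sub>R (x - z))) =
      - c * (((x - z) \<bullet> (x - z)) powr - c * \<phi> z) + c * (1 - x \<bullet> x) * (((x - z) \<bullet> (x - z)) powr - (c + 1) * \<phi> z)"
      unfolding N_def by simp
  qed
  also have "\<dots> = - c * riesz c \<phi> x + c * (1 - x \<bullet> x) * riesz (c + 1) \<phi> x"
    using riesz_integrable[OF x \<phi>, of "-(c+1)"] riesz_integrable[OF x \<phi>, of "-c"]
    unfolding riesz_def by (simp add: Bochner_Integration.integral_add)
  finally show ?thesis .
qed

lemma has_derivative_axis:
  fixes f :: "real ^ 'n::finite \<Rightarrow> 'b::real_normed_vector"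
  assumes "(f has_derivative D) (at (x + t *\<^sub>R axis i 1))"
  shows "((\<lambda>t. f (x + t *\<^sub>R axis i 1)) has_vector_derivative D (axis i 1)) (at t)"
proof -
  have "((\<lambda>t. x + t *\<^sub>R axis i 1) has_derivative (\<lambda>h. h *\<^sub>R axis i 1)) (at t)"
    by (auto intro!: derivative_eq_intros)
  from has_derivative_compose[OF this assms] show ?thesis
    unfolding has_vector_derivative_def
    by (rule has_derivative_eq_rhs)
       (simp add: fun_eq_iff linear_scale[OF has_derivative_linear[OF assms]])
qed

lemma linear_axis_sum:
  fixes D :: "real ^ 'n::finite \<Rightarrow> 'b::real_normed_vector"
  assumes "linear D"
  shows "D h = (\<Sum>i\<in>UNIV. h $ i *\<^sub>R D (axis i 1))"
proof -
  have "h = (\<Sum>i\<in>UNIV. h $ i *\<^sub>R axis i 1)"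
    using basis_expansion[of h] by (simp add: scalar_mult_eq_scaleR)
  then have "D h = D (\<Sum>i\<in>UNIV. h $ i *\<^sub>R axis i 1)" by simp
  then show ?thesis by (simp add: linear_sum[OF assms] linear_scale[OF assms])
qed

lemma DERIV_axis:
  assumes "(f has_derivative (\<lambda>h. g \<bullet> h)) (at (x + t *\<^sub>R axis i 1))"
  shows "((\<lambda>t. f (x + t *\<^sub>R axis i 1)) has_real_derivative g $ i) (at t)"
  using has_derivative_axis[OF assms]
  by (simp add: has_real_derivative_iff_has_vector_derivative inner_axis)

lemma eventually_ball_axis:
  fixes x :: "real ^ 'n::finite"
  assumes "norm x < R"
  shows "\<forall>\<^sub>F t in nhds 0. norm (x + t *\<^sub>R axis i 1) < R"
  by (rule eventually_add_axis[where P = "\<lambda>y. norm y < R"]) (use eventually_nhds_in_open[of "ball 0 R" x] assms in auto)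

text \<open>The coefficient is that of the power function: the Laplacian of \<open>|y|\<close> to
  the power \<open>-2c\<close> is \<open>2c (2c + 2 - n)\<close> times \<open>|y|\<close> to the
  power \<open>-2c - 2\<close>.\<close>

lemma has_lap_riesz:
  fixes \<phi> :: "real ^ 'n::finite \<Rightarrow> real"
  assumes x: "norm x < 1" and \<phi>: "continuous_on (sphere 0 1) \<phi>"
  shows "has_lap (riesz c \<phi>) x (riesz_grad c \<phi> x)
    ((4 * c * (c + 1) - 2 * real CARD('n) * c) * riesz (c + 1) \<phi> x)"
proof (rule has_lapI)
  have \<phi>i: "continuous_on (sphere 0 1) (\<lambda>z. z $ i * \<phi> z)" for i by (intro continuous_intros \<phi>)
  let ?g = "\<lambda>i. riesz_grad (c + 1) \<phi> x $ i" and ?h = "\<lambda>i. riesz_grad (c + 1) (\<lambda>z. z $ i * \<phi> z) x $ i"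
  let ?q = "\<lambda>i. -2 * c * (riesz (c + 1) \<phi> x + x $ i * ?g i - ?h i)"
  show "has_d2 (\<lambda>t. riesz c \<phi> (x + t *\<^sub>R axis i 1)) (riesz_grad c \<phi> x $ i) (?q i)" for i
  proof (rule has_d2I)
    let ?D = "\<lambda>t. -2 * c * ((x $ i + t) * riesz (c + 1) \<phi> (x + t *\<^sub>R axis i 1) - riesz (c + 1) (\<lambda>z. z $ i * \<phi> z) (x + t *\<^sub>R axis i 1))"
    show "\<forall>\<^sub>F t in nhds 0. ((\<lambda>t. riesz c \<phi> (x + t *\<^sub>R axis i 1)) has_real_derivative ?D t) (at t)"
      using eventually_ball_axis[OF x, of i]
    proof eventually_elim
      case (elim t)
      from DERIV_axis[OF riesz_has_derivative[OF elim \<phi>]] show ?case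
        by (simp add: riesz_grad_nth[OF elim \<phi>])
    qed
    have 1: "((\<lambda>t. riesz (c + 1) \<phi> (x + t *\<^sub>R axis i 1)) has_real_derivative ?g i) (at 0)"
      by (rule DERIV_axis) (use riesz_has_derivative[OF x \<phi>] in simp)
    have 2: "((\<lambda>t. riesz (c + 1) (\<lambda>z. z $ i * \<phi> z) (x + t *\<^sub>R axis i 1)) has_real_derivative ?h i) (at 0)"
      by (rule DERIV_axis) (use riesz_has_derivative[OF x \<phi>i] in simp)
    show "(?D has_real_derivative ?q i) (at 0)"
    proof -
      have "((\<lambda>t. x $ i + t) has_real_derivative 1) (at 0)" by (auto intro!: derivative_eq_intros)
      from DERIV_cmult[OF DERIV_diff[OF DERIV_mult[OF this 1] 2], of "-2 * c"] show ?thesis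
        by (simp add: mult.commute[of "?g i"])
    qed
    show "riesz_grad c \<phi> x $ i = ?D 0" by (simp add: riesz_grad_nth[OF x \<phi>])
  qed
  \<comment> \<open>The difference restores the square of the \<open>i\<close>-th coordinate of
    \<open>x - z\<close> under one integral. Summing over \<open>i\<close> gives the squared
    distance, which brings the exponent back to \<open>c + 1\<close>.\<close>
  have gh: "x $ i * ?g i - ?h i = (LINT z|sphere_measure.
      -2 * (c + 1) * (((x - z) \<bullet> (x - z)) powr - (c + 1 + 1) * (\<phi> z * ((x - z) $ i)\<^sup>2)))" for i
  proof -
    have 1: "riesz_grad (c + 1) \<phi> x \<bullet> (x $ i *\<^sub>R axis i 1) = (LINT z|sphere_measure. (\<phi> z *\<^sub>R ((-2 * (c + 1) * ((x - z) \<bullet> (x - z)) powr - (c + 1 + 1)) *\<^sub>R (x - z))) \<bullet> (x $ i *\<^sub>R axis i 1))"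
      unfolding riesz_grad_def by (rule integral_inner_left[symmetric]) (rule riesz_grad_integrable[OF x \<phi>])
    have 2: "riesz_grad (c + 1) (\<lambda>z. z $ i * \<phi> z) x \<bullet> axis i 1 = (LINT z|sphere_measure. ((z $ i * \<phi> z) *\<^sub>R ((-2 * (c + 1) * ((x - z) \<bullet> (x - z)) powr - (c + 1 + 1)) *\<^sub>R (x - z))) \<bullet> axis i 1)"
      unfolding riesz_grad_def by (rule integral_inner_left[symmetric]) (rule riesz_grad_integrable[OF x \<phi>i])
    have "x $ i * ?g i - ?h i = riesz_grad (c + 1) \<phi> x \<bullet> (x $ i *\<^sub>R axis i 1) - riesz_grad (c + 1) (\<lambda>z. z $ i * \<phi> z) x \<bullet> axis i 1"
      by (simp add: inner_axis)
    also have "\<dots> = (LINT z|sphere_measure. (\<phi> z *\<^sub>R ((-2 * (c + 1) * ((x - z) \<bullet> (x - z)) powr - (c + 1 + 1)) *\<^sub>R (x - z))) \<bullet> (x $ i *\<^sub>R axis i 1) -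
       ((z $ i * \<phi> z) *\<^sub>R ((-2 * (c + 1) * ((x - z) \<bullet> (x - z)) powr - (c + 1 + 1)) *\<^sub>R (x - z))) \<bullet> axis i 1)"
      unfolding 1 2
      by (rule Bochner_Integration.integral_diff[symmetric])
         (intro integrable_inner_left riesz_grad_integrable x \<phi> \<phi>i)+
    also have "\<dots> = (LINT z|sphere_measure.
      -2 * (c + 1) * (((x - z) \<bullet> (x - z)) powr - (c + 1 + 1) * (\<phi> z * ((x - z) $ i)\<^sup>2)))"
      by (intro Bochner_Integration.integral_cong refl)
         (simp add: inner_axis power2_eq_square algebra_simps)
    finally show ?thesis .
  qed
  have "(\<Sum>i\<in>UNIV. x $ i * ?g i - ?h i) = (LINT z|sphere_measure. (\<Sum>i\<in>UNIV.
      -2 * (c + 1) * (((x - z) \<bullet> (x - z)) powr - (c + 1 + 1) * (\<phi> z * ((x - z) $ i)\<^sup>2))))"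
    unfolding gh
    by (rule Bochner_Integration.integral_sum[symmetric])
       (intro integrable_mult_right riesz_integrable x continuous_intros \<phi>)
  also have "\<dots> = (LINT z|sphere_measure. -2 * (c + 1) * (((x - z) \<bullet> (x - z)) powr - (c + 1) * \<phi> z))"
  proof (intro Bochner_Integration.integral_cong refl)
    fix z :: "real ^ 'n" assume "z \<in> space sphere_measure"
    then have "(x - z) \<bullet> (x - z) > 0" by (intro sqdist_pos[OF x]) simp
    moreover define N where "N = (x - z) \<bullet> (x - z)"
    ultimately have "N powr - (c + 1) = N powr - (c + 1 + 1) * N"
      using powr_mult_base[of N "- (c + 1 + 1)"] by (simp add: algebra_simps)
    moreover have "(\<Sum>i\<in>UNIV. ((x - z) $ i)\<^sup>2) = N" by (simp add: N_def inner_vec_def power2_eq_square)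
    ultimately show "(\<Sum>i\<in>UNIV. -2 * (c + 1) * (((x - z) \<bullet> (x - z)) powr - (c + 1 + 1) * (\<phi> z * ((x - z) $ i)\<^sup>2))) =
        -2 * (c + 1) * (((x - z) \<bullet> (x - z)) powr - (c + 1) * \<phi> z)"
      unfolding N_def[symmetric] by (simp only: sum_distrib_left[symmetric] mult_ac)
  qed
  also have "\<dots> = -2 * (c + 1) * riesz (c + 1) \<phi> x" by (simp add: riesz_def)
  finally have T: "(\<Sum>i\<in>UNIV. x $ i * ?g i - ?h i) = -2 * (c + 1) * riesz (c + 1) \<phi> x" .
  have Q: "sum ?q UNIV = -2 * c * (real CARD('n) * riesz (c + 1) \<phi> x + (\<Sum>i\<in>UNIV. x $ i * ?g i - ?h i))"
  proof -
    have "?q = (\<lambda>i. -2 * c * (riesz (c + 1) \<phi> x + (x $ i * ?g i - ?h i)))"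
      by (simp add: fun_eq_iff)
    then show ?thesis by (simp only: sum_distrib_left[symmetric] sum.distrib) simp
  qed
  show "(4 * c * (c + 1) - 2 * real CARD('n) * c) * riesz (c + 1) \<phi> x = sum ?q UNIV"
    unfolding Q T by (simp add: algebra_simps)
qed

section \<open>The Poisson kernel\<close>

lemma has_lap_defect:
  "has_lap (\<lambda>x. 1 - x \<bullet> x) x (- 2 *\<^sub>R x) (- 2 * real CARD('n))" for x :: "real ^ 'n::finite"
  using has_lap_diff[OF has_lap_const has_lap_norm2, of 1 x] by simp

text \<open>The defect \<open>1 - x \<bullet> x\<close> is a polynomial stand-in for the distance to
  the sphere, to which it is comparable by the factorisation
  \<open>(1 - norm x) * (1 + norm x)\<close>.\<close>

lemma defect_bounds:
  fixes x :: "real ^ 'n::finite"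
  assumes "norm x < 1"
  shows "0 < 1 - x \<bullet> x" "1 - norm x \<le> 1 - x \<bullet> x" "1 - x \<bullet> x \<le> 2 * (1 - norm x)" "1 - x \<bullet> x \<le> 1"
proof -
  have e: "1 - x \<bullet> x = (1 - norm x) * (1 + norm x)"
    by (simp add: power2_norm_eq_inner[symmetric] algebra_simps power2_eq_square)
  show "1 - norm x \<le> 1 - x \<bullet> x" unfolding e using assms by (simp add: mult_le_cancel_left1)
  with assms show "0 < 1 - x \<bullet> x" by simp
  have "(1 - norm x) * (1 + norm x) \<le> (1 - norm x) * 2" using assms by (intro mult_left_mono) auto
  then show "1 - x \<bullet> x \<le> 2 * (1 - norm x)" unfolding e by simp
  show "1 - x \<bullet> x \<le> 1" by simp
qed

text \<open>With \<open>a = n / 2\<close> the product rule yields \<open>- 4a + 4a\<close> in front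
  of \<open>riesz a\<close> and again in front of
  \<open>(1 - x \<bullet> x) * riesz (a + 1)\<close>; the radial derivative from
  \<open>riesz_grad_inner_self\<close> supplies one term of each pair.\<close>

lemma has_lap_poisson_kernel:
  fixes \<phi> :: "real ^ 'n::finite \<Rightarrow> real"
  assumes x: "norm x < 1" and \<phi>: "continuous_on (sphere 0 1) \<phi>"
  shows "\<exists>p. has_lap (\<lambda>x. (1 - x \<bullet> x) * riesz (real CARD('n) / 2) \<phi> x) x p 0"
proof -
  define a where "a = real CARD('n) / 2"
  have n: "real CARD('n) = 2 * a" by (simp add: a_def)
  note h = has_lap_mult[OF has_lap_defect has_lap_riesz[OF x \<phi>, of a]]
  have "- 2 * real CARD('n) * riesz a \<phi> x + 2 * (- 2 *\<^sub>R x \<bullet> riesz_grad a \<phi> x) +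
      (1 - x \<bullet> x) * ((4 * a * (a + 1) - 2 * real CARD('n) * a) * riesz (a + 1) \<phi> x) = 0"
    unfolding n inner_scaleR_left riesz_grad_inner_self[OF x \<phi>] by (simp add: algebra_simps)
  with h show ?thesis unfolding a_def[symmetric] by (auto simp only:)
qed

lemma riesz_one_orthogonal:
  fixes A :: "real ^ 'n::finite \<Rightarrow> real ^ 'n"
  assumes A: "orthogonal_transformation A" and x: "norm x < 1"
  shows "riesz c (\<lambda>_. 1) (A x) = riesz c (\<lambda>_. 1) x"
proof -
  have Ax: "norm (A x) < 1" using x orthogonal_transformation_norm[OF A] by simp
  have lin: "linear A" by (rule orthogonal_transformation_linear[OF A])
  have mA: "A \<in> measurable sphere_measure sphere_measure"
    unfolding measurable_cong_sets[OF sets_sphere_measure sets_sphere_measure]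
    by (intro measurable_restrict_space2 measurable_restrict_space1 borel_measurable_continuous_onI
          linear_continuous_on linear_conv_bounded_linear[THEN iffD1] lin)
       (auto simp: space_restrict_space orthogonal_transformation_norm[OF A])
  have i: "integrable sphere_measure (\<lambda>z. ((A x - z) \<bullet> (A x - z)) powr - c * 1)"
    by (rule riesz_integrable[OF Ax]) simp
  have "riesz c (\<lambda>_. 1) (A x) = (LINT z|distr sphere_measure sphere_measure A. ((A x - z) \<bullet> (A x - z)) powr - c * 1)"
    unfolding sphere_measure_distr_orthogonal[OF A] riesz_def ..
  also have "\<dots> = (LINT z|sphere_measure. ((A x - A z) \<bullet> (A x - A z)) powr - c * 1)"
    by (rule integral_distr[OF mA]) (use i in blast)
  also have "\<dots> = riesz c (\<lambda>_. 1) x"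
    unfolding riesz_def linear_diff[OF lin, symmetric]
    by (simp only: orthogonal_transformation_def[THEN iffD1, OF A, THEN conjunct2, rule_format])
  finally show ?thesis .
qed

text \<open>
  The left-hand side is harmonic and, by rotation invariance, radial; comparing it with its
  boundary value on each concentric ball by the maximum principle shows that it is constant.
\<close>

lemma riesz_one:
  fixes x :: "real ^ 'n::finite"
  assumes x: "norm x < 1"
  shows "(1 - x \<bullet> x) * riesz (real CARD('n) / 2) (\<lambda>_. 1) x = measure sphere_measure (sphere (0 :: real ^ 'n) 1)"
proof -
  define I where "I x = (1 - x \<bullet> x) * riesz (real CARD('n) / 2) (\<lambda>_. 1) x" for x :: "real ^ 'n"
  have c1: "continuous_on (sphere 0 1) (\<lambda>_ :: real ^ 'n. 1 :: real)" by simp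
  have cont: "continuous_on (ball 0 1) I"
    unfolding I_def by (intro continuous_intros continuous_on_riesz)
  have rad: "I y = I x" if "norm y = norm x" for y
  proof -
    obtain A where A: "orthogonal_transformation A" "A x = y"
      using orthogonal_reflection_exists[of x y] \<open>norm y = norm x\<close> by metis
    then show ?thesis
      using riesz_one_orthogonal[OF A(1) x, of "real CARD('n) / 2"] that
      by (simp add: I_def norm_eq)
  qed
  \<comment> \<open>Applied with \<open>s = 1\<close> and \<open>s = -1\<close>, which gives both
    inequalities.\<close>
  have le: "s * (I 0 - I x) \<le> 0" for s
  proof (rule field_le_epsilon)
    fix e :: real assume e: "e > 0"
    \<comment> \<open>The term with \<open>e\<close> vanishes on the sphere through \<open>x\<close>
      and makes the harmonic difference strictly subharmonic.\<close>
    have "s * I 0 - s * I x + e * (0 \<bullet> (0 :: real ^ 'n) - x \<bullet> x) \<le> 0"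
    proof (rule max_principle[where K = "cball 0 (norm x)" and
          w = "\<lambda>y. s * I y - s * I x + e * (y \<bullet> y - x \<bullet> x)"])
      show "continuous_on (cball 0 (norm x)) (\<lambda>y. s * I y - s * I x + e * (y \<bullet> y - x \<bullet> x))"
        by (intro continuous_intros continuous_on_subset[OF cont]) (use x in auto)
      fix y assume y: "y \<in> cball 0 (norm x)" "s * I y - s * I x + e * (y \<bullet> y - x \<bullet> x) > 0"
      have "norm y \<noteq> norm x" using rad[of y] y(2) by (auto simp: norm_eq)
      then have "norm y < norm x" using y(1) by auto
      then have "y \<in> interior (cball 0 (norm x))" by (simp add: interior_cball)
      moreover obtain p where p: "has_lap I y p 0"
        using has_lap_poisson_kernel[OF _ c1, of y] \<open>norm y < norm x\<close> x unfolding I_def by auto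
      have "\<exists>p. has_lap (\<lambda>y. s * I y - s * I x + e * (y \<bullet> y - x \<bullet> x)) y p (e * (2 * real CARD('n)))"
        using has_lap_add[OF has_lap_diff[OF has_lap_cmult[OF p, of s] has_lap_const]
            has_lap_cmult[OF has_lap_diff[OF has_lap_norm2 has_lap_const], of e]] by auto
      moreover have "e * (2 * real CARD('n)) > 0" using e by simp
      ultimately show "y \<in> interior (cball 0 (norm x)) \<and>
         (\<exists>p s'. has_lap (\<lambda>y. s * I y - s * I x + e * (y \<bullet> y - x \<bullet> x)) y p s' \<and> s' > 0)" by blast
    qed auto
    moreover have "x \<bullet> x \<le> 1" using defect_bounds(1)[OF x] by simp
    then have "e * (x \<bullet> x) \<le> e" using e by (simp add: mult_left_le)
    ultimately show "s * (I 0 - I x) \<le> 0 + e" by (simp add: algebra_simps)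
  qed
  from le[of 1] le[of "-1"] have "I x = I 0" by simp
  also have "riesz (real CARD('n) / 2) (\<lambda>_. 1) (0 :: real ^ 'n) = (LINT z|(sphere_measure :: (real ^ 'n) measure). 1)"
    unfolding riesz_def by (intro Bochner_Integration.integral_cong refl) (auto simp: norm_eq_1)
  then have "I 0 = (LINT z|(sphere_measure :: (real ^ 'n) measure). 1)" by (simp add: I_def)
  finally show ?thesis by (simp add: I_def)
qed

text \<open>Since \<open>riesz_one\<close> gives the total mass of the Poisson kernel, every kernel
  dominated by it is estimated without evaluating another integral. The bounds near the sphere are
  reduced to such pointwise dominations.\<close>

lemma poisson_kernel_bound:
  fixes x :: "real ^ 'n::finite"
  assumes x: "norm x < 1" and k: "continuous_on (sphere 0 1) k"
    and bd: "\<And>z. z \<in> sphere 0 1 \<Longrightarrow> \<bar>k z\<bar> \<le> C * ((x - z) \<bullet> (x - z)) powr - (real CARD('n) / 2)"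
  shows "(1 - x \<bullet> x) * \<bar>LINT z|sphere_measure. k z\<bar> \<le> C * measure sphere_measure (sphere (0 :: real ^ 'n) 1)"
proof -
  have i: "integrable sphere_measure (\<lambda>z. ((x - z) \<bullet> (x - z)) powr - (real CARD('n) / 2) * C)"
    by (rule riesz_integrable[OF x]) simp
  have "norm (LINT z|sphere_measure. k z) \<le> (LINT z|sphere_measure. ((x - z) \<bullet> (x - z)) powr - (real CARD('n) / 2) * C)"
    by (rule Bochner_Integration.integral_norm_bound_integral[OF integrable_sphere[OF k] i])
       (use bd in \<open>auto simp: mult.commute\<close>)
  also have "\<dots> = C * riesz (real CARD('n) / 2) (\<lambda>_. 1) x"
    by (simp add: riesz_def)
  finally have "(1 - x \<bullet> x) * \<bar>LINT z|sphere_measure. k z\<bar> \<le> (1 - x \<bullet> x) * (C * riesz (real CARD('n) / 2) (\<lambda>_. 1) x)"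
    by (intro mult_left_mono) (use defect_bounds(1)[OF x] in auto)
  also have "\<dots> = C * ((1 - x \<bullet> x) * riesz (real CARD('n) / 2) (\<lambda>_. 1) x)" by simp
  finally show ?thesis unfolding riesz_one[OF x] .
qed

lemma unit_direction:
  fixes x :: "real ^ 'n::finite"
  obtains w where "norm w = 1" "x = norm x *\<^sub>R w"
proof (cases "x = 0")
  case True
  \<comment> \<open>At the origin every unit vector is a direction; an arbitrary coordinate axis is
    taken, so that later uses need no case distinction.\<close>
  have "norm (axis undefined 1 :: real ^ 'n) = 1" by simp
  with True show ?thesis by (intro that[of "axis undefined 1"]) simp_all
next
  case False
  show ?thesis by (rule that[of "sgn x"]) (use False in \<open>auto simp: norm_sgn sgn_div_norm\<close>)
qed

text \<open>\<open>w\<close> is the point of the sphere nearest to \<open>x\<close>, so a detour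
  through \<open>x\<close> controls distances from \<open>w\<close> by distances from
  \<open>x\<close>.\<close>

lemma dist_direction:
  fixes x :: "real ^ 'n::finite"
  assumes "norm w = 1" "x = norm x *\<^sub>R w" "norm z = 1" "norm x < 1"
  shows "norm (x - w) = 1 - norm x" "1 - norm x \<le> norm (x - z)" "norm (z - w) \<le> 2 * norm (x - z)"
proof -
  have "x - w = (norm x - 1) *\<^sub>R w" using assms(2) by (metis scaleR_left_diff_distrib scaleR_one)
  then show 1: "norm (x - w) = 1 - norm x" using assms by simp
  show 2: "1 - norm x \<le> norm (x - z)" using norm_triangle_ineq2[of z x] assms by (simp add: norm_minus_commute)
  have "norm (z - w) \<le> norm (z - x) + norm (x - w)" using norm_triangle_ineq[of "z - x" "x - w"] by simp
  with 1 2 show "norm (z - w) \<le> 2 * norm (x - z)" by (simp add: norm_minus_commute)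
qed

lemma sqdist_powr: "x \<noteq> z \<Longrightarrow> ((x - z) \<bullet> (x - z)) powr c = norm (x - z) powr (2 * c)"
  for x z :: "real ^ 'n::finite"
  by (simp add: power2_norm_eq_inner[symmetric] powr_powr[symmetric] powr_numeral)

text \<open>An approximate-identity argument, uniform over all kernels dominated by the Poisson
  kernel, since the biharmonic kernel need not be positive. Instead of cutting the sphere into a
  near and a far part, the oscillation of \<open>\<alpha>\<close> is bounded by
  \<open>e1 + K * norm (z - w) ^ n\<close>: the first term meets the total mass of the kernel, the
  power cancels its singularity and leaves a factor \<open>1 - x \<bullet> x\<close>.\<close>

lemma boundary_oscillation:
  fixes \<alpha> :: "real ^ 'n::finite \<Rightarrow> real"
  assumes \<alpha>: "continuous_on (sphere 0 1) \<alpha>" and e: "e > 0"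
  shows "\<exists>d<1. \<forall>x k w. d < norm x \<longrightarrow> norm x < 1 \<longrightarrow> norm w = 1 \<longrightarrow> x = norm x *\<^sub>R w \<longrightarrow>
    continuous_on (sphere 0 1) k \<longrightarrow>
    (\<forall>z\<in>sphere 0 1. \<bar>k z\<bar> \<le> C * (1 - x \<bullet> x) * ((x - z) \<bullet> (x - z)) powr - (real CARD('n) / 2)) \<longrightarrow>
    \<bar>LINT z|sphere_measure. k z * (\<alpha> z - \<alpha> w)\<bar> \<le> e"
proof -
  define s where "s = measure sphere_measure (sphere (0 :: real ^ 'n) 1)"
  have s: "s > 0" unfolding s_def by (rule measure_sphere_pos)
  define C' where "C' = \<bar>C\<bar> + 1"
  have C': "C' > 0" "C \<le> C'" by (auto simp: C'_def)
  \<comment> \<open>Multiplied by the total mass \<open>s\<close> and the kernel constant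
    \<open>C'\<close> this contributes \<open>e / 2\<close>.\<close>
  define e1 where "e1 = e / (2 * s * C')"
  have e1: "e1 > 0" using e s C' by (simp add: e1_def)
  obtain B where B: "\<And>z. z \<in> sphere 0 1 \<Longrightarrow> norm (\<alpha> z) \<le> B"
    using continuous_sphere_bounded[OF \<alpha>] by metis
  obtain \<delta> where \<delta>: "\<delta> > 0" "\<And>z w. z \<in> sphere 0 1 \<Longrightarrow> w \<in> sphere 0 1 \<Longrightarrow> dist z w < \<delta> \<Longrightarrow> dist (\<alpha> z) (\<alpha> w) < e1"
    using compact_uniformly_continuous[OF \<alpha> compact_sphere] e1
    unfolding uniformly_continuous_on_def by (metis dist_commute)
  define n where "n = CARD('n)"
  \<comment> \<open>At distance \<open>\<delta>\<close> and beyond,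
    \<open>K * norm (z - w) ^ n\<close> is at least the trivial bound
    \<open>2 * \<bar>B\<bar>\<close> on the oscillation.\<close>
  define K where "K = 2 * \<bar>B\<bar> / \<delta> ^ n"
  have K: "K \<ge> 0" using \<delta> by (simp add: K_def)
  have osc: "\<bar>\<alpha> z - \<alpha> w\<bar> \<le> e1 + K * norm (z - w) ^ n" if "z \<in> sphere 0 1" "w \<in> sphere 0 1" for z w
  proof (cases "dist z w < \<delta>")
    case True
    then have "\<bar>\<alpha> z - \<alpha> w\<bar> \<le> e1" using \<delta>(2)[OF that] by (simp add: dist_real_def)
    moreover have "K * norm (z - w) ^ n \<ge> 0" using K by simp
    ultimately show ?thesis by linarith
  next
    case False
    then have "\<delta> ^ n \<le> norm (z - w) ^ n" using \<delta>(1) by (intro power_mono) (auto simp: dist_norm)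
    then have "K * \<delta> ^ n \<le> K * norm (z - w) ^ n" using K by (rule mult_left_mono)
    moreover have "K * \<delta> ^ n = 2 * \<bar>B\<bar>" using \<delta> by (simp add: K_def)
    moreover have "\<bar>\<alpha> z - \<alpha> w\<bar> \<le> 2 * \<bar>B\<bar>" using B[OF that(1)] B[OF that(2)] by auto
    ultimately show ?thesis using e1 by linarith
  qed
  define K' where "K' = C' * K * 2 ^ n * s + 1"
  have K': "K' > 0" using K s C' by (simp add: K'_def add_nonneg_pos)
  show ?thesis
  \<comment> \<open>Because \<open>1 - x \<bullet> x \<le> 2 * (1 - norm x)\<close>, this radius
    makes the term with \<open>K\<close> at most \<open>e / 2\<close>.\<close>
  proof (intro exI[of _ "1 - e / (4 * K')"] conjI allI impI)
    show "1 - e / (4 * K') < 1" using e K' by simp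
    fix x w :: "real ^ 'n" and k
    assume x: "1 - e / (4 * K') < norm x" "norm x < 1" and w: "norm w = 1" "x = norm x *\<^sub>R w"
      and k: "continuous_on (sphere 0 1) k"
      and kb: "\<forall>z\<in>sphere 0 1. \<bar>k z\<bar> \<le> C * (1 - x \<bullet> x) * ((x - z) \<bullet> (x - z)) powr - (real CARD('n) / 2)"
    let ?q = "1 - x \<bullet> x"
    note q = defect_bounds[OF x(2)]
    have i1: "integrable sphere_measure (\<lambda>z. ((x - z) \<bullet> (x - z)) powr - (real CARD('n) / 2) * 1)"
      by (rule riesz_integrable[OF x(2)]) simp
    have "norm (LINT z|sphere_measure. k z * (\<alpha> z - \<alpha> w)) \<le>
       (LINT z|sphere_measure. (C' * ?q * e1) * (((x - z) \<bullet> (x - z)) powr - (real CARD('n) / 2) * 1) + C' * ?q * K * 2 ^ n)"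
    proof (rule Bochner_Integration.integral_norm_bound_integral)
      show "integrable sphere_measure (\<lambda>z. k z * (\<alpha> z - \<alpha> w))"
        by (intro integrable_sphere continuous_intros k \<alpha>)
      show "integrable sphere_measure (\<lambda>z. (C' * ?q * e1) * (((x - z) \<bullet> (x - z)) powr - (real CARD('n) / 2) * 1) + C' * ?q * K * 2 ^ n)"
        by (intro Bochner_Integration.integrable_add integrable_mult_right i1) simp
      fix z :: "real ^ 'n" assume "z \<in> space sphere_measure"
      then have z: "z \<in> sphere 0 1" by simp
      define N where "N = ((x - z) \<bullet> (x - z)) powr - (real CARD('n) / 2)"
      have N0: "N \<ge> 0" by (simp add: N_def)
      have xz: "x \<noteq> z" using x z by auto
      have "N = norm (x - z) powr (- real n)" unfolding N_def sqdist_powr[OF xz] by (simp add: n_def)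
      also have "\<dots> = 1 / norm (x - z) ^ n"
        using xz by (simp add: powr_minus powr_realpow inverse_eq_divide)
      finally have N: "N * norm (x - z) ^ n = 1" using xz by simp
      have "norm (z - w) ^ n \<le> (2 * norm (x - z)) ^ n"
        using dist_direction(3)[OF w _ x(2)] z by (intro power_mono) auto
      then have "K * norm (z - w) ^ n \<le> K * (2 ^ n * norm (x - z) ^ n)"
        using K by (intro mult_left_mono) (auto simp: power_mult_distrib)
      then have osc': "\<bar>\<alpha> z - \<alpha> w\<bar> \<le> e1 + K * 2 ^ n * norm (x - z) ^ n"
        using osc[OF z, of w] w by (simp add: mult.assoc)
      have "\<bar>k z\<bar> \<le> C * ?q * N" using kb z by (simp add: N_def)
      also have "\<dots> \<le> C' * ?q * N" using C' q N0 by (intro mult_right_mono) auto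
      finally have "\<bar>k z\<bar> * \<bar>\<alpha> z - \<alpha> w\<bar> \<le> (C' * ?q * N) * (e1 + K * 2 ^ n * norm (x - z) ^ n)"
        using osc' N0 C' q by (intro mult_mono) auto
      also have "\<dots> = C' * ?q * e1 * N + C' * ?q * K * 2 ^ n * (N * norm (x - z) ^ n)"
        by (simp add: algebra_simps)
      finally show "norm (k z * (\<alpha> z - \<alpha> w)) \<le> (C' * ?q * e1) * (((x - z) \<bullet> (x - z)) powr - (real CARD('n) / 2) * 1) + C' * ?q * K * 2 ^ n"
        unfolding N N_def[symmetric] by (simp add: abs_mult)
    qed
    also have "\<dots> = C' * e1 * (?q * riesz (real CARD('n) / 2) (\<lambda>_. 1) x) + ?q * (C' * K * 2 ^ n * s)"
      using i1 by (subst Bochner_Integration.integral_add) (auto simp: riesz_def s_def)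
    also have "\<dots> = e / 2 + ?q * (C' * K * 2 ^ n * s)"
      unfolding riesz_one[OF x(2)] s_def[symmetric] using s C' by (simp add: e1_def)
    also have "?q * (C' * K * 2 ^ n * s) \<le> ?q * K'"
      using q by (intro mult_left_mono) (auto simp: K'_def)
    also have "\<dots> \<le> (2 * (1 - norm x)) * K'" using q K' by (intro mult_right_mono) auto
    also have "\<dots> \<le> (2 * (e / (4 * K'))) * K'" using x K' by (intro mult_right_mono) auto
    also have "\<dots> = e / 2" using K' by simp
    finally show "\<bar>LINT z|sphere_measure. k z * (\<alpha> z - \<alpha> w)\<bar> \<le> e" by simp
  qed
qed

section \<open>Boundary behaviour of the biharmonic Poisson kernels\<close>

definition poisson :: "(real ^ 'n::finite \<Rightarrow> real) \<Rightarrow> real ^ 'n \<Rightarrow> real" where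
  "poisson \<phi> x = (1 - x \<bullet> x) * riesz (real CARD('n) / 2) \<phi> x /
     measure sphere_measure (sphere (0 :: real ^ 'n) 1)"

text \<open>
  With the Poisson integrals \<open>H\<close> and \<open>K\<close> of \<open>\<alpha>\<close> and \<open>\<beta>\<close>, where \<open>\<beta>\<close> stands for the inward normal derivative, the
  biharmonic extension has the Almansi form \<open>H + (1 - x \<bullet> x) / 2 * (x \<bullet> \<nabla>H + K)\<close>; here \<open>x \<bullet> \<nabla>H\<close> is written
  out by means of \<open>riesz_grad_inner_self\<close>.
\<close>

definition biharm_ext :: "(real ^ 'n::finite \<Rightarrow> real) \<Rightarrow> (real ^ 'n \<Rightarrow> real) \<Rightarrow> real ^ 'n \<Rightarrow> real" where
  "biharm_ext \<alpha> \<beta> x = (1 - x \<bullet> x)\<^sup>2 / (2 * measure sphere_measure (sphere (0 :: real ^ 'n) 1)) *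
     ((2 - real CARD('n) / 2) * riesz (real CARD('n) / 2) \<alpha> x +
      real CARD('n) / 2 * (1 - x \<bullet> x) * riesz (real CARD('n) / 2 + 1) \<alpha> x +
      riesz (real CARD('n) / 2) \<beta> x)"

lemma riesz_diff:
  assumes "norm x < 1" "continuous_on (sphere 0 1) \<alpha>" "continuous_on (sphere 0 1) \<beta>"
  shows "riesz c (\<lambda>z. \<alpha> z - \<beta> z) x = riesz c \<alpha> x - riesz c \<beta> x"
  unfolding riesz_def right_diff_distrib
  by (rule Bochner_Integration.integral_diff) (intro riesz_integrable assms)+

lemma riesz_cmult: "riesz c (\<lambda>z. k * \<alpha> z) x = k * riesz c \<alpha> x"
  unfolding riesz_def by (simp add: mult.left_commute)

lemma riesz_cong: "(\<And>z. z \<in> sphere 0 1 \<Longrightarrow> \<alpha> z = \<beta> z) \<Longrightarrow> riesz c \<alpha> x = riesz c \<beta> x"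
  unfolding riesz_def by (intro Bochner_Integration.integral_cong refl) auto

lemma poisson_bound:
  fixes x :: "real ^ 'n::finite"
  assumes x: "norm x < 1" and \<alpha>: "continuous_on (sphere 0 1) \<alpha>"
    and M: "\<And>z. z \<in> sphere 0 1 \<Longrightarrow> \<bar>\<alpha> z\<bar> \<le> M"
  shows "\<bar>poisson \<alpha> x\<bar> \<le> M"
proof -
  let ?A = "measure sphere_measure (sphere (0 :: real ^ 'n) 1)"
  let ?k = "\<lambda>z. ((x - z) \<bullet> (x - z)) powr - (real CARD('n) / 2) * \<alpha> z"
  have "(1 - x \<bullet> x) * \<bar>LINT z|sphere_measure. ?k z\<bar> \<le> M * ?A"
  proof (rule poisson_kernel_bound[OF x])
    show "continuous_on (sphere 0 1) ?k"
      by (intro continuous_intros \<alpha>) (use sqdist_pos[OF x] in fastforce)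
  qed (use M in \<open>auto simp: abs_mult mult.commute intro!: mult_right_mono\<close>)
  then have "\<bar>(1 - x \<bullet> x) * riesz (real CARD('n) / 2) \<alpha> x\<bar> \<le> M * ?A"
    unfolding riesz_def using defect_bounds(1)[OF x] by (simp add: abs_mult)
  then show ?thesis
    using measure_sphere_pos[where 'n = 'n] by (simp add: poisson_def divide_simps)
qed

lemma poisson_diff:
  assumes "norm x < 1" "continuous_on (sphere 0 1) \<alpha>" "continuous_on (sphere 0 1) \<beta>"
  shows "poisson (\<lambda>z. \<alpha> z - \<beta> z) x = poisson \<alpha> x - poisson \<beta> x"
  unfolding poisson_def riesz_diff[OF assms] by (simp add: right_diff_distrib diff_divide_distrib)

lemma riesz_minus_const:
  assumes "norm x < 1" "continuous_on (sphere 0 1) \<alpha>"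
  shows "riesz c (\<lambda>z. \<alpha> z - m) x = riesz c \<alpha> x - m * riesz c (\<lambda>_. 1) x"
  using riesz_diff[OF assms, of "\<lambda>z. m" c] riesz_cmult[of c m "\<lambda>_. 1" x] by simp

text \<open>Radial convergence, uniform in the direction, as the maximum principle on the open ball
  requires. The direction is a variable \<open>w\<close> instead of \<open>sgn x\<close>, which
  would be 0 at the origin.\<close>

definition has_boundary_values :: "(real ^ 'n::finite \<Rightarrow> real) \<Rightarrow> (real ^ 'n \<Rightarrow> real) \<Rightarrow> bool" where
  "has_boundary_values u \<alpha> \<longleftrightarrow> (\<forall>e>0. \<exists>d<1. \<forall>x w. d < norm x \<longrightarrow> norm x < 1 \<longrightarrow> norm w = 1 \<longrightarrow>
     x = norm x *\<^sub>R w \<longrightarrow> \<bar>u x - \<alpha> w\<bar> \<le> e)"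

lemma has_boundary_values_diff:
  fixes u v :: "real ^ 'n::finite \<Rightarrow> real"
  assumes u: "has_boundary_values u \<alpha>" and v: "has_boundary_values v \<alpha>" and e: "e > 0"
  shows "\<exists>d<1. \<forall>x. d < norm x \<longrightarrow> norm x < 1 \<longrightarrow> \<bar>u x - v x\<bar> \<le> e"
proof -
  have e2: "e / 2 > 0" using e by simp
  obtain d1 d2 where d1: "d1 < 1" "\<forall>x w. d1 < norm x \<longrightarrow> norm x < 1 \<longrightarrow> norm w = 1 \<longrightarrow> x = norm x *\<^sub>R w \<longrightarrow> \<bar>u x - \<alpha> w\<bar> \<le> e / 2"
    and d2: "d2 < 1" "\<forall>x w. d2 < norm x \<longrightarrow> norm x < 1 \<longrightarrow> norm w = 1 \<longrightarrow> x = norm x *\<^sub>R w \<longrightarrow> \<bar>v x - \<alpha> w\<bar> \<le> e / 2"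
    using u[unfolded has_boundary_values_def, rule_format, OF e2]
      v[unfolded has_boundary_values_def, rule_format, OF e2] by metis
  show ?thesis
  proof (intro exI[of _ "max d1 d2"] conjI allI impI)
    fix x :: "real ^ 'n" assume x: "max d1 d2 < norm x" "norm x < 1"
    obtain z where z: "norm z = 1" "x = norm x *\<^sub>R z" by (rule unit_direction[of x])
    have 1: "\<bar>u x - \<alpha> z\<bar> \<le> e / 2" using d1(2) x z by simp
    have 2: "\<bar>v x - \<alpha> z\<bar> \<le> e / 2" using d2(2) x z by simp
    have "u x - v x = (u x - \<alpha> z) - (v x - \<alpha> z)" by simp
    also have "\<bar>\<dots>\<bar> \<le> \<bar>u x - \<alpha> z\<bar> + \<bar>v x - \<alpha> z\<bar>" by (rule abs_triangle_ineq4)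
    also have "\<dots> \<le> e / 2 + e / 2" by (rule add_mono[OF 1 2])
    finally show "\<bar>u x - v x\<bar> \<le> e" by simp
  qed (use d1 d2 in simp)
qed

text \<open>By \<open>riesz_one\<close> the normalised kernel has integral 1, so the error is the
  integral of the kernel against \<open>\<alpha> z - \<alpha> w\<close>, to which the oscillation
  lemma applies with \<open>C = 1 / A\<close>.\<close>

lemma poisson_boundary:
  fixes \<alpha> :: "real ^ 'n::finite \<Rightarrow> real"
  assumes \<alpha>: "continuous_on (sphere 0 1) \<alpha>"
  shows "has_boundary_values (poisson \<alpha>) \<alpha>"
  unfolding has_boundary_values_def
proof (intro allI impI)
  fix e :: real assume e: "e > 0"
  define A where "A = measure sphere_measure (sphere (0 :: real ^ 'n) 1)"
  have A: "A > 0" unfolding A_def by (rule measure_sphere_pos)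
  obtain d where d: "d < 1" and *: "\<forall>x k w. d < norm x \<longrightarrow> norm x < 1 \<longrightarrow> norm w = 1 \<longrightarrow> x = norm x *\<^sub>R w \<longrightarrow>
    continuous_on (sphere 0 1) k \<longrightarrow>
    (\<forall>z\<in>sphere 0 1. \<bar>k z\<bar> \<le> (1 / A) * (1 - x \<bullet> x) * ((x - z) \<bullet> (x - z)) powr - (real CARD('n) / 2)) \<longrightarrow>
    \<bar>LINT z|sphere_measure. k z * (\<alpha> z - \<alpha> w)\<bar> \<le> e"
    using boundary_oscillation[OF \<alpha> e, of "1 / A"] by blast
  have "\<bar>poisson \<alpha> x - \<alpha> w\<bar> \<le> e" if x: "d < norm x" "norm x < 1" and w: "norm w = 1" "x = norm x *\<^sub>R w" for x w
  proof -
    let ?k = "\<lambda>z. (1 / A) * (1 - x \<bullet> x) * ((x - z) \<bullet> (x - z)) powr - (real CARD('n) / 2)"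
    have "continuous_on (sphere 0 1) ?k"
      by (intro continuous_intros) (use sqdist_pos[OF x(2)] in fastforce)
    moreover have "\<forall>z\<in>sphere 0 1. \<bar>?k z\<bar> \<le> ?k z" using A defect_bounds(1)[OF x(2)] by simp
    ultimately have "\<bar>LINT z|sphere_measure. ?k z * (\<alpha> z - \<alpha> w)\<bar> \<le> e" using * x w by blast
    also have "(LINT z|sphere_measure. ?k z * (\<alpha> z - \<alpha> w)) =
        (1 / A) * (1 - x \<bullet> x) * riesz (real CARD('n) / 2) (\<lambda>z. \<alpha> z - \<alpha> w) x"
      by (simp only: riesz_def mult.assoc integral_mult_right_zero)
    also have "\<dots> = poisson \<alpha> x - \<alpha> w * ((1 - x \<bullet> x) * riesz (real CARD('n) / 2) (\<lambda>_. 1) x / A)"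
      unfolding riesz_minus_const[OF x(2) \<alpha>] by (simp add: poisson_def A_def algebra_simps diff_divide_distrib)
    also have "(1 - x \<bullet> x) * riesz (real CARD('n) / 2) (\<lambda>_. 1) x / A = 1"
      unfolding riesz_one[OF x(2)] A_def[symmetric] using A by simp
    finally show ?thesis by simp
  qed
  with d show "\<exists>d<1. \<forall>x w. d < norm x \<longrightarrow> norm x < 1 \<longrightarrow> norm w = 1 \<longrightarrow> x = norm x *\<^sub>R w \<longrightarrow>
    \<bar>poisson \<alpha> x - \<alpha> w\<bar> \<le> e" by blast
qed

text \<open>By \<open>riesz_one\<close> the product of the defect and \<open>riesz a\<close> of the
  constant 1 is constant; setting its radial derivative to zero determines
  \<open>riesz (a + 1)\<close> of the constant 1, the only other potential that occurs. The result
  allows constants to be subtracted from the boundary datum.\<close>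

lemma biharm_ext_one:
  fixes x :: "real ^ 'n::finite"
  assumes x: "norm x < 1"
  shows "biharm_ext (\<lambda>_. 1) (\<lambda>_. 0) x = 1"
proof -
  define A where "A = measure sphere_measure (sphere (0 :: real ^ 'n) 1)"
  have A: "A > 0" unfolding A_def by (rule measure_sphere_pos)
  define a where "a = real CARD('n) / 2"
  define q where "q = 1 - x \<bullet> x"
  have q: "q > 0" unfolding q_def by (rule defect_bounds(1)[OF x])
  have c1: "continuous_on (sphere 0 1) (\<lambda>_ :: real ^ 'n. 1 :: real)" by simp
  define S where "S = riesz a (\<lambda>_. 1) x"
  define S' where "S' = riesz (a + 1) (\<lambda>_. 1) x"
  have qS: "q * S = A" using riesz_one[OF x] unfolding S_def q_def a_def A_def .
  have "((\<lambda>x. (1 - x \<bullet> x) * riesz a (\<lambda>_. 1) x) has_derivative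
      (\<lambda>h. q * (riesz_grad a (\<lambda>_. 1) x \<bullet> h) + - (2 * (x \<bullet> h)) * S)) (at x)"
    unfolding S_def q_def
    by (rule has_derivative_eq_rhs, rule has_derivative_mult, rule derivative_intros, rule derivative_intros,
        rule derivative_intros, rule derivative_intros, rule derivative_intros, rule riesz_has_derivative[OF x c1])
       (auto simp: inner_commute)
  moreover have "((\<lambda>x. (1 - x \<bullet> x) * riesz a (\<lambda>_. 1) x) has_derivative (\<lambda>h. 0)) (at x)"
  proof (rule has_derivative_transform_within_open[of "\<lambda>_. A" _ _ _ "ball 0 1"])
    fix y :: "real ^ 'n" assume "y \<in> ball 0 1"
    then show "A = (1 - y \<bullet> y) * riesz a (\<lambda>_. 1) y" using riesz_one[of y] by (simp add: A_def a_def)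
  qed (use x in auto)
  ultimately have "(\<lambda>h. q * (riesz_grad a (\<lambda>_. 1) x \<bullet> h) + - (2 * (x \<bullet> h)) * S) = (\<lambda>h. 0)"
    by (rule has_derivative_unique)
  \<comment> \<open>The radial direction \<open>h = x\<close> turns the vanishing derivative into a
    linear relation between \<open>S\<close> and \<open>S'\<close>, because
    \<open>riesz_grad_inner_self\<close> expresses the radial derivative by these two.\<close>
  from fun_cong[OF this, of x] have "q * (- a * S + a * q * S') - 2 * (1 - q) * S = 0"
    using riesz_grad_inner_self[OF x c1, of a]
    by (simp add: inner_commute S_def S'_def q_def)
  then have S': "a * q * q * S' = (a * q + 2 - 2 * q) * S" by (simp add: algebra_simps)
  have "q\<^sup>2 * ((2 - a) * S + a * q * S') = q * ((2 - a) * q * S + a * q * q * S')"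
    by (simp add: algebra_simps power2_eq_square)
  also have "\<dots> = 2 * (q * S)" unfolding S' by (simp add: algebra_simps)
  finally have "q\<^sup>2 * ((2 - a) * S + a * q * S') = 2 * A" unfolding qS .
  moreover have "riesz a (\<lambda>_. 0) x = 0" by (simp add: riesz_def)
  ultimately show ?thesis
    using A unfolding biharm_ext_def A_def[symmetric] a_def[symmetric] q_def[symmetric] S_def[symmetric] S'_def[symmetric]
    by (simp add: field_simps)
qed

lemma defect_le_dist:
  fixes x z :: "real ^ 'n::finite"
  assumes "norm x < 1" "norm z = 1"
  shows "(1 - x \<bullet> x)\<^sup>2 \<le> 4 * ((x - z) \<bullet> (x - z))"
proof -
  obtain w where w: "norm w = 1" "x = norm x *\<^sub>R w" by (rule unit_direction)
  have "1 - x \<bullet> x \<le> 2 * (1 - norm x)" by (rule defect_bounds(3)[OF assms(1)])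
  also have "\<dots> \<le> 2 * norm (x - z)"
    by (rule mult_left_mono[OF dist_direction(2)[OF w assms(2,1)]]) simp
  finally have "1 - x \<bullet> x \<le> 2 * norm (x - z)" .
  then have "(1 - x \<bullet> x)\<^sup>2 \<le> (2 * norm (x - z))\<^sup>2"
    by (rule power_mono) (use defect_bounds(1)[OF assms(1)] in simp)
  then show ?thesis by (simp add: power_mult_distrib power2_norm_eq_inner)
qed

lemma biharm_ext_minus_const:
  fixes \<alpha> \<beta> :: "real ^ 'n::finite \<Rightarrow> real"
  assumes x: "norm x < 1" and \<alpha>: "continuous_on (sphere 0 1) \<alpha>"
  shows "biharm_ext (\<lambda>z. \<alpha> z - m) \<beta> x = biharm_ext \<alpha> \<beta> x - m"
proof -
  have "biharm_ext (\<lambda>z. \<alpha> z - m) \<beta> x = biharm_ext \<alpha> \<beta> x - m * biharm_ext (\<lambda>_. 1) (\<lambda>_. 0) x"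
    unfolding biharm_ext_def riesz_minus_const[OF x \<alpha>]
    by (simp add: riesz_def algebra_simps add_divide_distrib diff_divide_distrib)
  then show ?thesis unfolding biharm_ext_one[OF x] by simp
qed

lemma biharm_ext_boundary:
  fixes \<alpha> \<beta> :: "real ^ 'n::finite \<Rightarrow> real"
  assumes \<alpha>: "continuous_on (sphere 0 1) \<alpha>" and \<beta>: "continuous_on (sphere 0 1) \<beta>"
  shows "has_boundary_values (biharm_ext \<alpha> \<beta>) \<alpha>"
  unfolding has_boundary_values_def
proof (intro allI impI)
  fix e :: real assume e: "e > 0"
  define A where "A = measure sphere_measure (sphere (0 :: real ^ 'n) 1)"
  have A: "A > 0" unfolding A_def by (rule measure_sphere_pos)
  define a where "a = real CARD('n) / 2"
  have a: "a \<ge> 0" by (simp add: a_def)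
  \<comment> \<open>The first kernel is estimated with \<open>q \<le> 1\<close>, the second with
    \<open>q\<^sup>2 \<le> 4 |x - z|\<^sup>2\<close>. Absolute values are taken because
    \<open>2 - a\<close> is negative for \<open>n > 4\<close>.\<close>
  define C where "C = (\<bar>2 - a\<bar> + 4 * a) / (2 * A)"
  obtain M where M0: "M \<ge> 0" and M: "\<And>z. z \<in> sphere 0 1 \<Longrightarrow> \<bar>\<beta> z\<bar> \<le> M"
    using continuous_sphere_bounded[OF \<beta>] by (metis real_norm_def)
  obtain d where d: "d < 1" and *: "\<forall>x k w. d < norm x \<longrightarrow> norm x < 1 \<longrightarrow> norm w = 1 \<longrightarrow> x = norm x *\<^sub>R w \<longrightarrow>
    continuous_on (sphere 0 1) k \<longrightarrow>
    (\<forall>z\<in>sphere 0 1. \<bar>k z\<bar> \<le> C * (1 - x \<bullet> x) * ((x - z) \<bullet> (x - z)) powr - (real CARD('n) / 2)) \<longrightarrow>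
    \<bar>LINT z|sphere_measure. k z * (\<alpha> z - \<alpha> w)\<bar> \<le> e / 2"
    using boundary_oscillation[OF \<alpha>, of "e / 2" C] e by auto
  show "\<exists>d<1. \<forall>x w. d < norm x \<longrightarrow> norm x < 1 \<longrightarrow> norm w = 1 \<longrightarrow> x = norm x *\<^sub>R w \<longrightarrow>
    \<bar>biharm_ext \<alpha> \<beta> x - \<alpha> w\<bar> \<le> e"
  \<comment> \<open>The second radius disposes of the datum \<open>\<beta>\<close>: its contribution
    is \<open>q / 2\<close> times a Poisson integral bounded by \<open>M\<close>, hence at most
    \<open>(1 - norm x) * M\<close>.\<close>
  proof (intro exI[of _ "max d (1 - e / (2 * (M + 1)))"] conjI allI impI)
    show "max d (1 - e / (2 * (M + 1))) < 1" using d e M0 by simp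
    fix x w :: "real ^ 'n"
    assume xd: "max d (1 - e / (2 * (M + 1))) < norm x" and x: "norm x < 1" and w: "norm w = 1" "x = norm x *\<^sub>R w"
    define q where "q = 1 - x \<bullet> x"
    have q: "q > 0" "q \<le> 1" "q \<le> 2 * (1 - norm x)" using defect_bounds[OF x] by (auto simp: q_def)
    let ?N = "\<lambda>z. (x - z) \<bullet> (x - z)"
    let ?k = "\<lambda>z. q\<^sup>2 / (2 * A) * ((2 - a) * ?N z powr - a + a * q * ?N z powr - (a + 1))"
    have kc: "continuous_on (sphere 0 1) ?k"
      by (intro continuous_intros) (use sqdist_pos[OF x] in fastforce)+
    have kb: "\<bar>?k z\<bar> \<le> C * q * ?N z powr - a" if z: "z \<in> sphere 0 1" for z
    proof -
      have N: "?N z > 0" by (rule sqdist_pos[OF x z])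
      have "?N z powr - (a + 1) * ?N z = ?N z powr - a"
        using N powr_mult_base[of "?N z" "- (a + 1)"] by (simp add: mult.commute)
      moreover have "q\<^sup>2 \<le> 4 * ?N z" unfolding q_def by (rule defect_le_dist) (use x z in auto)
      then have "?N z powr - (a + 1) * q\<^sup>2 \<le> ?N z powr - (a + 1) * (4 * ?N z)"
        by (intro mult_left_mono) auto
      ultimately have 1: "q\<^sup>2 * ?N z powr - (a + 1) \<le> 4 * ?N z powr - a" by (simp add: mult_ac)
      have "\<bar>(2 - a) * (q * ?N z powr - a) + a * (q\<^sup>2 * ?N z powr - (a + 1))\<bar> \<le>
          \<bar>2 - a\<bar> * (q * ?N z powr - a) + a * (q\<^sup>2 * ?N z powr - (a + 1))"
        using a q by (intro order_trans[OF abs_triangle_ineq]) (simp add: abs_mult)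
      also have "\<dots> \<le> \<bar>2 - a\<bar> * (1 * ?N z powr - a) + a * (4 * ?N z powr - a)"
        using a q 1 by (intro add_mono mult_left_mono mult_right_mono) auto
      also have "\<dots> = (\<bar>2 - a\<bar> + 4 * a) * ?N z powr - a" by (simp add: algebra_simps)
      finally have "q / (2 * A) * \<bar>(2 - a) * (q * ?N z powr - a) + a * (q\<^sup>2 * ?N z powr - (a + 1))\<bar> \<le>
          q / (2 * A) * ((\<bar>2 - a\<bar> + 4 * a) * ?N z powr - a)"
        using q A by (intro mult_left_mono) auto
      moreover have "\<bar>?k z\<bar> = q / (2 * A) * \<bar>(2 - a) * (q * ?N z powr - a) + a * (q\<^sup>2 * ?N z powr - (a + 1))\<bar>"
      proof -
        have "?k z = q / (2 * A) * ((2 - a) * (q * ?N z powr - a) + a * (q\<^sup>2 * ?N z powr - (a + 1)))"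
          by (simp add: algebra_simps power2_eq_square)
        then show ?thesis using q A by (simp add: abs_mult)
      qed
      ultimately show ?thesis by (simp add: C_def mult_ac)
    qed
    have 1: "\<bar>LINT z|sphere_measure. ?k z * (\<alpha> z - \<alpha> w)\<bar> \<le> e / 2"
      using *[rule_format, of x w ?k] xd x w kc kb unfolding q_def a_def by auto
    have \<alpha>w: "continuous_on (sphere 0 1) (\<lambda>z. \<alpha> z - \<alpha> w)" by (intro continuous_intros \<alpha>)
    have expand: "C * (X * M + Y * N) * D = C * X * (M * D) + C * Y * (N * D)" for C X Y M N D :: real
      by (simp add: algebra_simps)
    have "(LINT z|sphere_measure. ?k z * (\<alpha> z - \<alpha> w)) =
       (LINT z|sphere_measure. q\<^sup>2 / (2 * A) * (2 - a) * (?N z powr - a * (\<alpha> z - \<alpha> w)) +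
         q\<^sup>2 / (2 * A) * (a * q) * (?N z powr - (a + 1) * (\<alpha> z - \<alpha> w)))"
      by (intro Bochner_Integration.integral_cong refl) (rule expand)
    also have "\<dots> = q\<^sup>2 / (2 * A) * (2 - a) * riesz a (\<lambda>z. \<alpha> z - \<alpha> w) x +
         q\<^sup>2 / (2 * A) * (a * q) * riesz (a + 1) (\<lambda>z. \<alpha> z - \<alpha> w) x"
      unfolding riesz_def
      by (subst Bochner_Integration.integral_add)
         (intro integrable_mult_right riesz_integrable x \<alpha>w, intro integrable_mult_right riesz_integrable x \<alpha>w, simp)
    also have "\<dots> = biharm_ext (\<lambda>z. \<alpha> z - \<alpha> w) \<beta> x - q / 2 * poisson \<beta> x"
      unfolding biharm_ext_def poisson_def A_def[symmetric] a_def[symmetric] q_def[symmetric]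
      using A by (simp add: field_simps power2_eq_square)
    finally have "biharm_ext \<alpha> \<beta> x - \<alpha> w = (LINT z|sphere_measure. ?k z * (\<alpha> z - \<alpha> w)) + q / 2 * poisson \<beta> x"
      unfolding biharm_ext_minus_const[OF x \<alpha>] by simp
    moreover have "\<bar>q / 2 * poisson \<beta> x\<bar> \<le> e / 2"
    proof -
      have "\<bar>q / 2 * poisson \<beta> x\<bar> \<le> (1 - norm x) * M"
        unfolding abs_mult using q M0 by (intro mult_mono poisson_bound[OF x \<beta> M]) auto
      also have "\<dots> \<le> (e / (2 * (M + 1))) * (M + 1)" using xd M0 x by (intro mult_mono) auto
      also have "\<dots> = e / 2" using M0 by (simp add: field_simps)
      finally show ?thesis .
    qed
    ultimately show "\<bar>biharm_ext \<alpha> \<beta> x - \<alpha> w\<bar> \<le> e" using 1 by linarith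
  qed
qed

section \<open>Estimates for smooth boundary values\<close>

lemma poisson_uminus: "poisson (\<lambda>z. - \<alpha> z) x = - poisson \<alpha> x"
  using riesz_cmult[of _ "-1" \<alpha> x] by (simp add: poisson_def)

lemma continuous_on_poisson:
  "continuous_on (sphere 0 1) \<phi> \<Longrightarrow> continuous_on (ball 0 1) (poisson \<phi>)"
  for \<phi> :: "real ^ 'n::finite \<Rightarrow> real"
  unfolding poisson_def[abs_def] using measure_sphere_pos[where 'n = 'n]
  by (intro continuous_intros continuous_on_riesz) auto

lemma has_lap_poisson:
  fixes \<phi> :: "real ^ 'n::finite \<Rightarrow> real"
  assumes "norm x < 1" "continuous_on (sphere 0 1) \<phi>"
  shows "\<exists>p. has_lap (poisson \<phi>) x p 0"
proof -
  obtain p where "has_lap (\<lambda>x. (1 - x \<bullet> x) * riesz (real CARD('n) / 2) \<phi> x) x p 0"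
    using has_lap_poisson_kernel[OF assms] by blast
  from has_lap_cmult[OF this, of "1 / measure sphere_measure (sphere (0 :: real ^ 'n) 1)"]
  show ?thesis unfolding poisson_def[abs_def] by auto
qed

lemma continuous_has_boundary_values:
  fixes u :: "real ^ 'n::finite \<Rightarrow> real"
  assumes u: "continuous_on (cball 0 1) u"
  shows "has_boundary_values u u"
  unfolding has_boundary_values_def
proof (intro allI impI)
  fix e :: real assume e: "e > 0"
  have "uniformly_continuous_on (cball 0 1) u"
    by (rule compact_uniformly_continuous[OF u compact_cball])
  from this[unfolded uniformly_continuous_on_def, rule_format, OF e]
  obtain \<delta> where \<delta>: "\<delta> > 0" "\<forall>x\<in>cball 0 1. \<forall>x'\<in>cball 0 1. dist x' x < \<delta> \<longrightarrow> dist (u x') (u x) < e"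
    by (elim exE conjE)
  show "\<exists>d<1. \<forall>x w. d < norm x \<longrightarrow> norm x < 1 \<longrightarrow> norm w = 1 \<longrightarrow> x = norm x *\<^sub>R w \<longrightarrow> \<bar>u x - u w\<bar> \<le> e"
  proof (intro exI[of _ "1 - \<delta>"] conjI allI impI)
    fix x w :: "real ^ 'n" assume x: "1 - \<delta> < norm x" "norm x < 1" and w: "norm w = 1" "x = norm x *\<^sub>R w"
    have "norm (x - w) = 1 - norm x" by (rule dist_direction(1)[OF w w(1) x(2)])
    then have "dist x w < \<delta>" using x by (simp add: dist_norm)
    with \<delta>(2)[THEN bspec[of _ _ w], THEN bspec[of _ _ x]] x w show "\<bar>u x - u w\<bar> \<le> e"
      by (simp add: dist_real_def)
  qed (use \<delta> in auto)
qed

text \<open>The barrier is \<open>T * (1 - x \<bullet> x)\<close>: it vanishes on the sphere and, by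
  the choice of \<open>T\<close>, has Laplacian \<open>- S\<close>, which outweighs the Laplacian of
  \<open>u\<close>.\<close>

lemma poisson_estimate_upper:
  fixes u :: "real ^ 'n::finite \<Rightarrow> real"
  assumes u: "continuous_on (cball 0 1) u"
    and lap: "\<And>x. norm x < 1 \<Longrightarrow> \<exists>p s. has_lap u x p s \<and> \<bar>s\<bar> < S"
    and x: "norm x < 1"
  shows "u x - poisson u x \<le> S / (2 * real CARD('n)) * (1 - x \<bullet> x)"
proof -
  define T where "T = S / (2 * real CARD('n))"
  have n: "real CARD('n) > 0" by simp
  have us: "continuous_on (sphere 0 1) u" by (rule continuous_on_subset[OF u]) auto
  have "S > 0" using lap[OF x] by fastforce
  then have T: "T > 0" by (simp add: T_def)
  define w where "w x = u x - poisson u x - T * (1 - x \<bullet> x)" for x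
  have "w x \<le> 0"
  proof (rule max_principle_ball[OF _ _ _ x])
    show "continuous_on (ball 0 1) w"
      unfolding w_def by (intro continuous_intros continuous_on_poisson us continuous_on_subset[OF u]) auto
    fix e :: real assume e: "e > 0"
    obtain d where d: "d < 1" "\<forall>x. d < norm x \<longrightarrow> norm x < 1 \<longrightarrow> \<bar>u x - poisson u x\<bar> \<le> e"
      using has_boundary_values_diff[OF continuous_has_boundary_values[OF u] poisson_boundary[OF us] e] by blast
    have "w x \<le> e" if x: "d < norm x" "norm x < 1" for x
    proof -
      have "u x - poisson u x \<le> e" using d(2) x by (meson abs_le_D1)
      moreover have "T * (1 - x \<bullet> x) \<ge> 0" using T defect_bounds(1)[OF x(2)] by simp
      ultimately show ?thesis unfolding w_def by linarith
    qed
    with d(1) show "\<exists>d<1. \<forall>x. d < norm x \<longrightarrow> norm x < 1 \<longrightarrow> w x \<le> e" by blast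
  next
    fix y assume y: "norm y < 1" "w y > 0"
    obtain p s where p: "has_lap u y p s" "\<bar>s\<bar> < S" using lap[OF y(1)] by blast
    obtain p' where p': "has_lap (poisson u) y p' 0" using has_lap_poisson[OF y(1) us] by blast
    have "\<exists>p. has_lap w y p (s + S)"
      using has_lap_diff[OF has_lap_diff[OF p(1) p'] has_lap_cmult[OF has_lap_defect, of T]] n
      unfolding w_def[abs_def] T_def by auto
    moreover have "s + S > 0" using p(2) by linarith
    ultimately show "\<exists>p s. has_lap w y p s \<and> s > 0" by blast
  qed
  then show ?thesis by (simp add: w_def T_def)
qed

lemma poisson_estimate:
  fixes u :: "real ^ 'n::finite \<Rightarrow> real"
  assumes u: "continuous_on (cball 0 1) u"
    and lap: "\<And>x. norm x < 1 \<Longrightarrow> \<exists>p s. has_lap u x p s \<and> \<bar>s\<bar> < S"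
    and x: "norm x < 1"
  shows "\<bar>u x - poisson u x\<bar> \<le> S / (2 * real CARD('n)) * (1 - x \<bullet> x)"
proof -
  have "(- u x) - poisson (\<lambda>x. - u x) x \<le> S / (2 * real CARD('n)) * (1 - x \<bullet> x)"
  proof (rule poisson_estimate_upper[OF _ _ x])
    show "continuous_on (cball 0 1) (\<lambda>x. - u x)" by (intro continuous_intros u)
    fix x :: "real ^ 'n" assume "norm x < 1"
    from lap[OF this] obtain p s where p: "has_lap u x p s" "\<bar>s\<bar> < S" by blast
    from has_lap_cmult[OF p(1), of "-1"] have "has_lap (\<lambda>x. - u x) x (- p) (- s)" by simp
    moreover have "\<bar>- s\<bar> < S" using p(2) by simp
    ultimately show "\<exists>p s. has_lap (\<lambda>x. - u x) x p s \<and> \<bar>s\<bar> < S" by blast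
  qed
  with poisson_estimate_upper[OF assms] show ?thesis unfolding poisson_uminus by linarith
qed

text \<open>The mean value theorem on the ray makes the quotient equal to
  \<open>gV (t *\<^sub>R x) \<bullet> x\<close> with \<open>t\<close> between \<open>s\<close> and
  1; uniform continuity of \<open>gV\<close> on the closed unit ball, which lies inside the larger
  ball, does the rest.\<close>

lemma radial_difference_quotient:
  fixes V :: "real ^ 'n::finite \<Rightarrow> real"
  assumes R: "R > 1"
    and d: "\<And>x. norm x < R \<Longrightarrow> (V has_derivative (\<lambda>h. gV x \<bullet> h)) (at x)"
    and c: "continuous_on (ball 0 R) gV" and e: "e > 0"
  shows "\<forall>\<^sub>F s in at_left 1. \<forall>x\<in>cball 0 1. \<bar>(V x - V (s *\<^sub>R x)) / (1 - s) - gV x \<bullet> x\<bar> \<le> e"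
proof -
  have c1: "continuous_on (cball 0 1) gV" by (rule continuous_on_subset[OF c]) (use R in auto)
  have "uniformly_continuous_on (cball 0 1) gV"
    by (rule compact_uniformly_continuous[OF c1 compact_cball])
  from this[unfolded uniformly_continuous_on_def, rule_format, OF e]
  obtain \<delta> where \<delta>: "\<delta> > 0" "\<forall>x\<in>cball 0 1. \<forall>x'\<in>cball 0 1. dist x' x < \<delta> \<longrightarrow> dist (gV x') (gV x) < e"
    by (elim exE conjE)
  have "\<forall>\<^sub>F s in at_left 1. s \<in> {max 0 (1 - \<delta>)<..<1::real}"
    by (rule eventually_at_left_real) (use \<delta> in auto)
  then show ?thesis
  proof eventually_elim
    case (elim s)
    then have s: "0 < s" "1 - \<delta> < s" "s < 1" by auto
    show ?case
    proof
      fix x :: "real ^ 'n" assume "x \<in> cball 0 1"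
      then have x: "norm x \<le> 1" by simp
      have D: "((\<lambda>t. V (t *\<^sub>R x)) has_real_derivative gV (t *\<^sub>R x) \<bullet> x) (at t)" if "0 \<le> t" "t \<le> 1" for t
      proof -
        have "norm (t *\<^sub>R x) \<le> 1" using that x by (simp add: mult_le_one)
        then have *: "(V has_derivative (\<lambda>h. gV (t *\<^sub>R x) \<bullet> h)) (at (t *\<^sub>R x))" using R by (intro d) simp
        have "((\<lambda>t. t *\<^sub>R x) has_derivative (\<lambda>h. h *\<^sub>R x)) (at t)" by (auto intro!: derivative_eq_intros)
        from has_derivative_compose[OF this *] show ?thesis
          unfolding has_field_derivative_def by (rule has_derivative_eq_rhs) (auto simp: fun_eq_iff)
      qed
      have "\<exists>t. s < t \<and> t < 1 \<and> V (1 *\<^sub>R x) - V (s *\<^sub>R x) = (1 - s) * (gV (t *\<^sub>R x) \<bullet> x)"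
        by (rule MVT2[OF s(3)]) (use D s in auto)
      then obtain t where t: "s < t" "t < 1" "V x - V (s *\<^sub>R x) = (1 - s) * (gV (t *\<^sub>R x) \<bullet> x)" by auto
      have "(V x - V (s *\<^sub>R x)) / (1 - s) - gV x \<bullet> x = (gV (t *\<^sub>R x) - gV x) \<bullet> x"
        using t(3) s by (simp add: inner_diff_left)
      also have "\<bar>\<dots>\<bar> \<le> norm (gV (t *\<^sub>R x) - gV x) * norm x" by (rule Cauchy_Schwarz_ineq2)
      also have "\<dots> \<le> e * 1"
      proof (intro mult_mono x)
        have "norm (t *\<^sub>R x - x) = (1 - t) * norm x"
          using t by (metis (no_types, opaque_lifting) abs_minus_commute abs_of_pos diff_gt_0_iff_gt norm_scaleR scaleR_left_diff_distrib scaleR_one)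
        also have "\<dots> \<le> (1 - t) * 1" using x t by (intro mult_left_mono) auto
        finally have "dist (t *\<^sub>R x) x < \<delta>" using t s by (simp add: dist_norm)
        moreover have "t *\<^sub>R x \<in> cball 0 1" "x \<in> cball 0 1" using x t s by (auto simp: mult_le_one)
        ultimately show "norm (gV (t *\<^sub>R x) - gV x) \<le> e"
          using \<delta>(2) by (metis dist_norm less_imp_le)
      qed (use e in auto)
      finally show "\<bar>(V x - V (s *\<^sub>R x)) / (1 - s) - gV x \<bullet> x\<bar> \<le> e" by simp
    qed
  qed
qed

lemma uniform_scaling_limit:
  fixes V :: "real ^ 'n::finite \<Rightarrow> real"
  assumes V: "continuous_on (cball 0 1) V" and e: "e > 0"
  shows "\<forall>\<^sub>F s in at_left 1. \<forall>x\<in>cball 0 1. \<bar>V (s *\<^sub>R x) - V x\<bar> \<le> e"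
proof -
  have "uniformly_continuous_on (cball 0 1) V"
    by (rule compact_uniformly_continuous[OF V compact_cball])
  from this[unfolded uniformly_continuous_on_def, rule_format, OF e]
  obtain \<delta> where \<delta>: "\<delta> > 0" "\<forall>x\<in>cball 0 1. \<forall>x'\<in>cball 0 1. dist x' x < \<delta> \<longrightarrow> dist (V x') (V x) < e"
    by (elim exE conjE)
  have "\<forall>\<^sub>F s in at_left 1. s \<in> {max 0 (1 - \<delta>)<..<1::real}"
    by (rule eventually_at_left_real) (use \<delta> in auto)
  then show ?thesis
  proof eventually_elim
    case (elim s)
    then have s: "0 < s" "1 - \<delta> < s" "s < 1" by auto
    show ?case
    proof
      fix x :: "real ^ 'n" assume "x \<in> cball 0 1"
      then have x: "norm x \<le> 1" by simp
      have "norm (s *\<^sub>R x - x) = (1 - s) * norm x"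
        using s by (metis (no_types, opaque_lifting) abs_minus_commute abs_of_pos diff_gt_0_iff_gt norm_scaleR scaleR_left_diff_distrib scaleR_one)
      also have "\<dots> \<le> (1 - s) * 1" using x s by (intro mult_left_mono) auto
      finally have "dist (s *\<^sub>R x) x < \<delta>" using s by (simp add: dist_norm)
      moreover have "s *\<^sub>R x \<in> cball 0 1" "x \<in> cball 0 1" using x s by (auto simp: mult_le_one)
      ultimately show "\<bar>V (s *\<^sub>R x) - V x\<bar> \<le> e"
        using \<delta>(2) by (metis dist_real_def less_imp_le)
    qed
  qed
qed

text \<open>
  If \<^term>\<open>V\<close> is the Laplacian of \<^term>\<open>F\<close>, then the Laplacian of the function estimated here is
  \<^term>\<open>(1 - x \<bullet> x) * G x\<close> formally; the third derivatives of \<^term>\<open>F\<close> that this involves are avoided by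
  replacing the radial derivative by a difference quotient.
\<close>

lemma first_order_combination_estimate:
  fixes F V G :: "real ^ 'n::finite \<Rightarrow> real"
  assumes R: "R > 1"
    and dF: "\<And>x. norm x < R \<Longrightarrow> (F has_derivative (\<lambda>h. gF x \<bullet> h)) (at x)"
    and lF: "\<And>x. norm x < R \<Longrightarrow> has_lap F x (gF x) (V x)"
    and cF: "continuous_on (ball 0 R) gF"
    and dV: "\<And>x. norm x < R \<Longrightarrow> (V has_derivative (\<lambda>h. gV x \<bullet> h)) (at x)"
    and lV: "\<And>x. norm x < R \<Longrightarrow> has_lap V x (gV x) (G x)"
    and cV: "continuous_on (ball 0 R) gV"
    and S: "\<And>x. norm x < 1 \<Longrightarrow> \<bar>G x\<bar> \<le> S"
    and x: "norm x < 1"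
  defines "U \<equiv> \<lambda>x. (1 - x \<bullet> x) * V x + 4 * (gF x \<bullet> x) + (2 * real CARD('n) - 8) * F x"
  shows "\<bar>U x - poisson U x\<bar> \<le> S / (2 * real CARD('n)) * (1 - x \<bullet> x)"
proof (rule field_le_epsilon)
  fix e0 :: real assume e0: "e0 > 0"
  define n where "n = real CARD('n)"
  have n: "n \<ge> 1" unfolding n_def by (simp add: Suc_leI)
  \<comment> \<open>The errors collected below add up to \<open>16 * e\<close>, so
    \<open>e0 / 20\<close> leaves some slack.\<close>
  define e where "e = e0 / 20"
  have e: "e > 0" using e0 by (simp add: e_def)
  have contF: "continuous_on (cball 0 1) F"
    by (rule continuous_at_imp_continuous_on, rule ballI, rule has_derivative_continuous[OF dF]) (use R in auto)
  have contV: "continuous_on (cball 0 1) V"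
    by (rule continuous_at_imp_continuous_on, rule ballI, rule has_derivative_continuous[OF dV]) (use R in auto)
  have contgF: "continuous_on (cball 0 1) gF" by (rule continuous_on_subset[OF cF]) (use R in auto)
  have contU: "continuous_on (cball 0 1) U"
    unfolding U_def by (intro continuous_intros contF contV contgF)
  have sph: "continuous_on (sphere 0 1) f" if "continuous_on (cball 0 1) f" for f :: "real ^ 'n \<Rightarrow> real"
    by (rule continuous_on_subset[OF that]) auto
  obtain M where M: "M \<ge> 0" "\<And>x. x \<in> cball 0 1 \<Longrightarrow> \<bar>V x\<bar> \<le> M"
  proof -
    obtain B where "\<forall>y\<in>V ` cball 0 1. norm y \<le> B"
      using compact_imp_bounded[OF compact_continuous_image[OF contV compact_cball]]
      unfolding bounded_iff by blast
    then show ?thesis by (intro that[of "max 0 B"]) (auto simp: le_max_iff_disj)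
  qed
  have "\<forall>\<^sub>F s in at_left 1. s \<in> {max 0 (1 - e / (M + 1))<..<1::real}"
    by (rule eventually_at_left_real) (use e M in auto)
  moreover have "\<forall>\<^sub>F s in at_left 1. \<forall>x\<in>cball 0 1. \<bar>(F x - F (s *\<^sub>R x)) / (1 - s) - gF x \<bullet> x\<bar> \<le> e"
    by (rule radial_difference_quotient[OF R dF cF e])
  moreover have "\<forall>\<^sub>F s in at_left 1. \<forall>x\<in>cball 0 1. \<bar>(V x - V (s *\<^sub>R x)) / (1 - s) - gV x \<bullet> x\<bar> \<le> e"
    by (rule radial_difference_quotient[OF R dV cV e])
  moreover have "\<forall>\<^sub>F s in at_left 1. \<forall>x\<in>cball 0 1. \<bar>V (s *\<^sub>R x) - V x\<bar> \<le> e"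
    by (rule uniform_scaling_limit[OF contV e])
  ultimately have "\<forall>\<^sub>F s in at_left 1. s \<in> {max 0 (1 - e / (M + 1))<..<1} \<and>
      (\<forall>x\<in>cball 0 1. \<bar>(F x - F (s *\<^sub>R x)) / (1 - s) - gF x \<bullet> x\<bar> \<le> e) \<and>
      (\<forall>x\<in>cball 0 1. \<bar>(V x - V (s *\<^sub>R x)) / (1 - s) - gV x \<bullet> x\<bar> \<le> e) \<and>
      (\<forall>x\<in>cball 0 1. \<bar>V (s *\<^sub>R x) - V x\<bar> \<le> e)"
    by (intro eventually_conj)
  then have "\<exists>s. s \<in> {max 0 (1 - e / (M + 1))<..<1} \<and>
      (\<forall>x\<in>cball 0 1. \<bar>(F x - F (s *\<^sub>R x)) / (1 - s) - gF x \<bullet> x\<bar> \<le> e) \<and>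
      (\<forall>x\<in>cball 0 1. \<bar>(V x - V (s *\<^sub>R x)) / (1 - s) - gV x \<bullet> x\<bar> \<le> e) \<and>
      (\<forall>x\<in>cball 0 1. \<bar>V (s *\<^sub>R x) - V x\<bar> \<le> e)"
    by (rule eventually_happens'[rotated]) simp
  then obtain s where s0: "s \<in> {max 0 (1 - e / (M + 1))<..<1}"
    and sF0: "\<forall>x\<in>cball 0 1. \<bar>(F x - F (s *\<^sub>R x)) / (1 - s) - gF x \<bullet> x\<bar> \<le> e"
    and sV1: "\<forall>x\<in>cball 0 1. \<bar>(V x - V (s *\<^sub>R x)) / (1 - s) - gV x \<bullet> x\<bar> \<le> e"
    and sV2: "\<forall>x\<in>cball 0 1. \<bar>V (s *\<^sub>R x) - V x\<bar> \<le> e"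
    by (elim exE conjE)
  have s: "0 < s" "1 - e / (M + 1) < s" "s < 1" using s0 by auto
  note sF = sF0[THEN bspec] and sV = sV1[THEN bspec] and sV0 = sV2[THEN bspec]
  have scal: "norm (s *\<^sub>R x) \<le> norm x" for x :: "real ^ 'n"
    using s by (simp add: mult_left_le_one_le)
  define u where "u x = (1 - x \<bullet> x) * V x + (4 / (1 - s)) * (F x - F (s *\<^sub>R x)) + (2 * n - 8) * F x" for x
  have "continuous_on (cball 0 1) (\<lambda>x. F (s *\<^sub>R x))"
    by (rule continuous_on_compose2[OF contF]) (use s in \<open>auto intro!: continuous_intros simp: mult_le_one\<close>)
  then have contu: "continuous_on (cball 0 1) u"
    unfolding u_def by (intro continuous_intros contF contV)
  have uU: "\<bar>u y - U y\<bar> \<le> 4 * e" if "y \<in> cball 0 1" for y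
  proof -
    have "u y - U y = 4 * ((F y - F (s *\<^sub>R y)) / (1 - s) - gF y \<bullet> y)"
      by (simp add: u_def U_def n_def algebra_simps)
    then have eq: "\<bar>u y - U y\<bar> = 4 * \<bar>(F y - F (s *\<^sub>R y)) / (1 - s) - gF y \<bullet> y\<bar>"
      by (simp only: abs_mult abs_numeral)
    show ?thesis unfolding eq by (rule mult_left_mono[OF sF[OF that]]) simp
  qed
  have "\<bar>u x - poisson u x\<bar> \<le> (S + 16 * e) / (2 * n) * (1 - x \<bullet> x)"
    unfolding n_def
  proof (rule poisson_estimate[OF contu _ x])
    fix y :: "real ^ 'n" assume y: "norm y < 1"
    then have yR: "norm y < R" "norm (s *\<^sub>R y) < R" and yc: "y \<in> cball 0 1"
      using R scal[of y] by (auto simp del: norm_scaleR)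
    define l where "l = (1 - y \<bullet> y) * G y + 4 * ((V y - V (s *\<^sub>R y)) / (1 - s) - gV y \<bullet> y) + 4 * ((1 + s) * V (s *\<^sub>R y) - 2 * V y)"
    have lap: "\<exists>p. has_lap u y p ((- 2 * n * V y + 2 * (- 2 *\<^sub>R y \<bullet> gV y) + (1 - y \<bullet> y) * G y) +
        (4 / (1 - s)) * (V y - s\<^sup>2 * V (s *\<^sub>R y)) + (2 * n - 8) * V y)"
      using has_lap_add[OF has_lap_add[OF has_lap_mult[OF has_lap_defect lV[OF yR(1)]]
          has_lap_cmult[OF has_lap_diff[OF lF[OF yR(1)] has_lap_scale[OF lF[OF yR(2)]]], of "4 / (1 - s)"]]
          has_lap_cmult[OF lF[OF yR(1)], of "2 * n - 8"]]
      unfolding u_def[abs_def] n_def by (rule exI)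
    \<comment> \<open>The factorisation \<open>1 - s\<^sup>2 = (1 - s) * (1 + s)\<close> splits the
      scaled Laplacian into the difference quotient of \<open>V\<close> and a regular term. The
      quotient compensates the gradient term of the product rule, and \<open>2 * n - 8\<close>
      leaves \<open>- 8 * V y\<close> to compensate the regular term.\<close>
    have eq: "(- 2 * n * V y + 2 * (- 2 *\<^sub>R y \<bullet> gV y) + (1 - y \<bullet> y) * G y) +
        (4 / (1 - s)) * (V y - s\<^sup>2 * V (s *\<^sub>R y)) + (2 * n - 8) * V y = l"
    proof -
      define D where "D = (V y - V (s *\<^sub>R y)) / (1 - s)"
      have "1 - s \<noteq> 0" using s by simp
      then have D: "(4 / (1 - s)) * (V y - s\<^sup>2 * V (s *\<^sub>R y)) = 4 * D + 4 * ((1 + s) * V (s *\<^sub>R y))"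
        unfolding D_def by (simp add: field_simps power2_eq_square)
      show ?thesis
        unfolding l_def D D_def[symmetric] inner_scaleR_left inner_commute[of y "gV y"]
        by (simp add: algebra_simps)
    qed
    have "\<exists>p. has_lap u y p l" using lap unfolding eq .
    moreover have "\<bar>l\<bar> < S + 16 * e"
    proof -
      have "\<bar>(1 - y \<bullet> y) * G y\<bar> \<le> 1 * S"
        unfolding abs_mult using defect_bounds[OF y] S[OF y] by (intro mult_mono) auto
      moreover have "\<bar>4 * ((V y - V (s *\<^sub>R y)) / (1 - s) - gV y \<bullet> y)\<bar> \<le> 4 * e"
        unfolding abs_mult abs_numeral by (rule mult_left_mono[OF sV[OF yc]]) simp
      moreover have "\<bar>4 * ((1 + s) * V (s *\<^sub>R y) - 2 * V y)\<bar> < 12 * e"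
      proof -
        \<comment> \<open>Uniform continuity makes the first part small, the lower bound
          \<open>1 - e / (M + 1)\<close> on \<open>s\<close> the second.\<close>
        have eq: "(1 + s) * V (s *\<^sub>R y) - 2 * V y = (1 + s) * (V (s *\<^sub>R y) - V y) - (1 - s) * V y"
          by (simp add: algebra_simps)
        have "\<bar>(1 + s) * (V (s *\<^sub>R y) - V y)\<bar> \<le> 2 * e"
          unfolding abs_mult using s sV0[OF yc] by (intro mult_mono) auto
        moreover have "\<bar>(1 - s) * V y\<bar> < e"
        proof -
          have "\<bar>(1 - s) * V y\<bar> \<le> (1 - s) * M" unfolding abs_mult using s M(2)[OF yc] by (intro mult_mono) auto
          also have "\<dots> \<le> (1 - s) * (M + 1)" using s by (intro mult_left_mono) auto
          also have "\<dots> < (e / (M + 1)) * (M + 1)" using s M(1) by (intro mult_strict_right_mono) auto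
          finally show ?thesis using M(1) by simp
        qed
        moreover have "\<bar>4 * (a - b)\<bar> < 12 * e" if "\<bar>a\<bar> \<le> 2 * e" "\<bar>b\<bar> < e" for a b :: real
          using that unfolding abs_le_iff abs_less_iff by simp
        ultimately show ?thesis unfolding eq by blast
      qed
      moreover have "\<bar>a + b + c\<bar> < S + 16 * e" if "\<bar>a\<bar> \<le> 1 * S" "\<bar>b\<bar> \<le> 4 * e" "\<bar>c\<bar> < 12 * e" for a b c :: real
        using that unfolding abs_le_iff abs_less_iff by simp
      ultimately show ?thesis unfolding l_def by blast
    qed
    ultimately show "\<exists>p s'. has_lap u y p s' \<and> \<bar>s'\<bar> < S + 16 * e" by blast
  qed
  also have "(S + 16 * e) / (2 * n) * (1 - x \<bullet> x) \<le> S / (2 * n) * (1 - x \<bullet> x) + 8 * e"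
  proof -
    have "(S + 16 * e) / (2 * n) * (1 - x \<bullet> x) = S / (2 * n) * (1 - x \<bullet> x) + 8 * e * ((1 - x \<bullet> x) / n)"
      by (simp add: add_divide_distrib distrib_right)
    moreover have "1 - x \<bullet> x \<le> n" by (rule order_trans[OF defect_bounds(4)[OF x] n])
    then have "(1 - x \<bullet> x) / n \<le> 1" using n by simp
    then have "8 * e * ((1 - x \<bullet> x) / n) \<le> 8 * e" using e by (intro mult_left_le) auto
    ultimately show ?thesis by linarith
  qed
  finally have 1: "\<bar>u x - poisson u x\<bar> \<le> S / (2 * n) * (1 - x \<bullet> x) + 8 * e" .
  have 2: "\<bar>poisson u x - poisson U x\<bar> \<le> 4 * e"
  proof -
    have "\<bar>poisson (\<lambda>z. u z - U z) x\<bar> \<le> 4 * e"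
      by (rule poisson_bound[OF x]) (auto intro!: continuous_intros sph contu contU uU)
    then show ?thesis unfolding poisson_diff[OF x sph[OF contu] sph[OF contU]] .
  qed
  have 3: "\<bar>u x - U x\<bar> \<le> 4 * e" by (rule uU) (use x in simp)
  show "\<bar>U x - poisson U x\<bar> \<le> S / (2 * real CARD('n)) * (1 - x \<bullet> x) + e0"
    using 1 2 3 unfolding n_def[symmetric] e_def by linarith
qed

text \<open>With \<open>q = 1 - x \<bullet> x\<close> this says that
  \<open>q\<^sup>2 * riesz (n / 2 + 1) \<phi>\<close> is annihilated by
  \<open>q\<^sup>2 \<Delta> - 8\<close>, the operator in the equation of the remainder. The terms
  with \<open>riesz (n / 2 + 2)\<close> cancel.\<close>

lemma has_lap_defect_square_riesz:
  fixes \<phi> :: "real ^ 'n::finite \<Rightarrow> real"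
  assumes x: "norm x < 1" and \<phi>: "continuous_on (sphere 0 1) \<phi>"
  shows "\<exists>p. has_lap (\<lambda>x. (1 - x \<bullet> x) * ((1 - x \<bullet> x) * riesz (real CARD('n) / 2 + 1) \<phi> x)) x p
    (8 * riesz (real CARD('n) / 2 + 1) \<phi> x)"
proof -
  define a where "a = real CARD('n) / 2"
  have n: "real CARD('n) = 2 * a" by (simp add: a_def)
  define q where "q = 1 - x \<bullet> x"
  have xx: "x \<bullet> x = 1 - q" by (simp add: q_def)
  define S where "S = riesz (a + 1) \<phi> x"
  define S' where "S' = riesz (a + 1 + 1) \<phi> x"
  note h = has_lap_mult[OF has_lap_defect has_lap_mult[OF has_lap_defect has_lap_riesz[OF x \<phi>, of "a + 1"]]]
  have xg: "x \<bullet> riesz_grad (a + 1) \<phi> x = - (a + 1) * S + (a + 1) * q * S'"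
    unfolding riesz_grad_inner_self[OF x \<phi>] S_def S'_def q_def by simp
  have "- 2 * real CARD('n) * (q * S) +
      2 * (- 2 *\<^sub>R x \<bullet> (S *\<^sub>R (- 2 *\<^sub>R x) + q *\<^sub>R riesz_grad (a + 1) \<phi> x)) +
      q * (- 2 * real CARD('n) * S + 2 * (- 2 *\<^sub>R x \<bullet> riesz_grad (a + 1) \<phi> x) +
        q * ((4 * (a + 1) * (a + 1 + 1) - 2 * real CARD('n) * (a + 1)) * S')) = 8 * S"
    unfolding n inner_scaleR_left inner_add_right inner_scaleR_right xg xx by (simp add: algebra_simps)
  with h show ?thesis unfolding a_def[symmetric] S_def S'_def q_def by (auto simp only:)
qed

text \<open>In the extension divided by \<open>q = 1 - x \<bullet> x\<close> the two terms with
  \<open>riesz (n / 2)\<close> are harmonic, so \<open>q\<^sup>2 \<Delta> - 8\<close> multiplies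
  them by -8, while the term with \<open>riesz (n / 2 + 1)\<close> is annihilated; the outcome is
  the Poisson integral in the statement. The other terms come from applying the same operator to
  \<open>F / q\<close>.\<close>

lemma biharm_ext_remainder_has_lap:
  fixes F :: "real ^ 'n::finite \<Rightarrow> real"
  assumes x: "norm x < 1" and lF: "has_lap F x gF V"
    and \<alpha>: "continuous_on (sphere 0 1) \<alpha>" and \<beta>: "continuous_on (sphere 0 1) \<beta>"
  defines "e \<equiv> \<lambda>x. (F x - biharm_ext \<alpha> \<beta> x) / (1 - x \<bullet> x)"
  shows "\<exists>p s. has_lap e x p s \<and> (1 - x \<bullet> x)\<^sup>2 * s - 8 * e x =
    (1 - x \<bullet> x) * V + 4 * (gF \<bullet> x) + (2 * real CARD('n) - 8) * F x -
    poisson (\<lambda>z. (2 * real CARD('n) - 8) * \<alpha> z - 4 * \<beta> z) x"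
proof -
  define A where "A = measure sphere_measure (sphere (0 :: real ^ 'n) 1)"
  have A: "A > 0" unfolding A_def by (rule measure_sphere_pos)
  define a where "a = real CARD('n) / 2"
  have n: "real CARD('n) = 2 * a" by (simp add: a_def)
  define q where "q = 1 - x \<bullet> x"
  have q: "q > 0" unfolding q_def by (rule defect_bounds(1)[OF x])
  have xx: "x \<bullet> x = 1 - q" by (simp add: q_def)
  define S\<alpha> where "S\<alpha> = riesz a \<alpha> x"
  define S\<beta> where "S\<beta> = riesz a \<beta> x"
  define S' where "S' = riesz (a + 1) \<alpha> x"
  obtain p1 where p1: "has_lap (\<lambda>x. (1 - x \<bullet> x) * riesz a \<alpha> x) x p1 0"
    using has_lap_poisson_kernel[OF x \<alpha>] unfolding a_def by blast
  obtain p2 where p2: "has_lap (\<lambda>x. (1 - x \<bullet> x) * riesz a \<beta> x) x p2 0"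
    using has_lap_poisson_kernel[OF x \<beta>] unfolding a_def by blast
  obtain p3 where p3: "has_lap (\<lambda>x. (1 - x \<bullet> x) * ((1 - x \<bullet> x) * riesz (a + 1) \<alpha> x)) x p3 (8 * S')"
    using has_lap_defect_square_riesz[OF x \<alpha>] unfolding a_def S'_def by blast
  define t where "t x = 1 / (2 * A) * ((2 - a) * ((1 - x \<bullet> x) * riesz a \<alpha> x) +
      a * ((1 - x \<bullet> x) * ((1 - x \<bullet> x) * riesz (a + 1) \<alpha> x)) + (1 - x \<bullet> x) * riesz a \<beta> x)" for x
  have "\<exists>p. has_lap t x p (1 / (2 * A) * ((2 - a) * 0 + a * (8 * S') + 0))"
    using has_lap_cmult[OF has_lap_add[OF has_lap_add[OF has_lap_cmult[OF p1, of "2 - a"] has_lap_cmult[OF p3, of a]] p2], of "1 / (2 * A)"]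
    unfolding t_def[abs_def] by blast
  moreover have "1 / (2 * A) * ((2 - a) * 0 + a * (8 * S') + 0) = 4 * a / A * S'" by simp
  ultimately have t: "\<exists>p. has_lap t x p (4 * a / A * S')" by (simp only:)
  have q0: "1 - x \<bullet> x \<noteq> 0" using q by (simp add: q_def)
  have "\<exists>p. has_lap (\<lambda>x. F x * inverse (1 - x \<bullet> x)) x p
      (V * inverse q + 2 * (gF \<bullet> (- (1 / q\<^sup>2)) *\<^sub>R (- 2 *\<^sub>R x)) +
        F x * (2 * ((- 2 *\<^sub>R x) \<bullet> (- 2 *\<^sub>R x)) / q ^ 3 - (- 2 * real CARD('n)) / q\<^sup>2))"
    using has_lap_mult[OF lF has_lap_inverse[OF has_lap_defect q0]] unfolding q_def by blast
  moreover have "V * inverse q + 2 * (gF \<bullet> (- (1 / q\<^sup>2)) *\<^sub>R (- 2 *\<^sub>R x)) +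
        F x * (2 * ((- 2 *\<^sub>R x) \<bullet> (- 2 *\<^sub>R x)) / q ^ 3 - (- 2 * real CARD('n)) / q\<^sup>2) =
      V / q + 4 * (gF \<bullet> x) / q\<^sup>2 + F x * (8 * (1 - q) / q ^ 3 + 4 * a / q\<^sup>2)"
    by (simp add: n xx divide_inverse mult_ac)
  ultimately obtain p4 where p4: "has_lap (\<lambda>x. F x * inverse (1 - x \<bullet> x)) x p4
      (V / q + 4 * (gF \<bullet> x) / q\<^sup>2 + F x * (8 * (1 - q) / q ^ 3 + 4 * a / q\<^sup>2))"
    by (simp only:) blast
  obtain p5 where p5: "has_lap t x p5 (4 * a / A * S')" using t by blast
  define s where "s = V / q + 4 * (gF \<bullet> x) / q\<^sup>2 + F x * (8 * (1 - q) / q ^ 3 + 4 * a / q\<^sup>2) - 4 * a / A * S'"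
  have ev: "\<forall>\<^sub>F y in nhds x. e y = F y * inverse (1 - y \<bullet> y) - t y"
  proof -
    have "\<forall>\<^sub>F y in nhds x. y \<in> ball 0 1" by (rule eventually_nhds_in_open) (use x in auto)
    then show ?thesis
    proof eventually_elim
      case (elim y)
      define Q where "Q = 1 - y \<bullet> y"
      have "Q > 0" unfolding Q_def by (rule defect_bounds(1)) (use elim in simp)
      then show ?case
        unfolding e_def t_def biharm_ext_def A_def[symmetric] a_def[symmetric] Q_def[symmetric]
        using A by (simp add: field_simps power2_eq_square)
    qed
  qed
  have "has_lap e x (p4 - p5) s"
    unfolding s_def by (rule has_lap_cong[OF ev]) (rule has_lap_diff[OF p4 p5])
  moreover have "q\<^sup>2 * s - 8 * e x = q * V + 4 * (gF \<bullet> x) + (4 * a - 8) * F x - poisson (\<lambda>z. (4 * a - 8) * \<alpha> z - 4 * \<beta> z) x"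
  proof -
    have 1: "q\<^sup>2 * s = q * V + 4 * (gF \<bullet> x) + F x * (8 / q - 8 + 4 * a) - 4 * a / A * (q\<^sup>2 * S')"
      unfolding s_def using q by (simp add: field_simps power2_eq_square power3_eq_cube)
    have ex: "e x = F x / q - t x" using eventually_nhds_x_imp_x[OF ev] by (simp add: q_def divide_inverse)
    have tx: "t x = 1 / (2 * A) * ((2 - a) * (q * S\<alpha>) + a * (q * (q * S')) + q * S\<beta>)"
      unfolding t_def S\<alpha>_def S\<beta>_def S'_def q_def ..
    have 2: "8 * e x = 8 * F x / q - 4 / A * ((2 - a) * (q * S\<alpha>) + a * (q\<^sup>2 * S') + q * S\<beta>)"
      unfolding ex tx using A q by (simp add: field_simps power2_eq_square)
    have r: "riesz a (\<lambda>z. (4 * a - 8) * \<alpha> z - 4 * \<beta> z) x = (4 * a - 8) * S\<alpha> - 4 * S\<beta>"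
      unfolding S\<alpha>_def S\<beta>_def riesz_cmult[symmetric]
      by (rule riesz_diff[OF x]) (intro continuous_intros \<alpha> \<beta>)+
    have 3: "poisson (\<lambda>z. (4 * a - 8) * \<alpha> z - 4 * \<beta> z) x = q / A * ((4 * a - 8) * S\<alpha> - 4 * S\<beta>)"
      unfolding poisson_def A_def[symmetric] a_def[symmetric] q_def[symmetric] r by simp
    show ?thesis unfolding 1 2 3 using q A by (simp add: field_simps power2_eq_square)
  qed
  ultimately show ?thesis unfolding n q_def[symmetric] by auto
qed

text \<open>
  The remainder \<open>e\<close> solves \<open>q\<^sup>2 \<Delta>e - 8 e = W\<close> with bounded \<open>W\<close>, where \<open>q = 1 - x \<bullet> x\<close>.
  The supersolution \<open>1 / q + n\<close> controls it at the boundary, where only \<open>q e \<longlonglongrightarrow> 0\<close> is known.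
\<close>

lemma biharm_ext_remainder_bound_upper:
  fixes e :: "real ^ 'n::finite \<Rightarrow> real"
  assumes cont: "continuous_on (ball 0 1) e"
    and lap: "\<And>x. norm x < 1 \<Longrightarrow> \<exists>p s. has_lap e x p s \<and> \<bar>(1 - x \<bullet> x)\<^sup>2 * s - 8 * e x\<bar> \<le> S"
    and bd: "\<And>\<epsilon>. \<epsilon> > 0 \<Longrightarrow> \<exists>d<1. \<forall>x. d < norm x \<longrightarrow> norm x < 1 \<longrightarrow> (1 - x \<bullet> x) * e x \<le> \<epsilon>"
    and x: "norm x < 1"
  shows "e x \<le> S / 8"
proof (rule field_le_epsilon)
  define n where "n = real CARD('n)"
  have n: "n \<ge> 1" unfolding n_def by (simp add: Suc_leI)
  obtain p s where "has_lap e x p s" "\<bar>(1 - x \<bullet> x)\<^sup>2 * s - 8 * e x\<bar> \<le> S" using lap[OF x] by blast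
  then have S: "S \<ge> 0" by linarith
  fix \<epsilon>0 :: real assume \<epsilon>0: "\<epsilon>0 > 0"
  define B where "B = 1 / (1 - x \<bullet> x) + n"
  have B: "B > 0" using defect_bounds(1)[OF x] n by (simp add: B_def add_pos_pos)
  define \<epsilon> where "\<epsilon> = \<epsilon>0 / B"
  have \<epsilon>: "\<epsilon> > 0" using \<epsilon>0 B by (simp add: \<epsilon>_def)
  \<comment> \<open>\<open>q\<^sup>2 \<Delta> - 8\<close> maps \<open>1 / q + n\<close> to
    \<open>- (6 n + 8)\<close>. For \<open>1 / q\<close> alone the value would be
    \<open>2 n - 8\<close>, which has the wrong sign in high dimensions.\<close>
  define w where "w y = e y - S / 8 - \<epsilon> * (inverse (1 - y \<bullet> y) + n)" for y
  have "w x \<le> 0"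
  proof (rule max_principle_ball[OF _ _ _ x])
    have "\<forall>y\<in>ball (0 :: real ^ 'n) 1. 1 - y \<bullet> y \<noteq> (0::real)"
    proof
      fix y :: "real ^ 'n" assume "y \<in> ball 0 1"
      then show "1 - y \<bullet> y \<noteq> 0" using defect_bounds(1)[of y] by simp
    qed
    then show "continuous_on (ball 0 1) w"
      unfolding w_def by (intro continuous_intros cont)
    fix \<epsilon>' :: real assume "\<epsilon>' > 0"
    obtain d where d: "d < 1" "\<forall>x. d < norm x \<longrightarrow> norm x < 1 \<longrightarrow> (1 - x \<bullet> x) * e x \<le> \<epsilon>"
      using bd[OF \<epsilon>] by blast
    show "\<exists>d<1. \<forall>x. d < norm x \<longrightarrow> norm x < 1 \<longrightarrow> w x \<le> \<epsilon>'"
    proof (intro exI[of _ d] conjI allI impI d(1))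
      fix y :: "real ^ 'n" assume y: "d < norm y" "norm y < 1"
      have q: "1 - y \<bullet> y > 0" by (rule defect_bounds(1)[OF y(2)])
      have "(1 - y \<bullet> y) * e y \<le> \<epsilon>" using d(2) y by blast
      then have "e y \<le> \<epsilon> * inverse (1 - y \<bullet> y)" using q by (simp add: field_simps)
      moreover have "\<epsilon> * n \<ge> 0" using \<epsilon> n by simp
      ultimately show "w y \<le> \<epsilon>'" unfolding w_def distrib_left using S \<open>\<epsilon>' > 0\<close> by linarith
    qed
  next
    fix y assume y: "norm y < 1" "w y > 0"
    define q where "q = 1 - y \<bullet> y"
    have q: "q > 0" unfolding q_def by (rule defect_bounds(1)[OF y(1)])
    have yy: "y \<bullet> y = 1 - q" by (simp add: q_def)
    obtain p s where p: "has_lap e y p s" "\<bar>q\<^sup>2 * s - 8 * e y\<bar> \<le> S" using lap[OF y(1)] unfolding q_def by blast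
    have q0: "1 - y \<bullet> y \<noteq> 0" using q by (simp add: q_def)
    define s' where "s' = s - \<epsilon> * (8 * (1 - q) / q ^ 3 + 2 * n / q\<^sup>2)"
    have "\<exists>p. has_lap w y p (s - 0 - \<epsilon> * (2 * ((- 2 *\<^sub>R y) \<bullet> (- 2 *\<^sub>R y)) / q ^ 3 - (- 2 * n) / q\<^sup>2 + 0))"
      using has_lap_diff[OF has_lap_diff[OF p(1) has_lap_const[of "S / 8"]]
          has_lap_cmult[OF has_lap_add[OF has_lap_inverse[OF has_lap_defect q0] has_lap_const[of n]], of \<epsilon>]]
      unfolding w_def[abs_def] n_def q_def by (rule exI)
    moreover have "s - 0 - \<epsilon> * (2 * ((- 2 *\<^sub>R y) \<bullet> (- 2 *\<^sub>R y)) / q ^ 3 - (- 2 * n) / q\<^sup>2 + 0) = s'"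
      unfolding s'_def by (simp add: yy)
    ultimately have "\<exists>p. has_lap w y p s'" by (simp only:)
    moreover have "s' > 0"
    proof -
      have 1: "q\<^sup>2 * s' = q\<^sup>2 * s - \<epsilon> * (8 / q - 8 + 2 * n)"
        unfolding s'_def using q by (simp add: field_simps power2_eq_square power3_eq_cube)
      have 2: "8 * w y = 8 * e y - S - \<epsilon> * (8 / q) - \<epsilon> * (8 * n)"
        unfolding w_def q_def[symmetric] by (simp add: algebra_simps inverse_eq_divide)
      have eq: "q\<^sup>2 * s' = (q\<^sup>2 * s - 8 * e y + S) + 8 * w y + \<epsilon> * (6 * n + 8)"
        unfolding 1 2 by (simp add: algebra_simps)
      have Bp: "\<epsilon> * (6 * n + 8) > 0" using \<epsilon> n by simp
      have "- S \<le> q\<^sup>2 * s - 8 * e y" using abs_le_D2[OF p(2)] by (rule minus_le_iff[THEN iffD1])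
      then have A: "q\<^sup>2 * s - 8 * e y + S \<ge> 0" by simp
      have "q\<^sup>2 * s' > 0"
        unfolding eq by (rule add_nonneg_pos[OF add_nonneg_nonneg[OF A] Bp]) (use y(2) in simp)
      then show ?thesis using q by (simp only: zero_less_mult_iff) simp
    qed
    ultimately show "\<exists>p s. has_lap w y p s \<and> s > 0" by blast
  qed
  then have "e x \<le> S / 8 + \<epsilon> * B" unfolding w_def B_def inverse_eq_divide by simp
  also have "\<epsilon> * B = \<epsilon>0" using B by (simp add: \<epsilon>_def)
  finally show "e x \<le> S / 8 + \<epsilon>0" .
qed

lemma biharm_ext_remainder_bound:
  fixes e :: "real ^ 'n::finite \<Rightarrow> real"
  assumes cont: "continuous_on (ball 0 1) e"
    and lap: "\<And>x. norm x < 1 \<Longrightarrow> \<exists>p s. has_lap e x p s \<and> \<bar>(1 - x \<bullet> x)\<^sup>2 * s - 8 * e x\<bar> \<le> S"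
    and bd: "\<And>\<epsilon>. \<epsilon> > 0 \<Longrightarrow> \<exists>d<1. \<forall>x. d < norm x \<longrightarrow> norm x < 1 \<longrightarrow> \<bar>(1 - x \<bullet> x) * e x\<bar> \<le> \<epsilon>"
    and x: "norm x < 1"
  shows "\<bar>e x\<bar> \<le> S / 8"
proof -
  have "e x \<le> S / 8"
  proof (rule biharm_ext_remainder_bound_upper[OF cont lap _ x])
    show "\<exists>d<1. \<forall>x. d < norm x \<longrightarrow> norm x < 1 \<longrightarrow> (1 - x \<bullet> x) * e x \<le> \<epsilon>" if "\<epsilon> > 0" for \<epsilon>
      using bd[OF that] abs_le_D1 by meson
  qed
  moreover have "- e x \<le> S / 8"
  proof (rule biharm_ext_remainder_bound_upper[OF _ _ _ x])
    show "continuous_on (ball 0 1) (\<lambda>x. - e x)" by (intro continuous_intros cont)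
    show "\<exists>d<1. \<forall>x. d < norm x \<longrightarrow> norm x < 1 \<longrightarrow> (1 - x \<bullet> x) * - e x \<le> \<epsilon>" if "\<epsilon> > 0" for \<epsilon>
    proof -
      obtain d where d: "d < 1" "\<forall>x. d < norm x \<longrightarrow> norm x < 1 \<longrightarrow> \<bar>(1 - x \<bullet> x) * e x\<bar> \<le> \<epsilon>"
        using bd[OF \<open>\<epsilon> > 0\<close>] by blast
      have "(1 - x \<bullet> x) * - e x \<le> \<epsilon>" if "d < norm x" "norm x < 1" for x
        using d(2)[rule_format, OF that] unfolding mult_minus_right by linarith
      with d(1) show ?thesis by blast
    qed
    fix x :: "real ^ 'n" assume "norm x < 1"
    from lap[OF this] obtain p s where p: "has_lap e x p s" "\<bar>(1 - x \<bullet> x)\<^sup>2 * s - 8 * e x\<bar> \<le> S" by blast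
    from has_lap_cmult[OF p(1), of "-1"] have "has_lap (\<lambda>x. - e x) x (- p) (- s)" by simp
    moreover have "\<bar>(1 - x \<bullet> x)\<^sup>2 * (- s) - 8 * (- e x)\<bar> \<le> S" using p(2) unfolding mult_minus_right by linarith
    ultimately show "\<exists>p s. has_lap (\<lambda>x. - e x) x p s \<and> \<bar>(1 - x \<bullet> x)\<^sup>2 * s - 8 * - e x\<bar> \<le> S" by blast
  qed
  ultimately show ?thesis by linarith
qed

section \<open>From derivative bounds to the a priori Lipschitz estimate\<close>

lemma lipschitz_from_derivative:
  fixes w :: "real ^ 'n::finite \<Rightarrow> real"
  assumes D: "\<And>x. norm x < 1 \<Longrightarrow> \<exists>D. (w has_derivative D) (at x) \<and> (\<forall>h. \<bar>D h\<bar> \<le> C * norm h)"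
    and x: "norm x < 1" and y: "norm y < 1"
  shows "\<bar>w x - w y\<bar> \<le> C * norm (x - y)"
proof -
  obtain D where D: "\<And>z. norm z < 1 \<Longrightarrow> (w has_derivative D z) (at z) \<and> (\<forall>h. \<bar>D z h\<bar> \<le> C * norm h)"
    using D by metis
  have "norm (w x - w y) \<le> C * norm (x - y)"
  proof (rule differentiable_bound[of "ball 0 1" w D])
    fix z :: "real ^ 'n" assume "z \<in> ball 0 1"
    then have z: "norm z < 1" by simp
    show "(w has_derivative D z) (at z within ball 0 1)"
      by (rule has_derivative_at_withinI) (use D[OF z] in blast)
    show "onorm (D z) \<le> C"
      by (rule onorm_le) (use D[OF z] in simp)
  qed (use x y in auto)
  then show ?thesis by simp
qed

lemma lipschitz_from_partials:
  fixes w :: "real ^ 'n::finite \<Rightarrow> real"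
  assumes w: "\<And>x. norm x < 1 \<Longrightarrow> w differentiable (at x)"
    and p: "\<And>x i. norm x < 1 \<Longrightarrow> \<exists>D. ((\<lambda>t. w (x + t *\<^sub>R axis i 1)) has_real_derivative D) (at 0) \<and> \<bar>D\<bar> \<le> L"
    and x: "norm x < 1" and y: "norm y < 1"
  shows "\<bar>w x - w y\<bar> \<le> real CARD('n) * L * norm (x - y)"
proof (rule lipschitz_from_derivative[OF _ x y])
  fix z :: "real ^ 'n" assume z: "norm z < 1"
  obtain D where D: "(w has_derivative D) (at z)" using w[OF z] by (auto simp: differentiable_def)
  have lin: "linear D" using D by (rule has_derivative_linear)
  have Di: "\<bar>D (axis i 1)\<bar> \<le> L" for i
  proof -
    obtain d where d: "((\<lambda>t. w (z + t *\<^sub>R axis i 1)) has_real_derivative d) (at 0)" "\<bar>d\<bar> \<le> L"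
      using p[OF z] by blast
    have "((\<lambda>t. w (z + t *\<^sub>R axis i 1)) has_vector_derivative D (axis i 1)) (at 0)"
      by (rule has_derivative_axis) (use D in simp)
    with d show ?thesis
      using vector_derivative_unique_at unfolding has_real_derivative_iff_has_vector_derivative by metis
  qed
  have "\<bar>D h\<bar> \<le> real CARD('n) * L * norm h" for h
  proof -
    have "D h = (\<Sum>i\<in>UNIV. h $ i * D (axis i 1))" using linear_axis_sum[OF lin, of h] by simp
    also have "\<bar>\<dots>\<bar> \<le> (\<Sum>i\<in>UNIV. \<bar>h $ i * D (axis i 1)\<bar>)" by simp
    also have "\<dots> \<le> (\<Sum>i\<in>(UNIV :: 'n set). norm h * L)"
      unfolding abs_mult by (intro sum_mono mult_mono Di component_le_norm_cart) auto
    finally show ?thesis by (simp add: mult_ac)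
  qed
  with D show "\<exists>D. (w has_derivative D) (at z) \<and> (\<forall>h. \<bar>D h\<bar> \<le> real CARD('n) * L * norm h)" by blast
qed

lemma biharm_ext_differentiable:
  fixes \<alpha> \<beta> :: "real ^ 'n::finite \<Rightarrow> real"
  assumes x: "norm x < 1" and \<alpha>: "continuous_on (sphere 0 1) \<alpha>" and \<beta>: "continuous_on (sphere 0 1) \<beta>"
  shows "biharm_ext \<alpha> \<beta> differentiable (at x)"
proof -
  have r: "riesz c \<phi> differentiable (at x)" if "continuous_on (sphere 0 1) \<phi>" for c \<phi>
    using riesz_has_derivative[OF x that] by (rule differentiableI)
  have q: "(\<lambda>x :: real ^ 'n. 1 - x \<bullet> x) differentiable (at x)"
    by (intro derivative_intros differentiable_inner)
  show ?thesis
    unfolding biharm_ext_def[abs_def] divide_inverse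
    by (intro differentiable_mult differentiable_add differentiable_const differentiable_power r q \<alpha> \<beta>)
qed

text \<open>The boundary data of the extension are read off from \<open>F\<close> itself; the inward
  normal at \<open>z\<close> is \<open>- z\<close>, whence \<open>- (gF z \<bullet> z)\<close>. With
  \<open>w = q e\<close> the gradient is \<open>- 2 e x + q \<nabla>e\<close>, so a bound of order
  \<open>1 / q\<close> on \<open>\<nabla>e\<close> is affordable.\<close>

lemma apriori_lipschitz:
  fixes F V G :: "real ^ 'n::finite \<Rightarrow> real"
  assumes R: "R > 1"
    and dF: "\<And>x. norm x < R \<Longrightarrow> (F has_derivative (\<lambda>h. gF x \<bullet> h)) (at x)"
    and lF: "\<And>x. norm x < R \<Longrightarrow> has_lap F x (gF x) (V x)"
    and cF: "continuous_on (ball 0 R) gF"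
    and dV: "\<And>x. norm x < R \<Longrightarrow> (V has_derivative (\<lambda>h. gV x \<bullet> h)) (at x)"
    and lV: "\<And>x. norm x < R \<Longrightarrow> has_lap V x (gV x) (G x)"
    and cV: "continuous_on (ball 0 R) gV"
    and S: "\<And>x. norm x < 1 \<Longrightarrow> \<bar>G x\<bar> \<le> S"
    and x: "norm x < 1" and y: "norm y < 1"
  defines "w \<equiv> \<lambda>x. F x - biharm_ext F (\<lambda>z. - (gF z \<bullet> z)) x"
    and "n \<equiv> real CARD('n)"
  shows "\<bar>w x - w y\<bar> \<le> n * (S / 4 + 2 * (n\<^sup>2 * S + 8 * S + 1)) * norm (x - y)"
proof -
  have n: "n \<ge> 1" unfolding n_def by (simp add: Suc_leI)
  have S0: "S \<ge> 0" using S[of 0] by simp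
  define \<beta> where "\<beta> z = - (gF z \<bullet> z)" for z
  have contF: "continuous_on (cball 0 1) F"
    by (rule continuous_at_imp_continuous_on, rule ballI, rule has_derivative_continuous[OF dF]) (use R in auto)
  have \<alpha>c: "continuous_on (sphere 0 1) F" by (rule continuous_on_subset[OF contF]) auto
  have "continuous_on (sphere 0 1) gF" by (rule continuous_on_subset[OF cF]) (use R in auto)
  then have \<beta>c: "continuous_on (sphere 0 1) \<beta>" unfolding \<beta>_def by (intro continuous_intros)
  define e where "e x = (F x - biharm_ext F \<beta> x) / (1 - x \<bullet> x)" for x
  have we: "w x = (1 - x \<bullet> x) * e x" if "norm x < 1" for x
    using defect_bounds(1)[OF that] unfolding w_def e_def \<beta>_def[abs_def] by simp
  have wd: "w differentiable (at x)" if "norm x < 1" for x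
  proof -
    have "F differentiable (at x)" by (rule differentiableI[OF dF]) (use that R in simp)
    moreover have "biharm_ext F \<beta> differentiable (at x)" by (rule biharm_ext_differentiable[OF that \<alpha>c \<beta>c])
    ultimately show ?thesis unfolding w_def \<beta>_def[abs_def] by (rule differentiable_diff)
  qed
  have cont_e: "continuous_on (ball 0 1) e"
  proof -
    have "continuous_on (ball 0 1) w"
      by (rule continuous_at_imp_continuous_on, rule ballI, rule differentiable_imp_continuous_within, rule wd) simp
    moreover have "\<forall>y\<in>ball (0 :: real ^ 'n) 1. 1 - y \<bullet> y \<noteq> (0::real)"
    proof
      fix y :: "real ^ 'n" assume "y \<in> ball 0 1"
      then show "1 - y \<bullet> y \<noteq> 0" using defect_bounds(1)[of y] by simp
    qed
    ultimately have "continuous_on (ball 0 1) (\<lambda>x. w x / (1 - x \<bullet> x))" by (intro continuous_intros)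
    then show ?thesis by (simp only: w_def e_def[abs_def] \<beta>_def[abs_def])
  qed
  have lap_e: "\<exists>p s. has_lap e x p s \<and> \<bar>(1 - x \<bullet> x)\<^sup>2 * s - 8 * e x\<bar> \<le> S" if x: "norm x < 1" for x
  proof -
    define U where "U x = (1 - x \<bullet> x) * V x + 4 * (gF x \<bullet> x) + (2 * n - 8) * F x" for x
    have xR: "norm x < R" using x R by simp
    obtain p s where ps: "has_lap e x p s"
      "(1 - x \<bullet> x)\<^sup>2 * s - 8 * e x = U x - poisson (\<lambda>z. (2 * n - 8) * F z - 4 * \<beta> z) x"
      using biharm_ext_remainder_has_lap[OF x lF[OF xR] \<alpha>c \<beta>c] unfolding e_def[abs_def] U_def n_def by blast
    \<comment> \<open>On the sphere the defect vanishes, so \<open>U\<close> reduces to this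
      combination of the boundary data, and a Poisson integral sees only the values there.\<close>
    have "riesz (real CARD('n) / 2) (\<lambda>z. (2 * n - 8) * F z - 4 * \<beta> z) x = riesz (real CARD('n) / 2) U x"
      by (rule riesz_cong) (auto simp: U_def \<beta>_def norm_eq_1)
    then have "poisson (\<lambda>z. (2 * n - 8) * F z - 4 * \<beta> z) x = poisson U x" by (simp add: poisson_def)
    then have "\<bar>(1 - x \<bullet> x)\<^sup>2 * s - 8 * e x\<bar> = \<bar>U x - poisson U x\<bar>" unfolding ps(2) by simp
    also have "\<dots> \<le> S / (2 * n) * (1 - x \<bullet> x)"
      unfolding U_def[abs_def] n_def by (rule first_order_combination_estimate[OF R dF lF cF dV lV cV S x])
    also have "\<dots> \<le> S * 1"
    proof (rule mult_mono)
      show "S / (2 * n) \<le> S" using S0 n by (simp add: divide_le_eq mult_le_cancel_left1)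
    qed (use defect_bounds[OF x] S0 in auto)
    finally show ?thesis using ps(1) by auto
  qed
  have e_bound: "\<bar>e x\<bar> \<le> S / 8" if x: "norm x < 1" for x
  proof (rule biharm_ext_remainder_bound[OF cont_e lap_e _ x])
    fix \<epsilon> :: real assume \<epsilon>: "\<epsilon> > 0"
    obtain d where d: "d < 1" "\<forall>x. d < norm x \<longrightarrow> norm x < 1 \<longrightarrow> \<bar>F x - biharm_ext F \<beta> x\<bar> \<le> \<epsilon>"
      using has_boundary_values_diff[OF continuous_has_boundary_values[OF contF] biharm_ext_boundary[OF \<alpha>c \<beta>c] \<epsilon>]
      by blast
    have "\<bar>(1 - x \<bullet> x) * e x\<bar> \<le> \<epsilon>" if "d < norm x" "norm x < 1" for x
      using d(2)[rule_format, OF that] we[OF that(2)] unfolding w_def \<beta>_def[abs_def] by simp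
    with d(1) show "\<exists>d<1. \<forall>x. d < norm x \<longrightarrow> norm x < 1 \<longrightarrow> \<bar>(1 - x \<bullet> x) * e x\<bar> \<le> \<epsilon>" by blast
  qed
  \<comment> \<open>\<open>S / 4\<close> stems from differentiating the defect, with
    \<open>\<bar>e x\<bar> \<le> S / 8\<close>; the rest is the defect, at most
    \<open>2 * \<rho>\<close>, times a bound of order \<open>1 / \<rho>\<close> on the partial
    derivatives of \<open>e\<close>.\<close>
  define L where "L = S / 4 + 2 * (n\<^sup>2 * S + 8 * S + 1)"
  have partials: "\<exists>D. ((\<lambda>t. w (x + t *\<^sub>R axis i 1)) has_real_derivative D) (at 0) \<and> \<bar>D\<bar> \<le> L"
    if x: "norm x < 1" for x i
  proof -
    define \<rho> where "\<rho> = 1 - norm x"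
    have \<rho>: "\<rho> > 0" using x by (simp add: \<rho>_def)
    \<comment> \<open>By the sum norm a cube of this half-width stays within distance
      \<open>\<rho> / 2\<close> of \<open>x\<close>.\<close>
    define d where "d = \<rho> / (2 * n)"
    have d: "d > 0" using \<rho> n by (simp add: d_def)
    obtain p s where ps: "has_lap e x p s" using lap_e[OF x] by blast
    have box: "norm y < 1 \<and> \<rho> / 2 \<le> 1 - norm y" if y: "\<forall>i. \<bar>y $ i - x $ i\<bar> \<le> d" for y
    proof -
      have "norm (y - x) \<le> (\<Sum>i\<in>UNIV. \<bar>(y - x) $ i\<bar>)" by (rule norm_le_l1_cart)
      also have "\<dots> \<le> (\<Sum>i\<in>(UNIV :: 'n set). d)" by (rule sum_mono) (use y in simp)
      also have "\<dots> = \<rho> / 2" using n by (simp add: d_def n_def)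
      finally have "norm (y - x) \<le> \<rho> / 2" .
      moreover have "norm y \<le> norm x + norm (y - x)" using norm_triangle_ineq[of x "y - x"] by simp
      ultimately show ?thesis using \<rho> unfolding \<rho>_def by simp
    qed
    \<comment> \<open>On the cube the defect is at least \<open>\<rho> / 2\<close>, so the equation
      for \<open>e\<close> bounds its Laplacian by \<open>8 * S / \<rho>\<^sup>2\<close>; the added
      1 produces the strict inequality that the gradient estimate asks for.\<close>
    have "\<bar>p $ i\<bar> \<le> real CARD('n) * (S / 8) / d + ((8 * S + 1) / \<rho>\<^sup>2) * d / 2"
    proof (rule box_gradient_bound[OF d _ _ _ ps])
      show "continuous_on {y. \<forall>i. \<bar>y $ i - x $ i\<bar> \<le> d} e"
        by (rule continuous_on_subset[OF cont_e]) (use box in auto)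
      fix y assume y: "\<forall>i. \<bar>y $ i - x $ i\<bar> \<le> d"
      have y1: "norm y < 1" and y2: "\<rho> / 2 \<le> 1 - norm y" using box[OF y] by auto
      show "\<bar>e y\<bar> \<le> S / 8" by (rule e_bound[OF y1])
      obtain p' s' where p': "has_lap e y p' s'" "\<bar>(1 - y \<bullet> y)\<^sup>2 * s' - 8 * e y\<bar> \<le> S" using lap_e[OF y1] by blast
      have "\<rho> / 2 \<le> 1 - y \<bullet> y" using y2 defect_bounds(2)[OF y1] by (rule order_trans)
      then have q: "(\<rho> / 2)\<^sup>2 \<le> (1 - y \<bullet> y)\<^sup>2" by (rule power_mono) (use \<rho> in simp)
      have "(\<rho> / 2)\<^sup>2 * \<bar>s'\<bar> \<le> (1 - y \<bullet> y)\<^sup>2 * \<bar>s'\<bar>" using q by (rule mult_right_mono) simp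
      also have "\<dots> = \<bar>(1 - y \<bullet> y)\<^sup>2 * s'\<bar>" by (simp add: abs_mult)
      also have "\<dots> \<le> 2 * S"
      proof -
        have "\<bar>a\<bar> \<le> 2 * S" if "\<bar>a - 8 * b\<bar> \<le> S" "\<bar>b\<bar> \<le> S / 8" for a b :: real
          using that unfolding abs_le_iff by simp
        from this[OF p'(2) e_bound[OF y1]] show ?thesis .
      qed
      finally have "\<rho>\<^sup>2 * \<bar>s'\<bar> \<le> 8 * S" by (simp add: power_divide)
      then have "\<rho>\<^sup>2 * \<bar>s'\<bar> < 8 * S + 1" by simp
      then have "\<bar>s'\<bar> < (8 * S + 1) / \<rho>\<^sup>2" using \<rho> by (simp add: pos_less_divide_eq mult.commute)
      with p'(1) show "\<exists>p s. has_lap e y p s \<and> \<bar>s\<bar> < (8 * S + 1) / \<rho>\<^sup>2" by blast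
    qed
    also have "\<dots> \<le> (n\<^sup>2 * S + 8 * S + 1) / \<rho>"
    proof -
      have e1: "real CARD('n) * (S / 8) / d = (n\<^sup>2 * S / 4) / \<rho>"
        using n \<rho> unfolding d_def n_def[symmetric] by (simp add: field_simps power2_eq_square)
      have e2: "((8 * S + 1) / \<rho>\<^sup>2) * d / 2 = ((8 * S + 1) / (4 * n)) / \<rho>"
        using n \<rho> unfolding d_def by (simp add: field_simps power2_eq_square)
      have e3: "(n\<^sup>2 * S + 8 * S + 1) / \<rho> = (n\<^sup>2 * S) / \<rho> + (8 * S + 1) / \<rho>"
        by (simp only: add_divide_distrib add.assoc)
      show ?thesis
        unfolding e1 e2 e3
      proof (intro add_mono divide_right_mono)
        have "(8 * S + 1) * 1 \<le> (8 * S + 1) * (4 * n)" using S0 n by (intro mult_left_mono) auto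
        then show "(8 * S + 1) / (4 * n) \<le> 8 * S + 1" using n by (simp add: divide_le_eq)
      qed (use \<rho> S0 in auto)
    qed
    finally have p: "\<bar>p $ i\<bar> \<le> (n\<^sup>2 * S + 8 * S + 1) / \<rho>" .
    have ev: "\<forall>\<^sub>F y in nhds x. w y = (1 - y \<bullet> y) * e y"
    proof -
      have "\<forall>\<^sub>F y in nhds x. y \<in> ball 0 1" by (rule eventually_nhds_in_open) (use x in auto)
      then show ?thesis by eventually_elim (rule we, simp)
    qed
    define D where "D = (e x *\<^sub>R (- 2 *\<^sub>R x) + (1 - x \<bullet> x) *\<^sub>R p) $ i"
    have "\<exists>s. has_lap w x (e x *\<^sub>R (- 2 *\<^sub>R x) + (1 - x \<bullet> x) *\<^sub>R p) s"
      using has_lap_cong[OF ev has_lap_mult[OF has_lap_defect ps]] by (rule exI)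
    then obtain q where "has_d2 (\<lambda>t. w (x + t *\<^sub>R axis i 1)) D q"
      unfolding has_lap_def D_def by blast
    then have "((\<lambda>t. w (x + t *\<^sub>R axis i 1)) has_real_derivative D) (at 0)" by (rule has_d2_DERIV)
    moreover have "\<bar>D\<bar> \<le> L"
    proof -
      have "D = - 2 * (e x * x $ i) + (1 - x \<bullet> x) * p $ i" by (simp add: D_def)
      also have "\<bar>\<dots>\<bar> \<le> \<bar>- 2 * (e x * x $ i)\<bar> + \<bar>(1 - x \<bullet> x) * p $ i\<bar>" by (rule abs_triangle_ineq)
      also have "\<dots> = 2 * (\<bar>e x\<bar> * \<bar>x $ i\<bar>) + (1 - x \<bullet> x) * \<bar>p $ i\<bar>"
        using defect_bounds(1)[OF x] by (simp add: abs_mult)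
      also have "\<dots> \<le> 2 * (S / 8 * 1) + (2 * \<rho>) * ((n\<^sup>2 * S + 8 * S + 1) / \<rho>)"
      proof (intro add_mono mult_left_mono mult_mono)
        show "\<bar>x $ i\<bar> \<le> 1" using component_le_norm_cart[of x i] x by simp
        show "\<bar>e x\<bar> \<le> S / 8" by (rule e_bound[OF x])
        show "1 - x \<bullet> x \<le> 2 * \<rho>" using defect_bounds(3)[OF x] by (simp add: \<rho>_def)
      qed (use p S0 \<rho> in auto)
      also have "\<dots> = S / 4 + 2 * (n\<^sup>2 * S + 8 * S + 1)" using \<rho> by simp
      finally show ?thesis unfolding L_def .
    qed
    ultimately show ?thesis by blast
  qed
  show ?thesis
    using lipschitz_from_partials[OF wd partials x y] unfolding L_def n_def .
qed

section \<open>Lipschitz boundary values\<close>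

text \<open>\<open>j\<close> factors of the defect are spent on reducing the kernel to the Poisson
  kernel, and one more on the total mass of the latter.\<close>

lemma riesz_weighted_bound:
  fixes \<phi> :: "real ^ 'n::finite \<Rightarrow> real"
  assumes x: "norm x < 1" and \<phi>: "continuous_on (sphere 0 1) \<phi>"
    and bd: "\<And>z. z \<in> sphere 0 1 \<Longrightarrow> (1 - x \<bullet> x) ^ j * (((x - z) \<bullet> (x - z)) powr - c * \<bar>\<phi> z\<bar>) \<le>
      C * ((x - z) \<bullet> (x - z)) powr - (real CARD('n) / 2)"
  shows "(1 - x \<bullet> x) ^ Suc j * \<bar>riesz c \<phi> x\<bar> \<le> C * measure sphere_measure (sphere (0 :: real ^ 'n) 1)"
proof -
  have q: "0 < 1 - x \<bullet> x" by (rule defect_bounds(1)[OF x])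
  have c: "continuous_on (sphere 0 1) (\<lambda>z. ((x - z) \<bullet> (x - z)) powr - c * \<phi> z)"
    by (intro continuous_intros \<phi>) (use sqdist_pos[OF x] in fastforce)
  have "(1 - x \<bullet> x) * \<bar>LINT z|sphere_measure. (1 - x \<bullet> x) ^ j * (((x - z) \<bullet> (x - z)) powr - c * \<phi> z)\<bar> \<le>
      C * measure sphere_measure (sphere (0 :: real ^ 'n) 1)"
  proof (rule poisson_kernel_bound[OF x])
    show "continuous_on (sphere 0 1) (\<lambda>z. (1 - x \<bullet> x) ^ j * (((x - z) \<bullet> (x - z)) powr - c * \<phi> z))"
      by (intro continuous_on_mult continuous_on_const c)
    fix z :: "real ^ 'n" assume z: "z \<in> sphere 0 1"
    have "\<bar>(1 - x \<bullet> x) ^ j * (((x - z) \<bullet> (x - z)) powr - c * \<phi> z)\<bar> =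
        (1 - x \<bullet> x) ^ j * (((x - z) \<bullet> (x - z)) powr - c * \<bar>\<phi> z\<bar>)"
      using q by (simp add: abs_mult)
    with bd[OF z] show "\<bar>(1 - x \<bullet> x) ^ j * (((x - z) \<bullet> (x - z)) powr - c * \<phi> z)\<bar> \<le>
        C * ((x - z) \<bullet> (x - z)) powr - (real CARD('n) / 2)" by simp
  qed
  then show ?thesis
    using q unfolding integral_mult_right_zero riesz_def[symmetric] by (simp add: abs_mult mult.assoc)
qed

text \<open>The gradient is tested against a direction \<open>h\<close>, which keeps the integrand
  scalar, so that the bound for dominated kernels applies.\<close>

lemma riesz_grad_weighted_bound:
  fixes \<phi> :: "real ^ 'n::finite \<Rightarrow> real"
  assumes x: "norm x < 1" and \<phi>: "continuous_on (sphere 0 1) \<phi>" and c: "c \<ge> 0"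
    and bd: "\<And>z. z \<in> sphere 0 1 \<Longrightarrow>
      (1 - x \<bullet> x) ^ j * (2 * c * ((x - z) \<bullet> (x - z)) powr - (c + 1) * norm (x - z) * \<bar>\<phi> z\<bar>) \<le>
      C * ((x - z) \<bullet> (x - z)) powr - (real CARD('n) / 2)"
  shows "(1 - x \<bullet> x) ^ Suc j * \<bar>riesz_grad c \<phi> x \<bullet> h\<bar> \<le>
    C * measure sphere_measure (sphere (0 :: real ^ 'n) 1) * norm h"
proof -
  have q: "0 < 1 - x \<bullet> x" by (rule defect_bounds(1)[OF x])
  let ?k = "\<lambda>z. \<phi> z *\<^sub>R ((-2 * c * ((x - z) \<bullet> (x - z)) powr - (c + 1)) *\<^sub>R (x - z)) \<bullet> h"
  have k: "continuous_on (sphere 0 1) ?k"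
    by (intro continuous_intros \<phi>) (use sqdist_pos[OF x] in fastforce)
  have bound: "(1 - x \<bullet> x) * \<bar>LINT z|sphere_measure. (1 - x \<bullet> x) ^ j * ?k z\<bar> \<le>
      (C * norm h) * measure sphere_measure (sphere (0 :: real ^ 'n) 1)"
  proof (rule poisson_kernel_bound[OF x])
    show "continuous_on (sphere 0 1) (\<lambda>z. (1 - x \<bullet> x) ^ j * ?k z)"
      by (intro continuous_on_mult continuous_on_const k)
    fix z :: "real ^ 'n" assume z: "z \<in> sphere 0 1"
    have "\<bar>?k z\<bar> = 2 * c * ((x - z) \<bullet> (x - z)) powr - (c + 1) * \<bar>\<phi> z\<bar> * \<bar>(x - z) \<bullet> h\<bar>"
      using c by (simp add: abs_mult)
    also have "\<dots> \<le> 2 * c * ((x - z) \<bullet> (x - z)) powr - (c + 1) * \<bar>\<phi> z\<bar> * (norm (x - z) * norm h)"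
      using c by (intro mult_left_mono Cauchy_Schwarz_ineq2) auto
    finally have "(1 - x \<bullet> x) ^ j * \<bar>?k z\<bar> \<le>
        (1 - x \<bullet> x) ^ j * (2 * c * ((x - z) \<bullet> (x - z)) powr - (c + 1) * \<bar>\<phi> z\<bar> * (norm (x - z) * norm h))"
      using q by (intro mult_left_mono) auto
    also have "\<dots> = ((1 - x \<bullet> x) ^ j * (2 * c * ((x - z) \<bullet> (x - z)) powr - (c + 1) * norm (x - z) * \<bar>\<phi> z\<bar>)) * norm h"
      by (simp only: mult_ac)
    also have "\<dots> \<le> (C * ((x - z) \<bullet> (x - z)) powr - (real CARD('n) / 2)) * norm h"
      by (rule mult_right_mono[OF bd[OF z]]) simp
    finally show "\<bar>(1 - x \<bullet> x) ^ j * ?k z\<bar> \<le> C * norm h * ((x - z) \<bullet> (x - z)) powr - (real CARD('n) / 2)"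
      using q by (simp only: abs_mult abs_of_nonneg zero_le_power less_imp_le mult_ac)
  qed
  have eq: "(LINT z|sphere_measure. ?k z) = riesz_grad c \<phi> x \<bullet> h"
    unfolding riesz_grad_def by (rule integral_inner_left) (rule riesz_grad_integrable[OF x \<phi>])
  show ?thesis
    using bound q unfolding integral_mult_right_zero eq by (simp add: abs_mult mult_ac)
qed

lemma kernel_powr_shift:
  fixes x z :: "real ^ 'n::finite"
  assumes "x \<noteq> z"
  shows "((x - z) \<bullet> (x - z)) powr - (c + 1) * (norm (x - z))\<^sup>2 = ((x - z) \<bullet> (x - z)) powr - c"
  using assms powr_mult_base[of "(x - z) \<bullet> (x - z)" "- (c + 1)"]
  by (simp add: power2_norm_eq_inner mult.commute)

text \<open>
  Subtracting the constant \<^term>\<open>\<alpha> w\<close> gains a factor \<^term>\<open>norm (x - z)\<close> in the boundary datum, which pays for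
  the derivative of the kernel: every resulting kernel is dominated by the Poisson kernel.
\<close>

lemma biharm_ext_lipschitz:
  fixes \<alpha> \<beta> :: "real ^ 'n::finite \<Rightarrow> real"
  assumes \<alpha>L: "\<And>z w. z \<in> sphere 0 1 \<Longrightarrow> w \<in> sphere 0 1 \<Longrightarrow> \<bar>\<alpha> z - \<alpha> w\<bar> \<le> L * norm (z - w)"
    and L: "L \<ge> 0" and \<beta>: "continuous_on (sphere 0 1) \<beta>"
  shows "\<exists>C. \<forall>x y. norm x < 1 \<longrightarrow> norm y < 1 \<longrightarrow> \<bar>biharm_ext \<alpha> \<beta> x - biharm_ext \<alpha> \<beta> y\<bar> \<le> C * norm (x - y)"
proof -
  define A where "A = measure sphere_measure (sphere (0 :: real ^ 'n) 1)"
  have A: "A > 0" unfolding A_def by (rule measure_sphere_pos)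
  define a where "a = real CARD('n) / 2"
  have a: "a \<ge> 0" by (simp add: a_def)
  have \<alpha>: "continuous_on (sphere 0 1) \<alpha>"
  proof -
    have "L-lipschitz_on (sphere 0 1) \<alpha>"
      by (rule lipschitz_onI) (use \<alpha>L L in \<open>auto simp: dist_norm\<close>)
    then show ?thesis by (rule lipschitz_on_continuous_on)
  qed
  obtain M where M0: "M \<ge> 0" and M: "\<And>z. z \<in> sphere 0 1 \<Longrightarrow> \<bar>\<beta> z\<bar> \<le> M"
    using continuous_sphere_bounded[OF \<beta>] by (metis real_norm_def)
  \<comment> \<open>The first group comes from differentiating the outer factor
    \<open>q\<^sup>2\<close>, where 2 and \<open>\<bar>q' h\<bar> \<le> 2 * norm h\<close> combine
    to 4; the second comes from differentiating the bracket. The products are assembled from the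
    bounds \<open>b1\<close> to \<open>b6\<close>.\<close>
  define C where "C = 1 / (2 * A) * (4 * (\<bar>2 - a\<bar> * (4 * L * A) + a * (4 * L * A) + M * A) +
     (\<bar>2 - a\<bar> * (4 * a * L * A) + 2 * a * (4 * L * A) + a * (16 * (a + 1) * L * A) + 4 * a * M * A))"
  have "\<bar>biharm_ext \<alpha> \<beta> x - biharm_ext \<alpha> \<beta> y\<bar> \<le> C * norm (x - y)" if "norm x < 1" "norm y < 1" for x y
  proof (rule lipschitz_from_derivative[OF _ that])
    fix x :: "real ^ 'n" assume x: "norm x < 1"
    obtain w where w: "norm w = 1" "x = norm x *\<^sub>R w" by (rule unit_direction[of x])
    define q where "q y = 1 - y \<bullet> y" for y :: "real ^ 'n"
    have q: "q x > 0" "q x \<le> 1" using defect_bounds[OF x] by (auto simp: q_def)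
    define \<alpha>w where "\<alpha>w z = \<alpha> z - \<alpha> w" for z
    have \<alpha>wc: "continuous_on (sphere 0 1) \<alpha>w" unfolding \<alpha>w_def by (intro continuous_intros \<alpha>)
    have \<alpha>wb: "\<bar>\<alpha>w z\<bar> \<le> 2 * L * norm (x - z)" if "z \<in> sphere 0 1" for z
    proof -
      have "\<bar>\<alpha>w z\<bar> \<le> L * norm (z - w)" unfolding \<alpha>w_def using that w by (intro \<alpha>L) auto
      also have "\<dots> \<le> L * (2 * norm (x - z))"
        using dist_direction(3)[OF w _ x] that L by (intro mult_left_mono) auto
      finally show ?thesis by simp
    qed
    \<comment> \<open>By the third bound every spare factor \<open>q x\<close> is worth a factor
      \<open>norm (x - z)\<close>, and two of those lower the exponent \<open>c\<close> of the
      kernel by one.\<close>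
    have r: "0 < norm (x - z)" "norm (x - z) \<le> 2" "q x \<le> 2 * norm (x - z)" if "z \<in> sphere 0 1" for z
    proof -
      have z: "norm z = 1" using that by simp
      show "0 < norm (x - z)" using x z by auto
      show "norm (x - z) \<le> 2" using norm_triangle_ineq4[of x z] x z by simp
      have "q x \<le> 2 * (1 - norm x)" unfolding q_def by (rule defect_bounds(3)[OF x])
      also have "\<dots> \<le> 2 * norm (x - z)" by (rule mult_left_mono[OF dist_direction(2)[OF w z x]]) simp
      finally show "q x \<le> 2 * norm (x - z)" .
    qed
    let ?P = "\<lambda>z c. ((x - z) \<bullet> (x - z)) powr - c"
    have P1: "?P z (a + 1) * (norm (x - z))\<^sup>2 = ?P z a" and P2: "?P z (a + 1 + 1) * (norm (x - z))\<^sup>2 = ?P z (a + 1)"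
      if "z \<in> sphere 0 1" for z
      using kernel_powr_shift[of x z a] kernel_powr_shift[of x z "a + 1"] r(1)[OF that] by auto
    have b1: "q x * \<bar>riesz a \<alpha>w x\<bar> \<le> 4 * L * A"
    proof -
      have "(1 - x \<bullet> x) ^ Suc 0 * \<bar>riesz a \<alpha>w x\<bar> \<le> (4 * L) * measure sphere_measure (sphere (0 :: real ^ 'n) 1)"
      proof (rule riesz_weighted_bound[OF x \<alpha>wc])
        fix z :: "real ^ 'n" assume z: "z \<in> sphere 0 1"
        have "\<bar>\<alpha>w z\<bar> \<le> 2 * L * norm (x - z)" by (rule \<alpha>wb[OF z])
        also have "\<dots> \<le> 2 * L * 2" using r(2)[OF z] L by (intro mult_left_mono) auto
        finally have "?P z a * \<bar>\<alpha>w z\<bar> \<le> ?P z a * (4 * L)" by (intro mult_left_mono) auto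
        then show "(1 - x \<bullet> x) ^ 0 * (?P z a * \<bar>\<alpha>w z\<bar>) \<le> 4 * L * ?P z (real CARD('n) / 2)"
          by (simp add: a_def mult_ac)
      qed
      then show ?thesis by (simp add: q_def A_def)
    qed
    have b2: "(q x)\<^sup>2 * \<bar>riesz (a + 1) \<alpha>w x\<bar> \<le> 4 * L * A"
    proof -
      have "(1 - x \<bullet> x) ^ Suc 1 * \<bar>riesz (a + 1) \<alpha>w x\<bar> \<le> (4 * L) * measure sphere_measure (sphere (0 :: real ^ 'n) 1)"
      proof (rule riesz_weighted_bound[OF x \<alpha>wc])
        fix z :: "real ^ 'n" assume z: "z \<in> sphere 0 1"
        have "q x * (?P z (a + 1) * \<bar>\<alpha>w z\<bar>) \<le> (2 * norm (x - z)) * (?P z (a + 1) * (2 * L * norm (x - z)))"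
          using q r[OF z] L by (intro mult_mono \<alpha>wb[OF z] mult_left_mono) auto
        also have "\<dots> = 4 * L * (?P z (a + 1) * (norm (x - z))\<^sup>2)" by (simp add: power2_eq_square mult_ac)
        finally show "(1 - x \<bullet> x) ^ 1 * (?P z (a + 1) * \<bar>\<alpha>w z\<bar>) \<le> 4 * L * ?P z (real CARD('n) / 2)"
          unfolding P1[OF z] by (simp add: a_def q_def)
      qed
      then show ?thesis by (simp add: q_def A_def numeral_2_eq_2)
    qed
    have b3: "q x * \<bar>riesz_grad a \<alpha>w x \<bullet> h\<bar> \<le> 4 * a * L * A * norm h" for h
    proof -
      have "(1 - x \<bullet> x) ^ Suc 0 * \<bar>riesz_grad a \<alpha>w x \<bullet> h\<bar> \<le> (4 * a * L) * measure sphere_measure (sphere (0 :: real ^ 'n) 1) * norm h"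
      proof (rule riesz_grad_weighted_bound[OF x \<alpha>wc a])
        fix z :: "real ^ 'n" assume z: "z \<in> sphere 0 1"
        have "2 * a * ?P z (a + 1) * norm (x - z) * \<bar>\<alpha>w z\<bar> \<le> 2 * a * ?P z (a + 1) * norm (x - z) * (2 * L * norm (x - z))"
          using a by (intro mult_left_mono \<alpha>wb[OF z]) auto
        also have "\<dots> = 4 * a * L * (?P z (a + 1) * (norm (x - z))\<^sup>2)" by (simp add: power2_eq_square mult_ac)
        finally show "(1 - x \<bullet> x) ^ 0 * (2 * a * ?P z (a + 1) * norm (x - z) * \<bar>\<alpha>w z\<bar>) \<le> 4 * a * L * ?P z (real CARD('n) / 2)"
          unfolding P1[OF z] by (simp add: a_def)
      qed
      then show ?thesis by (simp add: q_def A_def)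
    qed
    \<comment> \<open>The most singular kernel: two factors \<open>q x\<close>, the displacement in
      the gradient and the Lipschitz datum together give the four powers of
      \<open>norm (x - z)\<close> that reduce the exponent from \<open>a + 2\<close> to
      \<open>a\<close>; the third \<open>q x\<close> pays for the total mass. The constant is
      \<open>2 * (a + 1) * 4 * 2 * L\<close>.\<close>
    have b4: "(q x) ^ 3 * \<bar>riesz_grad (a + 1) \<alpha>w x \<bullet> h\<bar> \<le> 16 * (a + 1) * L * A * norm h" for h
    proof -
      have "(1 - x \<bullet> x) ^ Suc 2 * \<bar>riesz_grad (a + 1) \<alpha>w x \<bullet> h\<bar> \<le> (16 * (a + 1) * L) * measure sphere_measure (sphere (0 :: real ^ 'n) 1) * norm h"
      proof (rule riesz_grad_weighted_bound[OF x \<alpha>wc])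
        fix z :: "real ^ 'n" assume z: "z \<in> sphere 0 1"
        have "(q x)\<^sup>2 \<le> (2 * norm (x - z))\<^sup>2" using q r[OF z] by (intro power_mono) auto
        then have "(q x)\<^sup>2 * (2 * (a + 1) * ?P z (a + 1 + 1) * norm (x - z) * \<bar>\<alpha>w z\<bar>) \<le>
            (2 * norm (x - z))\<^sup>2 * (2 * (a + 1) * ?P z (a + 1 + 1) * norm (x - z) * (2 * L * norm (x - z)))"
          using a by (intro mult_mono mult_left_mono \<alpha>wb[OF z]) auto
        also have "\<dots> = 16 * (a + 1) * L * ((?P z (a + 1 + 1) * (norm (x - z))\<^sup>2) * (norm (x - z))\<^sup>2)"
          by (simp add: power2_eq_square mult_ac)
        finally show "(1 - x \<bullet> x) ^ 2 * (2 * (a + 1) * ?P z (a + 1 + 1) * norm (x - z) * \<bar>\<alpha>w z\<bar>) \<le> 16 * (a + 1) * L * ?P z (real CARD('n) / 2)"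
          unfolding P2[OF z] P1[OF z] by (simp add: a_def q_def)
      qed (use a in simp)
      then show ?thesis by (simp add: q_def A_def numeral_3_eq_3 numeral_2_eq_2)
    qed
    have b5: "q x * \<bar>riesz a \<beta> x\<bar> \<le> M * A"
    proof -
      have "(1 - x \<bullet> x) ^ Suc 0 * \<bar>riesz a \<beta> x\<bar> \<le> M * measure sphere_measure (sphere (0 :: real ^ 'n) 1)"
      proof (rule riesz_weighted_bound[OF x \<beta>])
        fix z :: "real ^ 'n" assume z: "z \<in> sphere 0 1"
        have "?P z a * \<bar>\<beta> z\<bar> \<le> ?P z a * M" using M[OF z] by (intro mult_left_mono) auto
        then show "(1 - x \<bullet> x) ^ 0 * (?P z a * \<bar>\<beta> z\<bar>) \<le> M * ?P z (real CARD('n) / 2)"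
          by (simp add: a_def mult_ac)
      qed
      then show ?thesis by (simp add: q_def A_def)
    qed
    have b6: "(q x)\<^sup>2 * \<bar>riesz_grad a \<beta> x \<bullet> h\<bar> \<le> 4 * a * M * A * norm h" for h
    proof -
      have "(1 - x \<bullet> x) ^ Suc 1 * \<bar>riesz_grad a \<beta> x \<bullet> h\<bar> \<le> (4 * a * M) * measure sphere_measure (sphere (0 :: real ^ 'n) 1) * norm h"
      proof (rule riesz_grad_weighted_bound[OF x \<beta> a])
        fix z :: "real ^ 'n" assume z: "z \<in> sphere 0 1"
        have "q x * (2 * a * ?P z (a + 1) * norm (x - z) * \<bar>\<beta> z\<bar>) \<le> (2 * norm (x - z)) * (2 * a * ?P z (a + 1) * norm (x - z) * M)"
          using q a r[OF z] by (intro mult_mono mult_left_mono M[OF z]) auto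
        also have "\<dots> = 4 * a * M * (?P z (a + 1) * (norm (x - z))\<^sup>2)" by (simp add: power2_eq_square mult_ac)
        finally show "(1 - x \<bullet> x) ^ 1 * (2 * a * ?P z (a + 1) * norm (x - z) * \<bar>\<beta> z\<bar>) \<le> 4 * a * M * ?P z (real CARD('n) / 2)"
          unfolding P1[OF z] by (simp add: a_def q_def)
      qed
      then show ?thesis by (simp add: q_def A_def numeral_2_eq_2)
    qed
    define q' where "q' h = - 2 * (x \<bullet> h)" for h
    have q'b: "\<bar>q' h\<bar> \<le> 2 * norm h" for h
    proof -
      have "\<bar>x \<bullet> h\<bar> \<le> norm x * norm h" by (rule Cauchy_Schwarz_ineq2)
      also have "\<dots> \<le> 1 * norm h" using x by (intro mult_right_mono) auto
      finally show ?thesis by (simp add: q'_def abs_mult)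
    qed
    define D where "D h = (1 / (2 * A)) *
       (2 * q x * q' h * ((2 - a) * riesz a \<alpha>w x + a * q x * riesz (a + 1) \<alpha>w x + riesz a \<beta> x) +
        (q x)\<^sup>2 * ((2 - a) * (riesz_grad a \<alpha>w x \<bullet> h) + a * (q' h * riesz (a + 1) \<alpha>w x) +
          a * (q x * (riesz_grad (a + 1) \<alpha>w x \<bullet> h)) + riesz_grad a \<beta> x \<bullet> h))" for h
    have dq: "(q has_derivative q') (at x)"
      unfolding q_def[abs_def] q'_def[abs_def] by (auto intro!: derivative_eq_intros simp: inner_commute)
    note dr = riesz_has_derivative[OF x \<alpha>wc, of a] riesz_has_derivative[OF x \<alpha>wc, of "a + 1"] riesz_has_derivative[OF x \<beta>, of a]
    \<comment> \<open>The left-hand side is literally what the derivative rules produce, zero terms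
      included; as an identity of real variables it is checked without touching the
      potentials.\<close>
    have key: "k * (Q * Q * (m * u1 + 0 * r1 + (b * (Q * u2 + p * r2) + 0 * (Q * r2)) + u3) +
          (Q * p + p * Q) * (m * r1 + b * (Q * r2) + r3)) + 0 * (Q * Q * (m * r1 + b * (Q * r2) + r3)) + 0 =
        k * (2 * Q * p * (m * r1 + b * Q * r2 + r3) + Q\<^sup>2 * (m * u1 + b * (p * r2) + b * (Q * u2) + u3))"
      for k Q m b p u1 u2 u3 r1 r2 r3 :: real
    proof -
      have 1: "m * u1 + 0 * r1 + (b * (Q * u2 + p * r2) + 0 * (Q * r2)) + u3 =
          m * u1 + b * (p * r2) + b * (Q * u2) + u3" by (simp add: distrib_left)
      have 2: "Q * p + p * Q = 2 * Q * p" by simp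
      show ?thesis
        unfolding 1 2 power2_eq_square mult.assoc[of b Q r2] mult_zero_left add_0_right
        by (simp only: distrib_left[of b] add.commute add.left_commute)
    qed
    have "((\<lambda>y. (1 / (2 * A)) * ((q y * q y) * ((2 - a) * riesz a \<alpha>w y + a * (q y * riesz (a + 1) \<alpha>w y) + riesz a \<beta> y)) + \<alpha> w)
        has_derivative D) (at x)"
      by (rule has_derivative_eq_rhs[OF has_derivative_add[OF has_derivative_mult[OF has_derivative_const
            has_derivative_mult[OF has_derivative_mult[OF dq dq]
              has_derivative_add[OF has_derivative_add[OF has_derivative_mult[OF has_derivative_const dr(1)]
                has_derivative_mult[OF has_derivative_const has_derivative_mult[OF dq dr(2)]]] dr(3)]]]
            has_derivative_const]])
         (rule ext, unfold D_def, rule key)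
    then have "(biharm_ext \<alpha> \<beta> has_derivative D) (at x)"
    proof (rule has_derivative_transform_within_open[of _ _ _ _ "ball 0 1"])
      fix y :: "real ^ 'n" assume "y \<in> ball 0 1"
      then have y: "norm y < 1" by simp
      have "biharm_ext \<alpha>w \<beta> y = biharm_ext \<alpha> \<beta> y - \<alpha> w"
        unfolding \<alpha>w_def[abs_def] by (rule biharm_ext_minus_const[OF y \<alpha>])
      then show "(1 / (2 * A)) * ((q y * q y) * ((2 - a) * riesz a \<alpha>w y + a * (q y * riesz (a + 1) \<alpha>w y) + riesz a \<beta> y)) + \<alpha> w = biharm_ext \<alpha> \<beta> y"
        unfolding biharm_ext_def[of \<alpha>w] A_def[symmetric] a_def[symmetric] q_def[symmetric]
        by (simp add: power2_eq_square mult.assoc)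
    qed (use x in auto)
    moreover have "\<bar>D h\<bar> \<le> C * norm h" for h
    proof -
      \<comment> \<open>Every power of \<open>q x\<close> is moved next to the integral whose bound
        consumes it; one factor in the first gradient term is left over and estimated by 1.\<close>
      have eqD: "D h = (1 / (2 * A)) *
         ((2 * q' h) * ((2 - a) * (q x * riesz a \<alpha>w x) + a * ((q x)\<^sup>2 * riesz (a + 1) \<alpha>w x) + q x * riesz a \<beta> x) +
          ((2 - a) * (q x * (q x * (riesz_grad a \<alpha>w x \<bullet> h))) + (a * q' h) * ((q x)\<^sup>2 * riesz (a + 1) \<alpha>w x) +
            a * ((q x) ^ 3 * (riesz_grad (a + 1) \<alpha>w x \<bullet> h)) + (q x)\<^sup>2 * (riesz_grad a \<beta> x \<bullet> h)))"
      proof -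
        have 1: "2 * Q * p * (m * r1 + b * Q * r2 + r3) = (2 * p) * (m * (Q * r1) + b * (Q\<^sup>2 * r2) + Q * r3)"
          for Q p m b r1 r2 r3 :: real by (simp add: algebra_simps power2_eq_square)
        have 2: "Q\<^sup>2 * (m * g1 + b * (p * r2) + b * (Q * g2) + g3) =
            m * (Q * (Q * g1)) + (b * p) * (Q\<^sup>2 * r2) + b * (Q ^ 3 * g2) + Q\<^sup>2 * g3"
          for Q p m b r2 g1 g2 g3 :: real by (simp add: algebra_simps power2_eq_square power3_eq_cube)
        show ?thesis unfolding D_def 1 2 ..
      qed
      have "\<bar>D h\<bar> \<le> 1 / (2 * A) *
         ((2 * (2 * norm h)) * (\<bar>2 - a\<bar> * (4 * L * A) + a * (4 * L * A) + M * A) +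
          (\<bar>2 - a\<bar> * (1 * (4 * a * L * A * norm h)) + (a * (2 * norm h)) * (4 * L * A) +
            a * (16 * (a + 1) * L * A * norm h) + 4 * a * M * A * norm h))"
      proof -
        have m: "\<bar>u * v\<bar> \<le> U * V" if "\<bar>u\<bar> \<le> U" "\<bar>v\<bar> \<le> V" for u v U V :: real
          unfolding abs_mult using that by (intro mult_mono) auto
        have p: "\<bar>u + v\<bar> \<le> U + V" if "\<bar>u\<bar> \<le> U" "\<bar>v\<bar> \<le> V" for u v U V :: real
          using abs_triangle_ineq[of u v] that by linarith
        have b: "\<bar>q x * riesz a \<alpha>w x\<bar> \<le> 4 * L * A" "\<bar>(q x)\<^sup>2 * riesz (a + 1) \<alpha>w x\<bar> \<le> 4 * L * A"
          "\<bar>q x * riesz a \<beta> x\<bar> \<le> M * A" "\<bar>q x * (riesz_grad a \<alpha>w x \<bullet> h)\<bar> \<le> 4 * a * L * A * norm h"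
          "\<bar>(q x) ^ 3 * (riesz_grad (a + 1) \<alpha>w x \<bullet> h)\<bar> \<le> 16 * (a + 1) * L * A * norm h"
          "\<bar>(q x)\<^sup>2 * (riesz_grad a \<beta> x \<bullet> h)\<bar> \<le> 4 * a * M * A * norm h"
          using b1 b2 b3[of h] b4[of h] b5 b6[of h] q by (simp_all add: abs_mult)
        have s: "\<bar>1 / (2 * A)\<bar> \<le> 1 / (2 * A)" "\<bar>a\<bar> \<le> a" "\<bar>2::real\<bar> \<le> 2" "\<bar>q x\<bar> \<le> 1"
          using A a q by auto
        show ?thesis
          unfolding eqD by (intro m p b s q'b order_refl)
      qed
      also have "\<dots> = C * norm h"
      proof -
        have "K * ((2 * (2 * H)) * X + (m * (1 * (Y1 * H)) + (b * (2 * H)) * Y2 + b * (Y3 * H) + Y4 * H)) =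
            K * (4 * X + (m * Y1 + 2 * b * Y2 + b * Y3 + Y4)) * H"
          for K H X m b Y1 Y2 Y3 Y4 :: real by algebra
        from this[of "1 / (2 * A)" "norm h"] show ?thesis unfolding C_def .
      qed
      finally show ?thesis .
    qed
    ultimately show "\<exists>D. (biharm_ext \<alpha> \<beta> has_derivative D) (at x) \<and> (\<forall>h. \<bar>D h\<bar> \<le> C * norm h)" by blast
  qed
  then show ?thesis by blast
qed

section \<open>Distributional boundary values\<close>

lemma partial_eqI:
  assumes "(f has_derivative D) (at x)"
  shows "partial i f x = D (axis i 1)"
  unfolding partial_def
  by (rule vector_derivative_at, rule has_derivative_axis) (use assms in simp)

lemma DERIV_along_axis:
  fixes f :: "real ^ 'n::finite \<Rightarrow> 'b::real_normed_vector"
  assumes "f differentiable (at (x + t *\<^sub>R axis i 1))"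
  shows "((\<lambda>t. f (x + t *\<^sub>R axis i 1)) has_vector_derivative partial i f (x + t *\<^sub>R axis i 1)) (at t)"
proof -
  obtain D where "(f has_derivative D) (at (x + t *\<^sub>R axis i 1))"
    using assms by (auto simp: differentiable_def)
  then show ?thesis using has_derivative_axis partial_eqI by metis
qed

lemma partial_nth:
  fixes f :: "real ^ 'n::finite \<Rightarrow> real ^ 'm::finite"
  assumes "f differentiable (at x)"
  shows "((\<lambda>t. f (x + t *\<^sub>R axis i 1) $ j) has_real_derivative partial i f x $ j) (at 0)"
  using bounded_linear.has_vector_derivative[OF bounded_linear_vec_nth[of j] DERIV_along_axis[of f x 0 i]] assms
  by (simp add: has_real_derivative_iff_has_vector_derivative)

text \<open>The bridge from the operators \<open>partial\<close> and \<open>laplacian\<close>, which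
  return an unspecified value where no derivative exists, to the relations in which the estimates
  are phrased.\<close>

lemma Ck_on_component_calculus:
  fixes f :: "real ^ 'n::finite \<Rightarrow> real ^ 'm::finite"
  assumes f: "Ck_on 2 (ball 0 R) f" and x: "norm x < R"
  shows "((\<lambda>x. f x $ j) has_derivative (\<lambda>h. (\<chi> i. partial i f x $ j) \<bullet> h)) (at x)"
    and "has_lap (\<lambda>x. f x $ j) x (\<chi> i. partial i f x $ j) (laplacian f x $ j)"
    and "continuous_on (ball 0 R) (\<lambda>x. \<chi> i. partial i f x $ j)"
proof -
  have d: "f differentiable (at y)" "partial i f differentiable (at y)" if "norm y < R" for y i
    using f that by (auto simp: numeral_2_eq_2)
  obtain D where D: "(f has_derivative D) (at x)" using d(1)[OF x] by (auto simp: differentiable_def)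
  have lin: "linear D" using D by (rule has_derivative_linear)
  have "D h $ j = (\<chi> i. partial i f x $ j) \<bullet> h" for h
    using linear_axis_sum[OF lin, of h] by (simp add: partial_eqI[OF D] inner_vec_def mult.commute)
  moreover have "((\<lambda>x. f x $ j) has_derivative (\<lambda>h. D h $ j)) (at x)"
    by (rule bounded_linear.has_derivative[OF bounded_linear_vec_nth D])
  ultimately show "((\<lambda>x. f x $ j) has_derivative (\<lambda>h. (\<chi> i. partial i f x $ j) \<bullet> h)) (at x)" by simp
  show "has_lap (\<lambda>x. f x $ j) x (\<chi> i. partial i f x $ j) (laplacian f x $ j)"
  proof (rule has_lapI)
    fix i
    show "has_d2 (\<lambda>t. f (x + t *\<^sub>R axis i 1) $ j) ((\<chi> i. partial i f x $ j) $ i) (partial i (partial i f) x $ j)"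
    proof (rule has_d2I)
      show "\<forall>\<^sub>F t in nhds 0. ((\<lambda>t. f (x + t *\<^sub>R axis i 1) $ j) has_real_derivative partial i f (x + t *\<^sub>R axis i 1) $ j) (at t)"
        using eventually_ball_axis[OF x, of i]
      proof eventually_elim
        case (elim t)
        from bounded_linear.has_vector_derivative[OF bounded_linear_vec_nth[of j] DERIV_along_axis[OF d(1)[OF elim]]]
        show ?case by (simp add: has_real_derivative_iff_has_vector_derivative)
      qed
      show "((\<lambda>t. partial i f (x + t *\<^sub>R axis i 1) $ j) has_real_derivative partial i (partial i f) x $ j) (at 0)"
        by (rule partial_nth[OF d(2)[OF x]])
    qed simp
  qed (simp add: laplacian_def)
  have "continuous_on (ball 0 R) (partial i f)" for i
    by (rule continuous_at_imp_continuous_on, rule ballI, rule differentiable_imp_continuous_within, rule d(2)) simp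
  then show "continuous_on (ball 0 R) (\<lambda>x. \<chi> i. partial i f x $ j)"
    by (intro continuous_intros)
qed

section \<open>Smooth test functions on the whole space\<close>

lemma Ck_on_Suc_imp: "Ck_on (Suc k) U f \<Longrightarrow> Ck_on k U f"
proof (induction k arbitrary: f)
  case 0
  then show ?case
    by (auto intro!: continuous_at_imp_continuous_on differentiable_imp_continuous_within)
next
  case (Suc k)
  then show ?case by auto
qed

lemma partial_eq_frechet:
  "f differentiable (at x) \<Longrightarrow> partial i f x = frechet_derivative f (at x) (axis i 1)"
  using partial_eqI frechet_derivative_works by blast

lemma Ck_on_const: "Ck_on k UNIV (\<lambda>_ :: real ^ 'n::finite. c :: real)"
proof (induction k arbitrary: c)
  case (Suc k)
  have "partial i (\<lambda>_ :: real ^ 'n. c) = (\<lambda>_. 0)" for i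
    by (rule ext, subst partial_eqI[OF has_derivative_const]) simp
  with Suc show ?case by simp
qed simp

lemma Ck_on_coord: "Ck_on k UNIV (\<lambda>z :: real ^ 'n::finite. z $ j)"
proof (cases k)
  case 0
  then show ?thesis by (simp add: continuous_on_component)
next
  case (Suc k')
  have d: "((\<lambda>z :: real ^ 'n. z $ j) has_derivative (\<lambda>h. h $ j)) (at x)" for x
    by (rule bounded_linear.has_derivative[OF bounded_linear_vec_nth has_derivative_ident])
  have "partial i (\<lambda>z :: real ^ 'n. z $ j) = (\<lambda>_. axis i 1 $ j)" for i
    by (rule ext, rule partial_eqI[OF d])
  then show ?thesis using Suc by (simp add: Ck_on_const differentiableI[OF d])
qed

lemma Ck_on_add:
  fixes u v :: "real ^ 'n::finite \<Rightarrow> real"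
  shows "Ck_on k UNIV u \<Longrightarrow> Ck_on k UNIV v \<Longrightarrow> Ck_on k UNIV (\<lambda>x. u x + v x)"
proof (induction k arbitrary: u v)
  case 0
  then show ?case by (simp add: continuous_on_add)
next
  case (Suc k)
  have "partial i (\<lambda>x. u x + v x) = (\<lambda>x. partial i u x + partial i v x)" for i
  proof
    fix x
    have "u differentiable (at x)" "v differentiable (at x)" using Suc.prems by auto
    then show "partial i (\<lambda>x. u x + v x) x = partial i u x + partial i v x"
      by (subst partial_eqI[OF has_derivative_add[OF frechet_derivative_works[THEN iffD1] frechet_derivative_works[THEN iffD1]]])
         (simp_all add: partial_eq_frechet)
  qed
  with Suc show ?case by (auto intro!: differentiable_add)
qed

lemma Ck_on_mult:
  fixes u v :: "real ^ 'n::finite \<Rightarrow> real"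
  shows "Ck_on k UNIV u \<Longrightarrow> Ck_on k UNIV v \<Longrightarrow> Ck_on k UNIV (\<lambda>x. u x * v x)"
proof (induction k arbitrary: u v)
  case 0
  then show ?case by (simp add: continuous_on_mult)
next
  case (Suc k)
  have "partial i (\<lambda>x. u x * v x) = (\<lambda>x. u x * partial i v x + partial i u x * v x)" for i
  proof
    fix x
    have "u differentiable (at x)" "v differentiable (at x)" using Suc.prems by auto
    then show "partial i (\<lambda>x. u x * v x) x = u x * partial i v x + partial i u x * v x"
      by (subst partial_eqI[OF has_derivative_mult[OF frechet_derivative_works[THEN iffD1] frechet_derivative_works[THEN iffD1]]])
         (simp_all add: partial_eq_frechet)
  qed
  moreover have "Ck_on k UNIV u" "Ck_on k UNIV v" using Suc.prems by (auto intro: Ck_on_Suc_imp)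
  ultimately show ?case using Suc by (auto intro!: differentiable_mult Ck_on_add Suc.IH)
qed

text \<open>The exponent has to vary in the induction, since differentiating lowers it by
  one.\<close>

lemma Ck_on_powr:
  fixes u :: "real ^ 'n::finite \<Rightarrow> real"
  assumes pos: "\<And>x. u x > 0"
  shows "Ck_on k UNIV u \<Longrightarrow> Ck_on k UNIV (\<lambda>x. u x powr c)"
proof (induction k arbitrary: c)
  case 0
  then show ?case using pos by (auto intro!: continuous_intros simp: less_imp_neq[THEN not_sym])
next
  case (Suc k)
  have d: "((\<lambda>x. u x powr c) has_derivative (\<lambda>h. frechet_derivative u (at x) h * (c * u x powr (c - 1)))) (at x)" for x
  proof -
    have "(u has_derivative frechet_derivative u (at x)) (at x)"
      using Suc.prems by (auto simp: frechet_derivative_works[symmetric])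
    moreover have "((\<lambda>y. y powr c) has_derivative (\<lambda>h. h * (c * u x powr (c - 1)))) (at (u x))"
      using has_real_derivative_powr[OF pos, of c x]
      unfolding has_field_derivative_def by (rule has_derivative_eq_rhs) auto
    ultimately show ?thesis by (rule has_derivative_compose)
  qed
  have "partial i (\<lambda>x. u x powr c) = (\<lambda>x. partial i u x * (c * u x powr (c - 1)))" for i
    by (rule ext, subst partial_eqI[OF d]) (use Suc.prems in \<open>simp add: partial_eq_frechet\<close>)
  moreover have "Ck_on k UNIV (\<lambda>x. partial i u x * (c * u x powr (c - 1)))" for i
    using Suc.prems Ck_on_Suc_imp[OF Suc.prems] by (intro Ck_on_mult Ck_on_const Suc.IH) auto
  ultimately show ?case using differentiableI[OF d] by auto
qed

text \<open>
  The factor \<open>2 / (1 + z \<bullet> z)\<close>, which is 1 on the unit sphere, is inserted into the mixed term of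
  \<open>(x - z) \<bullet> (x - z)\<close>; the result is smooth and positive on the whole space.
\<close>

lemma smooth_kernel_extension:
  fixes x :: "real ^ 'n::finite"
  assumes x: "norm x < 1"
  shows "\<exists>\<psi>. (\<forall>k. Ck_on k UNIV \<psi>) \<and> (\<forall>z\<in>sphere 0 1. \<psi> z = ((x - z) \<bullet> (x - z)) powr c)"
proof -
  define u where "u z = 1 + (\<Sum>i\<in>UNIV. z $ i * z $ i)" for z :: "real ^ 'n"
  have uz: "u z = 1 + z \<bullet> z" for z by (simp add: u_def inner_vec_def)
  have u: "u z > 0" for z unfolding uz by (simp add: add_pos_nonneg)
  \<comment> \<open>Division is written as \<open>powr (-1)\<close> and the inner product as a sum
    over coordinates, so that the closure rules for \<open>Ck_on\<close> apply.\<close>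
  define v where "v z = (1 + x \<bullet> x) + (\<Sum>i\<in>UNIV. (-4 * x $ i) * z $ i) * u z powr (-1)" for z
  have vz: "v z = (1 + x \<bullet> x) - 4 * (x \<bullet> z) / (1 + z \<bullet> z)" for z
    using u[of z] by (simp add: v_def uz inner_vec_def powr_minus_divide sum_distrib_left sum_negf mult.assoc)
  \<comment> \<open>From \<open>2 * norm z \<le> 1 + z \<bullet> z\<close> one gets
    \<open>v z \<ge> (1 - norm x)\<^sup>2\<close>, which is positive inside the ball.\<close>
  have v: "v z > 0" for z
  proof -
    have "x \<bullet> z \<le> norm x * norm z" by (rule norm_cauchy_schwarz)
    moreover have "2 * norm z \<le> 1 + z \<bullet> z"
      using zero_le_power2[of "norm z - 1"] by (simp add: power2_norm_eq_inner[symmetric] power2_diff)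
    then have "2 * (norm x * norm z) \<le> norm x * (1 + z \<bullet> z)"
      using mult_left_mono[of "2 * norm z" "1 + z \<bullet> z" "norm x"] by (simp add: mult_ac)
    ultimately have "4 * (x \<bullet> z) \<le> (2 * norm x) * (1 + z \<bullet> z)" by simp
    then have "4 * (x \<bullet> z) / (1 + z \<bullet> z) \<le> 2 * norm x"
      using u[of z] by (simp add: uz divide_le_eq)
    moreover have "(1 - norm x)\<^sup>2 > 0" using x by simp
    then have "2 * norm x < 1 + x \<bullet> x" by (simp add: power2_diff power2_norm_eq_inner)
    ultimately show ?thesis unfolding vz by linarith
  qed
  have sum: "Ck_on k UNIV (\<lambda>z. \<Sum>i\<in>I. p i z)" if "\<And>i. Ck_on k UNIV (p i)"
    for k and I :: "'n set" and p :: "'n \<Rightarrow> real ^ 'n \<Rightarrow> real"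
    by (induction I rule: infinite_finite_induct) (auto intro: Ck_on_const Ck_on_add that)
  have Cu: "Ck_on k UNIV u" for k
    unfolding u_def by (intro Ck_on_add Ck_on_const sum Ck_on_mult Ck_on_coord)
  have Cv: "Ck_on k UNIV v" for k
    unfolding v_def by (intro Ck_on_add Ck_on_mult Ck_on_const sum Ck_on_coord Ck_on_powr u Cu)
  have "v z = (x - z) \<bullet> (x - z)" if "z \<in> sphere 0 1" for z
  proof -
    have "z \<bullet> z = 1" using that by (simp add: norm_eq_1)
    then show ?thesis by (simp add: vz inner_diff_left inner_diff_right inner_commute)
  qed
  then show ?thesis
    by (intro exI[of _ "\<lambda>z. v z powr c"]) (auto intro: Ck_on_powr v Cv)
qed

lemma riesz_distr_limit:
  fixes u :: "real \<Rightarrow> real ^ 'n::finite \<Rightarrow> real ^ 'm::finite"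
  assumes lim: "sphere_distr_limit u v" and x: "norm x < 1"
    and u: "\<forall>\<^sub>F r in at_left 1. continuous_on (sphere 0 1) (u r)" and v: "continuous_on (sphere 0 1) v"
  shows "((\<lambda>r. riesz c (\<lambda>z. u r z $ j) x) \<longlongrightarrow> riesz c (\<lambda>z. v z $ j) x) (at_left 1)"
proof -
  obtain \<psi> where \<psi>: "\<And>k. Ck_on k UNIV \<psi>" "\<And>z. z \<in> sphere 0 1 \<Longrightarrow> \<psi> z = ((x - z) \<bullet> (x - z)) powr - c"
    using smooth_kernel_extension[OF x, of "- c"] by blast
  have \<psi>c: "continuous_on (sphere 0 1) \<psi>"
    using \<psi>(1)[of 0] by (auto intro: continuous_on_subset)
  \<comment> \<open>Continuity of \<open>w\<close> makes the vector-valued integrand integrable, so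
    the coordinate may be taken under the integral.\<close>
  have eq: "(LINT z|sphere_measure. \<psi> z *\<^sub>R w z) $ j = riesz c (\<lambda>z. w z $ j) x"
    if "continuous_on (sphere 0 1) w" for w :: "real ^ 'n \<Rightarrow> real ^ 'm"
  proof -
    have "integrable sphere_measure (\<lambda>z. \<psi> z *\<^sub>R w z)"
      by (intro integrable_sphere continuous_intros \<psi>c that)
    from integral_bounded_linear[OF bounded_linear_vec_nth this, of j]
    have "(LINT z|sphere_measure. \<psi> z *\<^sub>R w z) $ j = (LINT z|sphere_measure. (\<psi> z *\<^sub>R w z) $ j)" by simp
    also have "\<dots> = riesz c (\<lambda>z. w z $ j) x"
      unfolding riesz_def by (intro Bochner_Integration.integral_cong refl) (use \<psi>(2) in simp)
    finally show ?thesis .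
  qed
  have "((\<lambda>r. LINT z|sphere_measure. \<psi> z *\<^sub>R u r z) \<longlongrightarrow> (LINT z|sphere_measure. \<psi> z *\<^sub>R v z)) (at_left 1)"
    using lim \<psi>(1) unfolding sphere_distr_limit_def by blast
  from tendsto_vec_nth[OF this, of j]
  have "((\<lambda>r. (LINT z|sphere_measure. \<psi> z *\<^sub>R u r z) $ j) \<longlongrightarrow> riesz c (\<lambda>z. v z $ j) x) (at_left 1)"
    unfolding eq[OF v] .
  then show ?thesis
    by (rule Lim_transform_eventually) (use u in \<open>eventually_elim, simp add: eq\<close>)
qed

section \<open>Majorants compared with linear functions, and passage to the limit\<close>

lemma majorant_quotient_antimono:
  "majorant \<omega> \<Longrightarrow> 0 < s \<Longrightarrow> s \<le> t \<Longrightarrow> \<omega> t / t \<le> \<omega> s / s"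
  by (auto simp: majorant_def monotone_on_def)

text \<open>Since \<open>\<omega> t / t\<close> is non-increasing, the quotients near 0 are at least
  the one at \<open>t\<close>; a limit superior at 0 is thereby a global bound.\<close>

lemma majorant_quotient_le_limsup:
  assumes \<omega>: "majorant \<omega>" and c: "Limsup (at_right 0) (\<lambda>t. ereal (\<omega> t / t)) = ereal c" and t: "t > 0"
  shows "\<omega> t / t \<le> c"
proof -
  have "\<forall>\<^sub>F s in at_right 0. s \<in> {0<..<t}"
    by (rule eventually_at_right_real[OF t])
  then have "\<forall>\<^sub>F s in at_right 0. ereal (\<omega> t / t) \<le> ereal (\<omega> s / s)"
    by eventually_elim (use majorant_quotient_antimono[OF \<omega>] in auto)
  then have "ereal (\<omega> t / t) \<le> Limsup (at_right 0) (\<lambda>s. ereal (\<omega> s / s))"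
    by (rule le_Limsup[rotated]) simp
  then show ?thesis unfolding c by simp
qed

lemma inward_normal_deriv_nth:
  fixes f :: "real ^ 'n::finite \<Rightarrow> real ^ 'm::finite"
  assumes f: "Ck_on 2 (ball 0 1) f" and z: "norm z = 1" and r: "0 < r" "r < 1"
  shows "inward_normal_deriv (\<lambda>x. f (r *\<^sub>R x)) z $ j = - ((r *\<^sub>R (\<chi> i. partial i f (r *\<^sub>R z) $ j)) \<bullet> z)"
proof -
  have rz: "norm (r *\<^sub>R z) < 1" using z r by simp
  have "f differentiable (at (r *\<^sub>R z))" using f rz by (auto simp: numeral_2_eq_2)
  then obtain D where D: "(f has_derivative D) (at (r *\<^sub>R z))" by (auto simp: differentiable_def)
  have lin: "linear D" using D by (rule has_derivative_linear)
  have "((\<lambda>t. r *\<^sub>R (t *\<^sub>R z)) has_derivative (\<lambda>h. r *\<^sub>R (h *\<^sub>R z))) (at (1::real))"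
    by (auto intro!: derivative_eq_intros)
  from has_derivative_compose[OF this, of f D] D
  have "((\<lambda>t. f (r *\<^sub>R (t *\<^sub>R z))) has_derivative (\<lambda>h. D (r *\<^sub>R (h *\<^sub>R z)))) (at (1::real))" by simp
  then have "((\<lambda>t. f (r *\<^sub>R (t *\<^sub>R z))) has_vector_derivative D (r *\<^sub>R z)) (at 1)"
    unfolding has_vector_derivative_def by (simp add: linear_scale[OF lin] mult.commute)
  then have "inward_normal_deriv (\<lambda>x. f (r *\<^sub>R x)) z = - D (r *\<^sub>R z)"
    unfolding inward_normal_deriv_def by (simp add: vector_derivative_at)
  moreover have "(\<lambda>h. D h $ j) = (\<lambda>h. (\<chi> i. partial i f (r *\<^sub>R z) $ j) \<bullet> h)"
    by (rule has_derivative_unique[OF bounded_linear.has_derivative[OF bounded_linear_vec_nth D]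
          Ck_on_component_calculus(1)[OF f rz]])
  then have "D (r *\<^sub>R z) $ j = (\<chi> i. partial i f (r *\<^sub>R z) $ j) \<bullet> (r *\<^sub>R z)" by (rule fun_cong)
  ultimately show ?thesis by simp
qed

lemma biharm_ext_cong:
  "(\<And>z. z \<in> sphere 0 1 \<Longrightarrow> \<alpha> z = \<alpha>' z) \<Longrightarrow> (\<And>z. z \<in> sphere 0 1 \<Longrightarrow> \<beta> z = \<beta>' z) \<Longrightarrow>
    biharm_ext \<alpha> \<beta> x = biharm_ext \<alpha>' \<beta>' x"
  unfolding biharm_ext_def using riesz_cong[of \<alpha> \<alpha>'] riesz_cong[of \<beta> \<beta>'] by simp

lemma biharm_ext_distr_limit:
  fixes u u' :: "real \<Rightarrow> real ^ 'n::finite \<Rightarrow> real ^ 'm::finite"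
  assumes "sphere_distr_limit u v" "sphere_distr_limit u' v'" and x: "norm x < 1"
    and "\<forall>\<^sub>F r in at_left 1. continuous_on (sphere 0 1) (u r)" "continuous_on (sphere 0 1) v"
    and "\<forall>\<^sub>F r in at_left 1. continuous_on (sphere 0 1) (u' r)" "continuous_on (sphere 0 1) v'"
  shows "((\<lambda>r. biharm_ext (\<lambda>z. u r z $ j) (\<lambda>z. u' r z $ j) x) \<longlongrightarrow>
    biharm_ext (\<lambda>z. v z $ j) (\<lambda>z. v' z $ j) x) (at_left 1)"
  unfolding biharm_ext_def by (intro tendsto_intros riesz_distr_limit assms)

lemma biharmonic_dirichlet_component_lipschitz:
  fixes f g \<phi>\<^sub>1 \<phi>\<^sub>2 :: "real ^ 'n::finite \<Rightarrow> real ^ 'm::finite"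
  assumes \<phi>1: "\<And>z w. z \<in> sphere 0 1 \<Longrightarrow> w \<in> sphere 0 1 \<Longrightarrow> norm (\<phi>\<^sub>1 z - \<phi>\<^sub>1 w) \<le> L * norm (z - w)"
    and L: "L \<ge> 0" and \<phi>2: "continuous_on (sphere 0 1) \<phi>\<^sub>2"
    and g: "continuous_on (cball 0 1) g" and bd: "biharmonic_dirichlet g \<phi>\<^sub>1 \<phi>\<^sub>2 f"
  shows "\<exists>K. \<forall>x y. norm x < 1 \<longrightarrow> norm y < 1 \<longrightarrow> \<bar>f x $ j - f y $ j\<bar> \<le> K * norm (x - y)"
proof -
  have f: "Ck_on 2 (ball 0 1) f" and v: "Ck_on 2 (ball 0 1) (laplacian f)"
    and eq: "\<And>x. norm x < 1 \<Longrightarrow> laplacian (laplacian f) x = g x"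
    and lim1: "sphere_distr_limit (\<lambda>r \<zeta>. f (r *\<^sub>R \<zeta>)) \<phi>\<^sub>1"
    and lim2: "sphere_distr_limit (\<lambda>r. inward_normal_deriv (\<lambda>x. f (r *\<^sub>R x))) \<phi>\<^sub>2"
    using bd unfolding biharmonic_dirichlet_def by auto
  note cf = Ck_on_component_calculus[OF f, of _ j]
  note cv = Ck_on_component_calculus[OF v, of _ j]
  define gf where "gf x = (\<chi> i. partial i f x $ j)" for x
  define gv where "gv x = (\<chi> i. partial i (laplacian f) x $ j)" for x
  obtain S where S: "\<And>x. norm x \<le> 1 \<Longrightarrow> \<bar>g x $ j\<bar> \<le> S"
  proof -
    obtain B where B: "\<forall>y\<in>g ` cball 0 1. norm y \<le> B"
      using compact_imp_bounded[OF compact_continuous_image[OF g compact_cball]]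
      unfolding bounded_iff by blast
    show ?thesis
      by (rule that[of B]) (use B in \<open>auto intro: order_trans[OF component_le_norm_cart]\<close>)
  qed
  have S0: "S \<ge> 0" using S[of 0] by simp
  define n where "n = real CARD('n)"
  define C where "C = n * (S / 4 + 2 * (n\<^sup>2 * S + 8 * S + 1))"
  define \<alpha> where "\<alpha> r z = f (r *\<^sub>R z) $ j" for r z
  define \<beta> where "\<beta> r z = inward_normal_deriv (\<lambda>x. f (r *\<^sub>R x)) z $ j" for r z
  have \<beta>eq: "\<beta> r z = - ((r *\<^sub>R gf (r *\<^sub>R z)) \<bullet> z)" if "0 < r" "r < 1" "z \<in> sphere 0 1" for r z
    unfolding \<beta>_def gf_def by (rule inward_normal_deriv_nth[OF f]) (use that in auto)
  have scaled: "\<bar>(\<alpha> r x - biharm_ext (\<alpha> r) (\<beta> r) x) - (\<alpha> r y - biharm_ext (\<alpha> r) (\<beta> r) y)\<bar> \<le> C * norm (x - y)"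
    if r: "0 < r" "r < 1" and x: "norm x < 1" and y: "norm y < 1" for r x y
  proof -
    have nr: "norm (r *\<^sub>R x) < 1" if "norm x < 1 / r" for x :: "real ^ 'n"
      using that r by (simp add: field_simps)
    have z0: "norm (0 :: real ^ 'n) < 1" by simp
    have sc: "((\<lambda>x. r *\<^sub>R x) has_derivative (\<lambda>h. r *\<^sub>R h)) (at x)" for x :: "real ^ 'n"
      by (auto intro!: derivative_eq_intros)
    have cont: "continuous_on (ball 0 (1 / r)) (\<lambda>x. k (r *\<^sub>R x))"
      if "continuous_on (ball 0 1) k" for k :: "real ^ 'n \<Rightarrow> real ^ 'n"
      by (rule continuous_on_compose2[OF that]) (use nr in \<open>auto intro!: continuous_intros\<close>)
    have "\<bar>(\<alpha> r x - biharm_ext (\<alpha> r) (\<lambda>z. - ((r *\<^sub>R gf (r *\<^sub>R z)) \<bullet> z)) x) -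
        (\<alpha> r y - biharm_ext (\<alpha> r) (\<lambda>z. - ((r *\<^sub>R gf (r *\<^sub>R z)) \<bullet> z)) y)\<bar> \<le> C * norm (x - y)"
      unfolding C_def n_def
    \<comment> \<open>\<open>f (r *\<^sub>R x)\<close> is regular on the ball of radius
      \<open>1 / r > 1\<close>. Each derivative brings a factor \<open>r\<close>, whence
      \<open>r\<^sup>2\<close>, \<open>r\<^sup>3\<close> and \<open>r\<^sup>4\<close> in the three
      instances; as \<open>r < 1\<close>, the one bound \<open>S\<close> for \<open>g\<close> serves
      all \<open>r\<close>.\<close>
    proof (rule apriori_lipschitz[where R = "1 / r" and V = "\<lambda>x. r\<^sup>2 * laplacian f (r *\<^sub>R x) $ j"
          and gV = "\<lambda>x. r\<^sup>2 *\<^sub>R (r *\<^sub>R gv (r *\<^sub>R x))" and G = "\<lambda>x. r\<^sup>2 * (r\<^sup>2 * g (r *\<^sub>R x) $ j)"])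
      show "1 / r > 1" using r by simp
      fix x :: "real ^ 'n" assume x: "norm x < 1 / r"
      show "(\<alpha> r has_derivative (\<lambda>h. (r *\<^sub>R gf (r *\<^sub>R x)) \<bullet> h)) (at x)"
        using has_derivative_compose[OF sc cf(1)[OF nr[OF x]]] by (simp add: \<alpha>_def[abs_def] gf_def)
      show "has_lap (\<alpha> r) x (r *\<^sub>R gf (r *\<^sub>R x)) (r\<^sup>2 * laplacian f (r *\<^sub>R x) $ j)"
        using has_lap_scale[OF cf(2)[OF nr[OF x]]] by (simp add: \<alpha>_def[abs_def] gf_def)
      show "((\<lambda>x. r\<^sup>2 * laplacian f (r *\<^sub>R x) $ j) has_derivative (\<lambda>h. (r\<^sup>2 *\<^sub>R (r *\<^sub>R gv (r *\<^sub>R x))) \<bullet> h)) (at x)"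
        using has_derivative_mult_right[OF has_derivative_compose[OF sc cv(1)[OF nr[OF x]]], of "r\<^sup>2"]
        by (simp add: gv_def mult.assoc)
      show "has_lap (\<lambda>x. r\<^sup>2 * laplacian f (r *\<^sub>R x) $ j) x (r\<^sup>2 *\<^sub>R (r *\<^sub>R gv (r *\<^sub>R x))) (r\<^sup>2 * (r\<^sup>2 * g (r *\<^sub>R x) $ j))"
        using has_lap_cmult[OF has_lap_scale[OF cv(2)[OF nr[OF x]]], of "r\<^sup>2"] eq[OF nr[OF x]] by (simp add: gv_def)
    next
      show "continuous_on (ball 0 (1 / r)) (\<lambda>x. r *\<^sub>R gf (r *\<^sub>R x))"
        using cont[OF cf(3)[OF z0]] by (intro continuous_intros) (simp add: gf_def)
      show "continuous_on (ball 0 (1 / r)) (\<lambda>x. r\<^sup>2 *\<^sub>R (r *\<^sub>R gv (r *\<^sub>R x)))"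
        using cont[OF cv(3)[OF z0]] by (intro continuous_intros) (simp add: gv_def)
    next
      fix x :: "real ^ 'n" assume "norm x < 1"
      then have "norm (r *\<^sub>R x) \<le> 1" using r by (simp add: mult_le_one)
      then have "\<bar>g (r *\<^sub>R x) $ j\<bar> \<le> S" by (rule S)
      moreover have "r\<^sup>2 \<le> 1" using r by (simp add: power_le_one)
      ultimately have "r\<^sup>2 * (r\<^sup>2 * \<bar>g (r *\<^sub>R x) $ j\<bar>) \<le> 1 * (1 * S)"
        by (intro mult_mono) auto
      then show "\<bar>r\<^sup>2 * (r\<^sup>2 * g (r *\<^sub>R x) $ j)\<bar> \<le> S" by (simp add: abs_mult)
    qed (fact x y)+
    moreover have "biharm_ext (\<alpha> r) (\<beta> r) x = biharm_ext (\<alpha> r) (\<lambda>z. - ((r *\<^sub>R gf (r *\<^sub>R z)) \<bullet> z)) x" for x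
      by (rule biharm_ext_cong) (use \<beta>eq r in auto)
    ultimately show ?thesis by simp
  qed
  have r01: "\<forall>\<^sub>F r in at_left 1. r \<in> {0<..<1::real}"
    by (rule eventually_at_left_real) simp
  have contf: "continuous_on (ball 0 1) f"
    by (rule continuous_at_imp_continuous_on, rule ballI, rule differentiable_imp_continuous_within)
       (use f in \<open>auto simp: numeral_2_eq_2\<close>)
  have c1: "\<forall>\<^sub>F r in at_left 1. continuous_on (sphere 0 1) (\<lambda>\<zeta>. f (r *\<^sub>R \<zeta>))"
    using r01
    by eventually_elim (rule continuous_on_compose2[OF contf], auto intro!: continuous_intros)
  have c2: "\<forall>\<^sub>F r in at_left 1. continuous_on (sphere 0 1) (inward_normal_deriv (\<lambda>x. f (r *\<^sub>R x)))"
    using r01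
  proof eventually_elim
    case (elim r)
    have "continuous_on (sphere 0 1) (\<lambda>\<zeta>. \<chi> k. inward_normal_deriv (\<lambda>x. f (r *\<^sub>R x)) \<zeta> $ k)"
    proof (rule continuous_on_vec_lambda)
      fix k
      have "continuous_on (sphere 0 1) (\<lambda>\<zeta>. \<chi> i. partial i f (r *\<^sub>R \<zeta>) $ k)"
        by (rule continuous_on_compose2[OF Ck_on_component_calculus(3)[OF f, of 0 k]])
           (use elim in \<open>auto intro!: continuous_intros\<close>)
      then have "continuous_on (sphere 0 1) (\<lambda>\<zeta>. - ((r *\<^sub>R (\<chi> i. partial i f (r *\<^sub>R \<zeta>) $ k)) \<bullet> \<zeta>))"
        by (rule continuous_on_minus[OF continuous_on_inner[OF continuous_on_scaleR[OF continuous_on_const] continuous_on_id]])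
      then show "continuous_on (sphere 0 1) (\<lambda>\<zeta>. inward_normal_deriv (\<lambda>x. f (r *\<^sub>R x)) \<zeta> $ k)"
        by (rule continuous_on_eq) (use elim in \<open>auto simp: inward_normal_deriv_nth[OF f]\<close>)
    qed
    then show ?case by simp
  qed
  have \<phi>1c: "continuous_on (sphere 0 1) \<phi>\<^sub>1"
  proof -
    have "L-lipschitz_on (sphere 0 1) \<phi>\<^sub>1"
      by (rule lipschitz_onI) (use \<phi>1 L in \<open>auto simp: dist_norm\<close>)
    then show ?thesis by (rule lipschitz_on_continuous_on)
  qed
  define T where "T = biharm_ext (\<lambda>z. \<phi>\<^sub>1 z $ j) (\<lambda>z. \<phi>\<^sub>2 z $ j)"
  have lim: "((\<lambda>r. \<alpha> r x - biharm_ext (\<alpha> r) (\<beta> r) x) \<longlongrightarrow> f x $ j - T x) (at_left 1)" if x: "norm x < 1" for x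
  proof (rule tendsto_diff)
    have "((\<lambda>r. r *\<^sub>R x) \<longlongrightarrow> 1 *\<^sub>R x) (at_left 1)" by (intro tendsto_intros)
    moreover have "isCont f x" using contf x by (simp add: continuous_on_eq_continuous_at)
    ultimately have "((\<lambda>r. f (r *\<^sub>R x)) \<longlongrightarrow> f x) (at_left 1)"
      using isCont_tendsto_compose[of x f "\<lambda>r. r *\<^sub>R x"] by simp
    then show "((\<lambda>r. \<alpha> r x) \<longlongrightarrow> f x $ j) (at_left 1)" unfolding \<alpha>_def by (rule tendsto_vec_nth)
    show "((\<lambda>r. biharm_ext (\<alpha> r) (\<beta> r) x) \<longlongrightarrow> T x) (at_left 1)"
      unfolding T_def \<alpha>_def[abs_def] \<beta>_def[abs_def]
      by (rule biharm_ext_distr_limit[OF lim1 lim2 x c1 \<phi>1c c2 \<phi>2])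
  qed
  have w: "\<bar>(f x $ j - T x) - (f y $ j - T y)\<bar> \<le> C * norm (x - y)" if x: "norm x < 1" and y: "norm y < 1" for x y
  proof (rule tendsto_upperbound)
    show "((\<lambda>r. \<bar>(\<alpha> r x - biharm_ext (\<alpha> r) (\<beta> r) x) - (\<alpha> r y - biharm_ext (\<alpha> r) (\<beta> r) y)\<bar>) \<longlongrightarrow>
        \<bar>(f x $ j - T x) - (f y $ j - T y)\<bar>) (at_left 1)"
      by (intro tendsto_rabs tendsto_diff[OF lim[OF x] lim[OF y]])
    show "\<forall>\<^sub>F r in at_left 1. \<bar>(\<alpha> r x - biharm_ext (\<alpha> r) (\<beta> r) x) - (\<alpha> r y - biharm_ext (\<alpha> r) (\<beta> r) y)\<bar> \<le> C * norm (x - y)"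
      using r01 by eventually_elim (use scaled x y in auto)
  qed simp
  have "\<exists>C'. \<forall>x y. norm x < 1 \<longrightarrow> norm y < 1 \<longrightarrow> \<bar>T x - T y\<bar> \<le> C' * norm (x - y)"
    unfolding T_def
  proof (rule biharm_ext_lipschitz[OF _ L])
    fix z w :: "real ^ 'n" assume zw: "z \<in> sphere 0 1" "w \<in> sphere 0 1"
    have "\<bar>\<phi>\<^sub>1 z $ j - \<phi>\<^sub>1 w $ j\<bar> \<le> norm (\<phi>\<^sub>1 z - \<phi>\<^sub>1 w)"
      using component_le_norm_cart[of "\<phi>\<^sub>1 z - \<phi>\<^sub>1 w" j] by simp
    also have "\<dots> \<le> L * norm (z - w)" by (rule \<phi>1[OF zw])
    finally show "\<bar>\<phi>\<^sub>1 z $ j - \<phi>\<^sub>1 w $ j\<bar> \<le> L * norm (z - w)" .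
  qed (intro continuous_intros \<phi>2)
  then obtain C' where C': "\<And>x y. norm x < 1 \<Longrightarrow> norm y < 1 \<Longrightarrow> \<bar>T x - T y\<bar> \<le> C' * norm (x - y)" by blast
  have "\<bar>f x $ j - f y $ j\<bar> \<le> (C + C') * norm (x - y)" if "norm x < 1" "norm y < 1" for x y
  proof -
    have "f x $ j - f y $ j = ((f x $ j - T x) - (f y $ j - T y)) + (T x - T y)" by simp
    then have "\<bar>f x $ j - f y $ j\<bar> \<le> \<bar>(f x $ j - T x) - (f y $ j - T y)\<bar> + \<bar>T x - T y\<bar>"
      by (metis abs_triangle_ineq)
    also have "\<dots> \<le> C * norm (x - y) + C' * norm (x - y)" by (rule add_mono[OF w[OF that] C'[OF that]])
    finally show ?thesis by (simp add: distrib_right)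
  qed
  then show ?thesis by blast
qed

theorem theorem1p2:
  fixes \<omega> :: "real \<Rightarrow> real" and c :: real
    and f g \<phi>\<^sub>1 \<phi>\<^sub>2 :: "real ^ 'n \<Rightarrow> real ^ 'm"
  assumes "CARD('n) \<ge> 2"
    and "majorant \<omega>"
    and "Limsup (at_right 0) (\<lambda>t. ereal (\<omega> t / t)) = ereal c"
    and "lipschitz_class \<omega> (sphere 0 1) \<phi>\<^sub>1"
    and "continuous_on (sphere 0 1) \<phi>\<^sub>2"
    and "continuous_on (cball 0 1) g"
    and "biharmonic_dirichlet g \<phi>\<^sub>1 \<phi>\<^sub>2 f"
  shows "lipschitz_class \<omega> (ball 0 1) f"
proof -
  have pos: "\<omega> t > 0" if "t > 0" for t using assms(2) that by (simp add: majorant_def)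
  have le_c: "\<omega> t \<le> c * t" if "t > 0" for t
    using majorant_quotient_le_limsup[OF assms(2,3) that] that by (simp add: divide_le_eq)
  have c: "c > 0" using pos[of 1] le_c[of 1] by simp
  obtain L where L: "L > 0" "\<And>z w. z \<in> sphere 0 1 \<Longrightarrow> w \<in> sphere 0 1 \<Longrightarrow> z \<noteq> w \<Longrightarrow> dist (\<phi>\<^sub>1 z) (\<phi>\<^sub>1 w) / \<omega> (dist z w) \<le> L"
    using assms(4) unfolding lipschitz_class_def by blast
  have \<phi>1: "norm (\<phi>\<^sub>1 z - \<phi>\<^sub>1 w) \<le> (L * c) * norm (z - w)" if "z \<in> sphere 0 1" "w \<in> sphere 0 1" for z w
  proof (cases "z = w")
    case False
    then have d: "dist z w > 0" by simp
    have "dist (\<phi>\<^sub>1 z) (\<phi>\<^sub>1 w) \<le> L * \<omega> (dist z w)"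
      using L(2)[OF that False] pos[OF d] by (simp add: divide_le_eq)
    also have "\<dots> \<le> L * (c * dist z w)" using L(1) le_c[OF d] by (intro mult_left_mono) auto
    finally show ?thesis by (simp add: dist_norm mult.assoc)
  qed simp
  have "\<exists>K. \<forall>x y. norm x < 1 \<longrightarrow> norm y < 1 \<longrightarrow> \<bar>f x $ j - f y $ j\<bar> \<le> K * norm (x - y)" for j
    by (rule biharmonic_dirichlet_component_lipschitz[OF \<phi>1 _ assms(5-7)]) (use L(1) c in simp_all)
  then obtain K where K: "\<And>j x y. norm x < 1 \<Longrightarrow> norm y < 1 \<Longrightarrow> \<bar>f x $ j - f y $ j\<bar> \<le> K j * norm (x - y)"
    by metis
  \<comment> \<open>The constants \<open>K j\<close> carry no sign; the absolute value makes
    \<open>B\<close> a nonnegative factor.\<close>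
  define B where "B = \<bar>sum K UNIV\<bar>"
  have B: "norm (f x - f y) \<le> B * norm (x - y)" if "norm x < 1" "norm y < 1" for x y
  proof -
    have "norm (f x - f y) \<le> (\<Sum>j\<in>UNIV. \<bar>(f x - f y) $ j\<bar>)" by (rule norm_le_l1_cart)
    also have "\<dots> \<le> (\<Sum>j\<in>UNIV. K j * norm (x - y))" using K[OF that] by (intro sum_mono) simp
    also have "\<dots> = sum K UNIV * norm (x - y)" by (simp add: sum_distrib_right)
    also have "\<dots> \<le> B * norm (x - y)" unfolding B_def by (intro mult_right_mono) auto
    finally show ?thesis .
  qed
  \<comment> \<open>Distances in the ball are at most 2 and \<open>\<omega> t / t\<close> is
    non-increasing, so \<open>t \<le> 2 / \<omega> 2 * \<omega> t\<close> for all of them. The added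
    1 makes \<open>M\<close> positive even if \<open>B = 0\<close>.\<close>
  define M where "M = B * 2 / \<omega> 2 + 1"
  have M: "M > 0" using pos[of 2] by (simp add: M_def B_def add_nonneg_pos)
  have "dist (f x) (f y) / \<omega> (dist x y) \<le> M" if x: "x \<in> ball 0 1" and y: "y \<in> ball 0 1" and ne: "x \<noteq> y" for x y
  proof -
    have d: "dist x y > 0" using ne by simp
    have "dist x y \<le> 2"
      using norm_triangle_ineq4[of x y] x y by (simp add: dist_norm)
    then have "\<omega> 2 / 2 \<le> \<omega> (dist x y) / dist x y"
      by (rule majorant_quotient_antimono[OF assms(2) d])
    then have le: "dist x y \<le> 2 / \<omega> 2 * \<omega> (dist x y)"
      using d pos[of 2] by (simp add: field_simps)
    have "dist (f x) (f y) \<le> B * dist x y" using B[of x y] x y by (simp add: dist_norm)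
    also have "\<dots> \<le> B * (2 / \<omega> 2 * \<omega> (dist x y))" using le by (intro mult_left_mono) (auto simp: B_def)
    also have "\<dots> = (B * 2 / \<omega> 2) * \<omega> (dist x y)" by simp
    also have "\<dots> \<le> M * \<omega> (dist x y)" using pos[OF d] by (intro mult_right_mono) (auto simp: M_def)
    finally show ?thesis using pos[OF d] by (simp add: divide_le_eq)
  qed
  with M show ?thesis unfolding lipschitz_class_def by blast
qed

end
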